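(* Let $K$ be an infinite field of characteristic $p>0$, let $n,r,d$ be positive integers, and let $\lambda=(\lambda_1,\dots,\lambda_n)$ and $\mu=(\mu_1,\dots,\mu_n)$ be partitions of $r$. Put $S=S_K(n,r)$ and $S'=S_K(n,r+p^d)$. Suppose $p^d>\min\{\lambda_2,\mu_1-\lambda_1\}$ and $\mu_2\le\lambda_1$. Then $$\mathrm{Hom}_S(\Delta(\lambda),\Delta(\mu))\simeq \mathrm{Hom}_{S'}(\Delta(\lambda^+),\Delta(\mu^+)).$$
   Context: $S_K(n,r)$ is the Schur algebra of $GL_n(K)$ in degree $r$; its finite dimensional modules are the homogeneous polynomial representations of $GL_n(K)$ of degree $r$. A partition of $r$ with at most $n$ parts is a sequence $\lambda=(\lambda_1\ge\dots\ge\lambda_n\ge0)$ of integers with sum $r$. For such $\lambda$, $\Delta(\lambda)$ is the Weyl module of highest weight $\lambda$, and $\lambda^+=(\lambda_1+p^d,\lambda_2,\dots,\lambda_n)$. Isomorphisms are of $K$-vector spaces. *)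

theory Defs
  imports
    "HOL.Vector_Spaces"
    "HOL-Combinatorics.Permutations"
    "HOL-Library.FuncSet"
    "HOL-Library.Function_Algebras"
begin

section \<open>Linear maps between subspaces\<close>

text \<open>
  A linear map with domain \<open>V\<close> is represented by the HOL function which extends it by \<open>0\<close>
  outside \<open>V\<close>. So distinct functions are distinct maps, and pointwise addition and scaling of
  functions are addition and scaling of maps.
\<close>

definition lin_maps ::
  "('k::field \<Rightarrow> 'v::ab_group_add \<Rightarrow> 'v) \<Rightarrow> ('k \<Rightarrow> 'w::ab_group_add \<Rightarrow> 'w) \<Rightarrow>
   'v set \<Rightarrow> 'w set \<Rightarrow> ('v \<Rightarrow> 'w) set" where
  "lin_maps s t V W = {f \<in> V \<rightarrow> W.
     (\<forall>x\<in>V. \<forall>y\<in>V. f (x + y) = f x + f y) \<and>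
     (\<forall>c. \<forall>x\<in>V. f (s c x) = t c (f x)) \<and>
     (\<forall>x. x \<notin> V \<longrightarrow> f x = 0)}"

definition vs_isomorphic ::
  "('k::field \<Rightarrow> 'v::ab_group_add \<Rightarrow> 'v) \<Rightarrow> ('k \<Rightarrow> 'w::ab_group_add \<Rightarrow> 'w) \<Rightarrow>
   'v set \<Rightarrow> 'w set \<Rightarrow> bool" where
  "vs_isomorphic s t V W \<longleftrightarrow> (\<exists>\<Phi>\<in>lin_maps s t V W. bij_betw \<Phi> V W)"


section \<open>Tensor powers and the Schur algebra\<close>

text \<open>
  Let \<open>E = K\<^sup>n\<close> have the basis \<open>e\<^sub>1, \<dots>, e\<^sub>n\<close>. A tensor in the \<open>r\<close>-th tensor power of \<open>E\<close> is
  represented by its coefficient function: \<open>x [i\<^sub>1, \<dots>, i\<^sub>r]\<close> is the coefficient of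
  \<open>e\<^bsub>i\<^sub>1\<^esub> \<otimes> \<dots> \<otimes> e\<^bsub>i\<^sub>r\<^esub>\<close>.
\<close>

type_synonym 'k tensor = "nat list \<Rightarrow> 'k"

definition tscale :: "'k::field \<Rightarrow> 'k tensor \<Rightarrow> 'k tensor" where
  "tscale c x = (\<lambda>i. c * x i)"

definition multi_indices :: "nat \<Rightarrow> nat \<Rightarrow> nat list set" where
  "multi_indices n r = {i. length i = r \<and> set i \<subseteq> {1..n}}"

definition tensor_power :: "nat \<Rightarrow> nat \<Rightarrow> 'k::field tensor set" where
  "tensor_power n r = {x. \<forall>i. i \<notin> multi_indices n r \<longrightarrow> x i = 0}"

text \<open>The action of a permutation of the tensor positions \<open>{..<r}\<close>.\<close>

definition place_perm :: "(nat \<Rightarrow> nat) \<Rightarrow> 'k::field tensor \<Rightarrow> 'k tensor" where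
  "place_perm \<sigma> x = (\<lambda>i. x (permute_list \<sigma> i))"

text \<open>
  The Schur algebra \<open>S\<^sub>K(n,r)\<close> is the algebra of endomorphisms of the \<open>r\<close>-th tensor power of \<open>E\<close>
  that commute with the symmetric group on the tensor positions. Its product is composition, and
  every \<open>S\<^sub>K(n,r)\<close>-submodule of the tensor power is a module by evaluation.
\<close>

definition schur_algebra :: "nat \<Rightarrow> nat \<Rightarrow> ('k::field tensor \<Rightarrow> 'k tensor) set" where
  "schur_algebra n r = {\<phi> \<in> lin_maps tscale tscale (tensor_power n r) (tensor_power n r).
     \<forall>\<sigma>. \<sigma> permutes {..<r} \<longrightarrow>
       (\<forall>x\<in>tensor_power n r. \<phi> (place_perm \<sigma> x) = place_perm \<sigma> (\<phi> x))}"

definition schur_submodule :: "nat \<Rightarrow> nat \<Rightarrow> 'k::field tensor set \<Rightarrow> bool" where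
  "schur_submodule n r M \<longleftrightarrow> M \<subseteq> tensor_power n r \<and> 0 \<in> M \<and>
     (\<forall>x\<in>M. \<forall>y\<in>M. x + y \<in> M) \<and> (\<forall>c. \<forall>x\<in>M. tscale c x \<in> M) \<and>
     (\<forall>\<phi>\<in>schur_algebra n r. \<forall>x\<in>M. \<phi> x \<in> M)"

definition schur_hom ::
  "nat \<Rightarrow> nat \<Rightarrow> 'k::field tensor set \<Rightarrow> 'k tensor set \<Rightarrow> ('k tensor \<Rightarrow> 'k tensor) set" where
  "schur_hom n r M N = {f \<in> lin_maps tscale tscale M N.
     \<forall>\<phi>\<in>schur_algebra n r. \<forall>x\<in>M. f (\<phi> x) = \<phi> (f x)}"

definition hom_scale ::
  "'k::field \<Rightarrow> ('k tensor \<Rightarrow> 'k tensor) \<Rightarrow> 'k tensor \<Rightarrow> 'k tensor" where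
  "hom_scale c f = (\<lambda>x. tscale c (f x))"


section \<open>Partitions and Weyl modules\<close>

text \<open>
  The parts are \<open>\<lambda> 1, \<dots>, \<lambda> n\<close>; in particular \<open>\<lambda> 2 = 0\<close> if \<open>n = 1\<close>.
\<close>

definition partitions :: "nat \<Rightarrow> nat \<Rightarrow> (nat \<Rightarrow> nat) set" where
  "partitions n r = {la. (\<forall>i. i \<notin> {1..n} \<longrightarrow> la i = 0) \<and>
     (\<forall>i\<in>{1..<n}. la (Suc i) \<le> la i) \<and> (\<Sum>i=1..n. la i) = r}"

text \<open>
  The boxes (row, column) of the Young diagram, read row by row. The \<open>k\<close>-th tensor position is
  placed in the \<open>k\<close>-th box.
\<close>

definition boxes :: "nat \<Rightarrow> (nat \<Rightarrow> nat) \<Rightarrow> (nat \<times> nat) list" where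
  "boxes n la = concat (map (\<lambda>i. map (Pair i) [1..<Suc (la i)]) [1..<Suc n])"

definition row_stabilizer :: "nat \<Rightarrow> nat \<Rightarrow> (nat \<Rightarrow> nat) \<Rightarrow> (nat \<Rightarrow> nat) set" where
  "row_stabilizer n r la = {\<sigma>. \<sigma> permutes {..<r} \<and>
     (\<forall>k<r. fst (boxes n la ! \<sigma> k) = fst (boxes n la ! k))}"

definition col_stabilizer :: "nat \<Rightarrow> nat \<Rightarrow> (nat \<Rightarrow> nat) \<Rightarrow> (nat \<Rightarrow> nat) set" where
  "col_stabilizer n r la = {\<sigma>. \<sigma> permutes {..<r} \<and>
     (\<forall>k<r. snd (boxes n la ! \<sigma> k) = snd (boxes n la ! k))}"

definition col_antisym :: "nat \<Rightarrow> nat \<Rightarrow> (nat \<Rightarrow> nat) \<Rightarrow> 'k::field tensor \<Rightarrow> 'k tensor" where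
  "col_antisym n r la x =
     (\<Sum>\<sigma>\<in>col_stabilizer n r la. tscale (of_int (sign \<sigma>)) (place_perm \<sigma> x))"

text \<open>
  The Weyl module of highest weight \<open>\<lambda>\<close> is the image of the map
  \<open>D\<^bsub>\<lambda>\<^sub>1\<^esub> E \<otimes> \<dots> \<otimes> D\<^bsub>\<lambda>\<^sub>n\<^esub> E \<rightarrow> \<Lambda>\<^bsub>\<lambda>'\<^sub>1\<^esub> E \<otimes> \<Lambda>\<^bsub>\<lambda>'\<^sub>2\<^esub> E \<otimes> \<dots>\<close> which comultiplies along the rows of the
  diagram and multiplies along its columns (\<open>\<lambda>'\<close> being the conjugate partition). Here the divided
  power \<open>D\<^sub>a E\<close> is the space of symmetric tensors of degree \<open>a\<close>, and \<open>\<Lambda>\<^sub>b E\<close> is embedded in the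
  tensor power by \<open>v\<^sub>1 \<and> \<dots> \<and> v\<^sub>b \<mapsto> \<Sum>\<^sub>\<sigma> sign \<sigma> v\<^bsub>\<sigma> 1\<^esub> \<otimes> \<dots> \<otimes> v\<^bsub>\<sigma> b\<^esub>\<close>, which is injective in every
  characteristic.
\<close>

definition weyl_module :: "nat \<Rightarrow> nat \<Rightarrow> (nat \<Rightarrow> nat) \<Rightarrow> 'k::field tensor set" where
  "weyl_module n r la = col_antisym n r la `
     {x \<in> tensor_power n r. \<forall>\<sigma>\<in>row_stabilizer n r la. place_perm \<sigma> x = x}"

text \<open>
  Equivalently (\<open>weyl_module_cyclic\<close> below), the Weyl module is generated by the highest weight
  vector \<open>(e\<^sub>1 \<and> \<dots> \<and> e\<^bsub>\<lambda>'\<^sub>1\<^esub>) \<otimes> (e\<^sub>1 \<and> \<dots> \<and> e\<^bsub>\<lambda>'\<^sub>2\<^esub>) \<otimes> \<dots>\<close>.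
\<close>

definition highest_weight_vector :: "nat \<Rightarrow> nat \<Rightarrow> (nat \<Rightarrow> nat) \<Rightarrow> 'k::field tensor" where
  "highest_weight_vector n r la =
     col_antisym n r la (\<lambda>i. if i = map fst (boxes n la) then 1 else 0)"

subsection \<open>Basic properties\<close>

lemma lin_mapsD:
  assumes "f \<in> lin_maps s t V W"
  shows "x \<in> V \<Longrightarrow> f x \<in> W" "x \<in> V \<Longrightarrow> y \<in> V \<Longrightarrow> f (x + y) = f x + f y"
    "x \<in> V \<Longrightarrow> f (s c x) = t c (f x)" "x \<notin> V \<Longrightarrow> f x = 0"
  using assms by (auto simp: lin_maps_def)

lemma tscale_apply [simp]: "tscale c x i = c * x i"
  by (simp add: tscale_def)

lemma hom_scale_apply [simp]: "hom_scale c f x = tscale c (f x)"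
  by (simp add: hom_scale_def)

lemma vector_space_tscale: "vector_space (tscale :: 'k::field \<Rightarrow> _)"
  by unfold_locales (auto simp: fun_eq_iff algebra_simps)

lemma vector_space_hom_scale: "vector_space (hom_scale :: 'k::field \<Rightarrow> _)"
  by unfold_locales (auto simp: fun_eq_iff algebra_simps)

lemma finite_multi_indices: "finite (multi_indices n r)"
  using finite_lists_length_eq[of "{1..n}" r] by (simp add: multi_indices_def conj_commute)

lemma permute_list_multi_indices:
  assumes "\<sigma> permutes {..<r}"
  shows "permute_list \<sigma> i \<in> multi_indices n r \<longleftrightarrow> i \<in> multi_indices n r"
  using assms by (auto simp: multi_indices_def)

lemma place_perm_tensor_power:
  assumes "\<sigma> permutes {..<r}" "x \<in> tensor_power n r"
  shows "place_perm \<sigma> x \<in> tensor_power n r"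
  using assms by (auto simp: tensor_power_def place_perm_def permute_list_multi_indices)

lemma zero_tensor_power: "0 \<in> tensor_power n r"
  and add_tensor_power: "x \<in> tensor_power n r \<Longrightarrow> y \<in> tensor_power n r \<Longrightarrow> x + y \<in> tensor_power n r"
  and tscale_tensor_power: "x \<in> tensor_power n r \<Longrightarrow> tscale c x \<in> tensor_power n r"
  by (auto simp: tensor_power_def)

lemma sum_tensor_power:
  assumes "\<And>a. a \<in> A \<Longrightarrow> f a \<in> tensor_power n r"
  shows "sum f A \<in> tensor_power n r"
  using assms
  by (induction A rule: infinite_finite_induct) (auto simp: zero_tensor_power intro!: add_tensor_power)

lemma col_antisym_tensor_power:
  assumes "x \<in> tensor_power n r"
  shows "col_antisym n r la x \<in> tensor_power n r"
  unfolding col_antisym_def using assms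
  by (intro sum_tensor_power tscale_tensor_power place_perm_tensor_power)
     (auto simp: col_stabilizer_def)

lemma place_perm_add: "place_perm \<sigma> (x + y) = place_perm \<sigma> x + place_perm \<sigma> y"
  and place_perm_tscale: "place_perm \<sigma> (tscale c x) = tscale c (place_perm \<sigma> x)"
  and place_perm_zero: "place_perm \<sigma> 0 = 0"
  by (auto simp: fun_eq_iff place_perm_def)

lemma tscale_add: "tscale c (x + y) = tscale c x + tscale c y"
  and tscale_commute: "tscale c (tscale d x) = tscale d (tscale c x)"
  and tscale_zero: "tscale c 0 = 0"
  by (auto simp: fun_eq_iff algebra_simps)

lemma tscale_sum: "tscale c (sum f A) = (\<Sum>a\<in>A. tscale c (f a))"
  by (induction A rule: infinite_finite_induct)
     (simp_all only: tscale_add tscale_zero sum.infinite sum.empty sum.insert not_False_eq_True)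

lemma col_antisym_add: "col_antisym n r la (x + y) = col_antisym n r la x + col_antisym n r la y"
  and col_antisym_tscale: "col_antisym n r la (tscale c x) = tscale c (col_antisym n r la x)"
  and col_antisym_zero: "col_antisym n r la 0 = 0"
  by (simp_all add: col_antisym_def place_perm_add place_perm_tscale place_perm_zero tscale_add
      tscale_zero sum.distrib tscale_sum tscale_commute[of c])

lemma schur_algebra_lin:
  "\<phi> \<in> schur_algebra n r \<Longrightarrow> \<phi> \<in> lin_maps tscale tscale (tensor_power n r) (tensor_power n r)"
  and schur_algebra_place_perm:
  "\<phi> \<in> schur_algebra n r \<Longrightarrow> \<sigma> permutes {..<r} \<Longrightarrow> x \<in> tensor_power n r \<Longrightarrow>
     \<phi> (place_perm \<sigma> x) = place_perm \<sigma> (\<phi> x)"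
  by (auto simp: schur_algebra_def)

lemma schur_algebra_zero:
  assumes "\<phi> \<in> schur_algebra n r"
  shows "\<phi> 0 = 0"
  using lin_mapsD(2)[OF schur_algebra_lin[OF assms] zero_tensor_power zero_tensor_power] by simp

lemma schur_algebra_sum:
  assumes \<phi>: "\<phi> \<in> schur_algebra n r" and "\<And>a. a \<in> A \<Longrightarrow> f a \<in> tensor_power n r"
  shows "\<phi> (sum f A) = (\<Sum>a\<in>A. \<phi> (f a))"
  using assms(2)
  by (induction A rule: infinite_finite_induct)
     (simp_all add: schur_algebra_zero[OF \<phi>] lin_mapsD(2)[OF schur_algebra_lin[OF \<phi>]]
        sum_tensor_power)

lemma schur_algebra_col_antisym:
  assumes \<phi>: "\<phi> \<in> schur_algebra n r" and x: "x \<in> tensor_power n r"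
  shows "\<phi> (col_antisym n r la x) = col_antisym n r la (\<phi> x)"
proof -
  have pp: "place_perm \<sigma> x \<in> tensor_power n r" if "\<sigma> \<in> col_stabilizer n r la" for \<sigma>
    using that x by (auto simp: col_stabilizer_def intro: place_perm_tensor_power)
  have "\<phi> (col_antisym n r la x) =
      (\<Sum>\<sigma>\<in>col_stabilizer n r la. \<phi> (tscale (of_int (sign \<sigma>)) (place_perm \<sigma> x)))"
    unfolding col_antisym_def
    by (rule schur_algebra_sum[OF \<phi>]) (simp add: tscale_tensor_power pp)
  also have "\<dots> = col_antisym n r la (\<phi> x)"
    unfolding col_antisym_def
    by (intro sum.cong refl)
       (use pp schur_algebra_place_perm[OF \<phi> _ x] in
         \<open>auto simp: lin_mapsD(3)[OF schur_algebra_lin[OF \<phi>]] col_stabilizer_def\<close>)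
  finally show ?thesis .
qed

lemma schur_submodule_weyl_module:
  "schur_submodule n r (weyl_module n r la :: 'k::field tensor set)"
proof -
  define D :: "'k tensor set" where
    "D = {x \<in> tensor_power n r. \<forall>\<sigma>\<in>row_stabilizer n r la. place_perm \<sigma> x = x}"
  have D: "0 \<in> D" "\<And>x y. x \<in> D \<Longrightarrow> y \<in> D \<Longrightarrow> x + y \<in> D" "\<And>c x. x \<in> D \<Longrightarrow> tscale c x \<in> D"
    by (auto simp: D_def zero_tensor_power add_tensor_power tscale_tensor_power place_perm_add
        place_perm_tscale place_perm_zero)
  have \<phi>D: "\<phi> x \<in> D" if "\<phi> \<in> schur_algebra n r" "x \<in> D" for \<phi> x
  proof -
    have "place_perm \<sigma> (\<phi> x) = \<phi> x" if "\<sigma> \<in> row_stabilizer n r la" for \<sigma>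
      using schur_algebra_place_perm[OF \<open>\<phi> \<in> _\<close>, of \<sigma> x] that \<open>x \<in> D\<close>
      by (auto simp: D_def row_stabilizer_def)
    then show ?thesis
      using that lin_mapsD(1)[OF schur_algebra_lin] by (auto simp: D_def)
  qed
  have W: "weyl_module n r la = col_antisym n r la ` D"
    by (simp add: weyl_module_def D_def)
  have DT: "D \<subseteq> tensor_power n r"
    by (auto simp: D_def)
  show ?thesis
    unfolding schur_submodule_def W
  proof (intro conjI ballI allI)
    show "col_antisym n r la ` D \<subseteq> tensor_power n r"
      using DT by (auto intro: col_antisym_tensor_power)
    show "0 \<in> col_antisym n r la ` D"
      by (rule image_eqI[OF _ D(1)]) (simp add: col_antisym_zero)
  next
    fix x y assume "x \<in> col_antisym n r la ` D" "y \<in> col_antisym n r la ` D"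
    then show "x + y \<in> col_antisym n r la ` D"
      using D(2) by (auto simp flip: col_antisym_add)
  next
    fix c x assume "x \<in> col_antisym n r la ` D"
    then show "tscale c x \<in> col_antisym n r la ` D"
      using D(3) by (auto simp flip: col_antisym_tscale)
  next
    fix \<phi> :: "'k tensor \<Rightarrow> 'k tensor" and x
    assume "\<phi> \<in> schur_algebra n r" "x \<in> col_antisym n r la ` D"
    then show "\<phi> x \<in> col_antisym n r la ` D"
      using DT \<phi>D by (auto simp: schur_algebra_col_antisym subset_iff)
  qed
qed

lemma schur_hom_subspace:
  assumes M: "schur_submodule n r M" and N: "schur_submodule n r N"
  shows "0 \<in> schur_hom n r M N"
    and "f \<in> schur_hom n r M N \<Longrightarrow> g \<in> schur_hom n r M N \<Longrightarrow> f + g \<in> schur_hom n r M N"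
    and "f \<in> schur_hom n r M N \<Longrightarrow> hom_scale c f \<in> schur_hom n r M N"
proof -
  have N': "x \<in> tensor_power n r" if "x \<in> N" for x
    using N that by (auto simp: schur_submodule_def)
  show "0 \<in> schur_hom n r M N"
    using N by (auto simp: schur_hom_def lin_maps_def schur_submodule_def tscale_zero
        schur_algebra_zero)
  show "f + g \<in> schur_hom n r M N" if "f \<in> schur_hom n r M N" "g \<in> schur_hom n r M N"
    using that N
    by (auto simp: schur_hom_def lin_maps_def Pi_iff schur_submodule_def tscale_add N'
        lin_mapsD(2)[OF schur_algebra_lin])
  show "hom_scale c f \<in> schur_hom n r M N" if "f \<in> schur_hom n r M N"
    using that N
    by (auto simp: schur_hom_def lin_maps_def Pi_iff schur_submodule_def tscale_add tscale_zero N'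
        tscale_commute[of c] lin_mapsD(3)[OF schur_algebra_lin])
qed

lemma length_boxes:
  assumes "la \<in> partitions n r"
  shows "length (boxes n la) = r"
  using assms
  by (simp add: boxes_def length_concat comp_def partitions_def sum_list_distinct_conv_sum_set
      atLeastLessThanSuc_atLeastAtMost del: upt_Suc)

lemma set_boxes: "set (boxes n la) = {(i, j). i \<in> {1..n} \<and> j \<in> {1..la i}}"
  by (auto simp: boxes_def image_iff simp del: upt_Suc)

lemma weyl_module_cyclic:
  assumes la: "la \<in> partitions n r"
  shows "(weyl_module n r la :: 'k::field tensor set) =
    (\<lambda>\<phi>. \<phi> (highest_weight_vector n r la)) ` schur_algebra n r"
proof -
  define l where "l = map fst (boxes n la)"
  define e :: "'k tensor" where "e = (\<lambda>i. if i = l then 1 else 0)"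
  have len: "length l = r"
    using length_boxes[OF la] by (simp add: l_def)
  have l: "l \<in> multi_indices n r"
    using set_boxes[of n la] len by (auto simp: multi_indices_def l_def)
  then have eT: "e \<in> tensor_power n r"
    by (auto simp: tensor_power_def e_def)
  have row: "\<sigma> \<in> row_stabilizer n r la \<longleftrightarrow> \<sigma> permutes {..<r} \<and> permute_list \<sigma> l = l" for \<sigma>
  proof -
    have "permute_list \<sigma> l = l \<longleftrightarrow> (\<forall>k<r. fst (boxes n la ! \<sigma> k) = fst (boxes n la ! k))"
      if "\<sigma> permutes {..<r}"
      using that permutes_in_image[OF that] length_boxes[OF la]
      by (auto simp: list_eq_iff_nth_eq len permute_list_nth l_def)
    then show ?thesis
      by (auto simp: row_stabilizer_def)
  qed
  have inv_l: "permute_list (inv \<sigma>) l = l"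
    if "\<sigma> permutes {..<r}" "permute_list \<sigma> l = l" for \<sigma>
  proof -
    have "permute_list (\<sigma> \<circ> inv \<sigma>) l = permute_list (inv \<sigma>) (permute_list \<sigma> l)"
      using that permutes_inv[OF that(1)] by (simp add: permute_list_compose len)
    then show ?thesis
      using that by (simp add: permutes_inv_o)
  qed
  have e_inv: "place_perm \<sigma> e = e" if "\<sigma> \<in> row_stabilizer n r la" for \<sigma>
  proof
    fix i
    have \<sigma>: "\<sigma> permutes {..<r}" "permute_list \<sigma> l = l"
      using that row by auto
    have "permute_list \<sigma> i = l \<longleftrightarrow> i = l"
    proof
      assume *: "permute_list \<sigma> i = l"
      then have "length i = r"
        using len by (metis length_permute_list)
      then have "i = permute_list (inv \<sigma>) (permute_list \<sigma> i)"
        using \<sigma>(1) permutes_inv[OF \<sigma>(1)]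
        by (simp add: permutes_inv_o flip: permute_list_compose)
      also have "\<dots> = l"
        using * inv_l \<sigma> by simp
      finally show "i = l" .
    qed (use \<sigma> in simp)
    then show "place_perm \<sigma> e i = e i"
      by (simp add: place_perm_def e_def)
  qed
  have z: "highest_weight_vector n r la = col_antisym n r la e"
    by (simp add: highest_weight_vector_def e_def l_def)
  have "\<phi> (col_antisym n r la e) \<in> weyl_module n r la" if "\<phi> \<in> schur_algebra n r" for \<phi>
    using schur_submodule_weyl_module[of n r la] that eT e_inv
    by (auto simp: schur_submodule_def weyl_module_def)
  moreover have "\<exists>\<phi>\<in>schur_algebra n r. \<phi> (col_antisym n r la e) = col_antisym n r la x"
    if x: "x \<in> tensor_power n r" and xinv: "\<forall>\<sigma>\<in>row_stabilizer n r la. place_perm \<sigma> x = x" for x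
  proof -
    define S where "S j = {\<sigma>. \<sigma> permutes {..<r} \<and> permute_list \<sigma> j = l}" for j
    define \<xi> where
      "\<xi> i j = (if S j = {} then 0 else x (permute_list (SOME \<sigma>. \<sigma> \<in> S j) i))" for i j
    have xi: "\<xi> i j = x (permute_list \<sigma> i)"
      if \<sigma>: "\<sigma> \<in> S j" and i: "length i = r" and j: "length j = r" for i j \<sigma>
    proof -
      define \<tau> where "\<tau> = (SOME \<sigma>. \<sigma> \<in> S j)"
      have \<tau>: "\<tau> \<in> S j"
        using someI[of "\<lambda>\<sigma>. \<sigma> \<in> S j", OF \<sigma>] by (simp add: \<tau>_def)
      have p: "\<sigma> permutes {..<r}" "\<tau> permutes {..<r}" "permute_list \<sigma> j = l" "permute_list \<tau> j = l"
        using \<sigma> \<tau> by (auto simp: S_def)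
      define \<rho> where "\<rho> = inv \<tau> \<circ> \<sigma>"
      have \<rho>: "\<rho> permutes {..<r}"
        unfolding \<rho>_def by (rule permutes_compose[OF p(1) permutes_inv[OF p(2)]])
      have \<sigma>\<rho>: "\<tau> \<circ> \<rho> = \<sigma>"
        using p(2) by (simp add: \<rho>_def fun_eq_iff permutes_inverses)
      have "permute_list \<rho> l = permute_list (\<tau> \<circ> \<rho>) j"
        using \<rho> p j by (simp add: permute_list_compose)
      then have "\<rho> \<in> row_stabilizer n r la"
        using \<rho> p \<sigma>\<rho> row by simp
      then have "x (permute_list \<rho> (permute_list \<tau> i)) = x (permute_list \<tau> i)"
        using xinv by (metis place_perm_def)
      moreover have "permute_list \<rho> (permute_list \<tau> i) = permute_list \<sigma> i"
        using \<rho> i \<sigma>\<rho> by (metis permute_list_compose)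
      moreover have "\<xi> i j = x (permute_list \<tau> i)"
        using \<sigma> by (auto simp: \<xi>_def \<tau>_def)
      ultimately show ?thesis
        by simp
    qed
    have xi_perm: "\<xi> (permute_list \<tau> i) (permute_list \<tau> j) = \<xi> i j"
      if \<tau>: "\<tau> permutes {..<r}" and i: "length i = r" and j: "length j = r" for i j \<tau>
    proof (cases "S (permute_list \<tau> j) = {}")
      case False
      then obtain \<sigma> where \<sigma>: "\<sigma> \<in> S (permute_list \<tau> j)"
        by blast
      then have "\<tau> \<circ> \<sigma> \<in> S j"
        using \<tau> j by (auto simp: S_def permute_list_compose permutes_compose)
      then have "\<xi> i j = x (permute_list (\<tau> \<circ> \<sigma>) i)"
        using i j by (rule xi)
      then show ?thesis
        using xi[OF \<sigma>, of "permute_list \<tau> i"] \<sigma> i j by (simp add: S_def permute_list_compose)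
    next
      case True
      have "S j = {}"
      proof (rule ccontr)
        assume "S j \<noteq> {}"
        then obtain \<sigma> where \<sigma>: "\<sigma> \<in> S j"
          by blast
        have q: "inv \<tau> \<circ> \<sigma> permutes {..<r}"
          using \<sigma> permutes_compose[OF _ permutes_inv[OF \<tau>]] by (simp add: S_def)
        have "\<tau> \<circ> (inv \<tau> \<circ> \<sigma>) = \<sigma>"
          using \<tau> by (simp add: fun_eq_iff permutes_inverses)
        then have "permute_list (inv \<tau> \<circ> \<sigma>) (permute_list \<tau> j) = l"
          using q j \<sigma> permute_list_compose[of "inv \<tau> \<circ> \<sigma>" j \<tau>] by (simp add: S_def)
        then show False
          using True q by (auto simp: S_def)
      qed
      then show ?thesis
        using True by (simp add: \<xi>_def)
    qed
    define \<phi> :: "'k tensor \<Rightarrow> 'k tensor" where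
      "\<phi> y = (if y \<in> tensor_power n r then
         (\<lambda>i. if i \<in> multi_indices n r then \<Sum>j\<in>multi_indices n r. \<xi> i j * y j else 0) else 0)" for y
    have "\<phi> \<in> lin_maps tscale tscale (tensor_power n r) (tensor_power n r)"
      by (auto simp: lin_maps_def \<phi>_def fun_eq_iff add_tensor_power tscale_tensor_power
          algebra_simps sum.distrib sum_distrib_left intro!: sum.cong)
         (auto simp: tensor_power_def)
    moreover have "\<phi> (place_perm \<tau> y) = place_perm \<tau> (\<phi> y)"
      if \<tau>: "\<tau> permutes {..<r}" and y: "y \<in> tensor_power n r" for \<tau> y
    proof
      fix i
      have bij: "bij_betw (permute_list \<tau>) (multi_indices n r) (multi_indices n r)"
      proof (rule bij_betw_byWitness[where f' = "permute_list (inv \<tau>)"])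
        show "\<forall>i\<in>multi_indices n r. permute_list (inv \<tau>) (permute_list \<tau> i) = i"
          using \<tau> permutes_inv[OF \<tau>]
          by (auto simp: multi_indices_def permutes_inv_o simp flip: permute_list_compose)
        show "\<forall>i\<in>multi_indices n r. permute_list \<tau> (permute_list (inv \<tau>) i) = i"
          using \<tau> permutes_inv[OF \<tau>]
          by (auto simp: multi_indices_def permutes_inv_o simp flip: permute_list_compose)
      qed (use \<tau> permutes_inv[OF \<tau>] in \<open>auto simp: permute_list_multi_indices\<close>)
      have "(\<Sum>j\<in>multi_indices n r. \<xi> (permute_list \<tau> i) j * y j) =
          (\<Sum>j\<in>multi_indices n r. \<xi> i j * y (permute_list \<tau> j))"
        if i: "i \<in> multi_indices n r"
        by (subst sum.reindex_bij_betw[OF bij, symmetric], intro sum.cong refl)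
           (use xi_perm[OF \<tau>] i in \<open>auto simp: multi_indices_def\<close>)
      then show "\<phi> (place_perm \<tau> y) i = place_perm \<tau> (\<phi> y) i"
        using y place_perm_tensor_power[OF \<tau> y]
        by (auto simp: \<phi>_def place_perm_def permute_list_multi_indices[OF \<tau>])
    qed
    ultimately have \<phi>: "\<phi> \<in> schur_algebra n r"
      by (simp add: schur_algebra_def)
    have "\<phi> e = x"
    proof
      fix i
      have "id \<in> S l"
        by (simp add: S_def permutes_id)
      then have "\<xi> i l = x i" if "i \<in> multi_indices n r"
        using xi[of id l i] that len by (simp add: multi_indices_def)
      moreover have "(\<Sum>j\<in>multi_indices n r. \<xi> i j * e j) = \<xi> i l"
        using l by (simp add: e_def if_distrib sum.delta finite_multi_indices cong: if_cong)
      ultimately show "\<phi> e i = x i"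
        using eT x by (auto simp: \<phi>_def tensor_power_def)
    qed
    then show ?thesis
      using \<phi> schur_algebra_col_antisym[OF \<phi> eT] by auto
  qed
  then have "col_antisym n r la x \<in> (\<lambda>\<phi>. \<phi> (col_antisym n r la e)) ` schur_algebra n r"
    if "x \<in> tensor_power n r" and "\<forall>\<sigma>\<in>row_stabilizer n r la. place_perm \<sigma> x = x" for x
    using that by (metis image_eqI)
  then have "weyl_module n r la \<subseteq> (\<lambda>\<phi>. \<phi> (col_antisym n r la e)) ` schur_algebra n r"
    unfolding weyl_module_def by blast
  ultimately show ?thesis
    unfolding z by blast
qed

end

theory Submission
  imports
    Defs
    "HOL-Library.List_Lexorder"
    "HOL-Computational_Algebra.Primes"
begin

text \<open>
  Evaluation at the highest weight vector identifies the homomorphisms from \<open>\<Delta>(\<lambda>)\<close> to a submodule \<open>M\<close>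
  of the tensor power with the vectors of weight \<open>\<lambda>\<close> in \<open>M\<close> that are killed by all divided powers
  \<open>e\<^sub>i\<^sup>(\<^sup>t\<^sup>)\<close> of the raising operators. The nontrivial half of this is James's kernel intersection theorem:
  such a vector is a combination of place permutations of the highest weight vector. Combinations
  of place permutations commute with the Schur algebra, so they define homomorphisms.

  Put \<open>q = p\<^sup>d\<close>. The diagram of \<open>\<mu>\<^sup>+\<close> has \<open>q\<close> more columns than that of \<open>\<mu>\<close>, all of height one. Taking the
  component with a \<open>1\<close> in each of them maps \<open>\<Delta>(\<mu>\<^sup>+)\<close> onto \<open>\<Delta>(\<mu>)\<close>. As \<open>\<mu>\<^sub>2 \<le> \<lambda>\<^sub>1\<close>, an exchange relation
  between columns makes this map injective on the weight spaces in question. It commutes with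
  \<open>e\<^sub>i\<^sup>(\<^sup>t\<^sup>)\<close> for \<open>i \<ge> 2\<close>, and with \<open>e\<^sub>1\<^sup>(\<^sup>t\<^sup>)\<close> for \<open>t < q\<close> because \<open>p\<close> divides \<open>q choose j\<close> for \<open>0 < j < q\<close>. For
  \<open>t \<ge> q\<close> both operators \<open>e\<^sub>1\<^sup>(\<^sup>t\<^sup>)\<close> vanish for weight reasons, by the hypothesis on \<open>p\<^sup>d\<close>.
\<close>

section \<open>Antisymmetrization over label-preserving permutations\<close>

text \<open>Surjectivity of the truncation is what requires injectivity on several weight spaces. A
  primitive vector of \<open>\<Delta>(\<mu>)\<close> lifts to some \<open>y\<close> of the extended
  weight, but nothing in its construction makes \<open>y\<close> primitive: one only knows that the
  raised vectors have truncation zero. So truncation has to be injective also where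
  \<open>raising_op\<close> with \<open>i = 1\<close> sends \<open>y\<close>, that is, on words with
  \<open>la 1 + t + q\<close> letters 1. By \<open>mu 2 \<le> la 1\<close> such words have enough
  letters 1 to fill the top of each of the \<open>mu 2\<close> columns of height at least two and
  all \<open>q\<close> new boxes; exchanges can then bring ones into all new boxes, where truncation
  sees the coefficient.

  The hypothesis on \<open>p ^ d\<close> offers two alternatives, and each stops the raising
  operator with \<open>i = 1\<close> and \<open>t \<ge> q\<close>: either there are fewer than
  \<open>t\<close> letters 2 to be raised (\<open>la 2 < q\<close>), or the result would need more
  letters 1 than the diagram has columns (\<open>mu 1 < la 1 + q\<close>).

  Characteristic 2 is included, so no vanishing is ever deduced from \<open>x = - x\<close>;
  cancellation always pairs even with odd permutations.\<close>

text \<open>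
  Boxes of a diagram enter only through their row and column labels, given as lists indexed by
  tensor positions. So a diagram may be read in any order.
\<close>

definition label_stab :: "'a list \<Rightarrow> (nat \<Rightarrow> nat) set" where
  "label_stab L = {\<sigma>. \<sigma> permutes {..<length L} \<and> permute_list \<sigma> L = L}"

definition label_antisym :: "'a list \<Rightarrow> 'k::field tensor \<Rightarrow> 'k tensor" where
  "label_antisym L x = (\<Sum>\<sigma>\<in>label_stab L. tscale (of_int (sign \<sigma>)) (place_perm \<sigma> x))"

lemma permute_list_eq_iff:
  assumes "\<sigma> permutes {..<length L}"
  shows "permute_list \<sigma> L = L \<longleftrightarrow> (\<forall>k<length L. L ! \<sigma> k = L ! k)"
  using assms by (auto simp: list_eq_iff_nth_eq permute_list_nth)

lemma label_stab_iff:
  "\<sigma> \<in> label_stab L \<longleftrightarrow> \<sigma> permutes {..<length L} \<and> (\<forall>k<length L. L ! \<sigma> k = L ! k)"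
  by (auto simp: label_stab_def permute_list_eq_iff)

lemma label_stab_permutes: "\<sigma> \<in> label_stab L \<Longrightarrow> \<sigma> permutes {..<length L}"
  by (simp add: label_stab_def)

lemma finite_label_stab: "finite (label_stab L)"
  by (rule finite_subset[of _ "{\<sigma>. \<sigma> permutes {..<length L}}"])
     (auto simp: label_stab_def finite_permutations)

lemma permutes_permutation: "\<sigma> permutes {..<r::nat} \<Longrightarrow> permutation \<sigma>"
  by (rule permutes_imp_permutation) auto

lemma sum_tensor_apply: "(\<Sum>a\<in>A. f a) u = (\<Sum>a\<in>A. f a u)" for f :: "'a \<Rightarrow> 'k::field tensor"
  by (induction A rule: infinite_finite_induct) auto

lemma label_antisym_apply:
  "label_antisym L x u = (\<Sum>\<sigma>\<in>label_stab L. of_int (sign \<sigma>) * x (permute_list \<sigma> u))"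
  by (simp add: label_antisym_def sum_tensor_apply place_perm_def)

lemma id_label_stab: "id \<in> label_stab L"
  by (simp add: label_stab_def permutes_id)

lemma label_stab_compose:
  assumes "\<sigma> \<in> label_stab L" "\<tau> \<in> label_stab L"
  shows "\<sigma> \<circ> \<tau> \<in> label_stab L"
  using assms by (auto simp: label_stab_def permute_list_compose permutes_compose)

lemma label_stab_inv:
  assumes "\<sigma> \<in> label_stab L"
  shows "inv \<sigma> \<in> label_stab L"
proof -
  have \<sigma>: "\<sigma> permutes {..<length L}" "permute_list \<sigma> L = L"
    using assms by (auto simp: label_stab_def)
  have "permute_list (inv \<sigma>) (permute_list \<sigma> L) = L"
    using \<sigma>(1) permutes_inv[OF \<sigma>(1)]
    by (simp add: permutes_inv_o flip: permute_list_compose)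
  then show ?thesis
    using \<sigma> permutes_inv[OF \<sigma>(1)] by (simp add: label_stab_def)
qed

lemma label_stab_transpose:
  assumes "a < length L" "b < length L" "L ! a = L ! b"
  shows "transpose a b \<in> label_stab L"
  using assms permutes_swap_id[of a "{..<length L}" b] by (auto simp: label_stab_iff transpose_def)

lemma permute_list_transpose_id:
  assumes "a < length w" "b < length w" "w ! a = w ! b"
  shows "permute_list (transpose a b) w = w"
  using label_stab_transpose[OF assms] by (simp add: label_stab_def)

text \<open>The involution \<open>h\<close> pairs even with odd elements, and paired terms cancel.
  Comparing the sum with its own negative would only show that twice the sum is zero, which is empty
  in characteristic 2; hence the explicit split into \<open>?E\<close> and
  \<open>?O\<close>.\<close>

lemma sign_sum_zero:
  fixes F :: "(nat \<Rightarrow> nat) \<Rightarrow> 'k::ring_1"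
  assumes fin: "finite U"
    and closed: "\<And>g. g \<in> U \<Longrightarrow> h g \<in> U" and invol: "\<And>g. g \<in> U \<Longrightarrow> h (h g) = g"
    and sign: "\<And>g. g \<in> U \<Longrightarrow> sign (h g) = - sign g" and F: "\<And>g. g \<in> U \<Longrightarrow> F (h g) = F g"
  shows "(\<Sum>g\<in>U. of_int (sign g) * F g) = 0"
proof -
  let ?E = "{g \<in> U. sign g = 1}" and ?O = "{g \<in> U. sign g = - 1}"
  have U: "U = ?E \<union> ?O"
    by (auto intro: sign_cases)
  have bij: "bij_betw h ?E ?O"
    by (rule bij_betw_byWitness[where f' = h]) (auto simp: closed invol sign)
  have "(\<Sum>g\<in>U. of_int (sign g) * F g) = (\<Sum>g\<in>?E. of_int (sign g) * F g) + (\<Sum>g\<in>?O. of_int (sign g) * F g)"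
    by (subst U, subst sum.union_disjoint) (use fin in auto)
  also have "(\<Sum>g\<in>?O. of_int (sign g) * F g) = (\<Sum>g\<in>?E. of_int (sign (h g)) * F (h g))"
    by (rule sum.reindex_bij_betw[OF bij, symmetric])
  also have "\<dots> = - (\<Sum>g\<in>?E. of_int (sign g) * F g)"
    by (subst sum_negf[symmetric], rule sum.cong) (auto simp: sign F)
  finally show ?thesis by simp
qed

lemma sign_transpose_compose:
  assumes "\<sigma> permutes {..<r::nat}" "a \<noteq> b"
  shows "sign (transpose a b \<circ> \<sigma>) = - sign \<sigma>" "sign (\<sigma> \<circ> transpose a b) = - sign \<sigma>"
  using permutes_permutation[OF assms(1)] assms(2)
  by (simp_all add: sign_compose permutation_swap_id sign_swap_id)

text \<open>Coefficient form of the rule that a wedge product with a repeated factor is zero: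
  composing on the left with \<open>transpose a b\<close> reverses the sign and does not change the
  word read off from \<open>w\<close>.\<close>

lemma label_antisym_eq_0:
  assumes "a < length L" "b < length L" "a \<noteq> b" "L ! a = L ! b" "length w = length L" "w ! a = w ! b"
  shows "label_antisym L x w = 0"
  unfolding label_antisym_apply
proof (rule sign_sum_zero[where h = "\<lambda>\<sigma>. transpose a b \<circ> \<sigma>"])
  fix \<sigma> assume \<sigma>: "\<sigma> \<in> label_stab L"
  show "transpose a b \<circ> \<sigma> \<in> label_stab L"
    using assms \<sigma> by (intro label_stab_compose label_stab_transpose) auto
  show "transpose a b \<circ> (transpose a b \<circ> \<sigma>) = \<sigma>"
    by (simp add: fun_eq_iff)
  show "sign (transpose a b \<circ> \<sigma>) = - sign \<sigma>"
    by (rule sign_transpose_compose[OF label_stab_permutes[OF \<sigma>] assms(3)])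
  have "permute_list (transpose a b \<circ> \<sigma>) w = permute_list \<sigma> (permute_list (transpose a b) w)"
    using label_stab_permutes[OF \<sigma>] assms by (simp add: permute_list_compose)
  then show "x (permute_list (transpose a b \<circ> \<sigma>) w) = x (permute_list \<sigma> w)"
    using assms by (simp add: permute_list_transpose_id)
qed (rule finite_label_stab)

lemma bij_label_stab_left:
  assumes "\<sigma> \<in> label_stab L"
  shows "bij_betw (\<lambda>\<tau>. \<sigma> \<circ> \<tau>) (label_stab L) (label_stab L)"
proof (rule bij_betw_byWitness[where f' = "\<lambda>\<tau>. inv \<sigma> \<circ> \<tau>"])
  have "\<sigma> permutes {..<length L}"
    using assms by (rule label_stab_permutes)
  note * = permutes_inverses[OF this]
  show "\<forall>\<tau>\<in>label_stab L. inv \<sigma> \<circ> (\<sigma> \<circ> \<tau>) = \<tau>" "\<forall>\<tau>\<in>label_stab L. \<sigma> \<circ> (inv \<sigma> \<circ> \<tau>) = \<tau>"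
    by (auto simp: fun_eq_iff *)
qed (use assms label_stab_compose label_stab_inv in blast)+

lemma label_antisym_permute:
  fixes x :: "'k::field tensor"
  assumes \<sigma>: "\<sigma> \<in> label_stab L" and w: "length w = length L"
  shows "label_antisym L x (permute_list \<sigma> w) = of_int (sign \<sigma>) * label_antisym L x w"
proof -
  have "of_int (sign \<sigma>) * label_antisym L x w =
      (\<Sum>\<tau>\<in>label_stab L. of_int (sign \<sigma>) * (of_int (sign (\<sigma> \<circ> \<tau>)) * x (permute_list (\<sigma> \<circ> \<tau>) w)))"
    unfolding label_antisym_apply sum_distrib_left
    by (rule sum.reindex_bij_betw[OF bij_label_stab_left[OF \<sigma>], symmetric])
  also have "\<dots> = label_antisym L x (permute_list \<sigma> w)"
    unfolding label_antisym_apply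
  proof (intro sum.cong refl)
    fix \<tau> assume \<tau>: "\<tau> \<in> label_stab L"
    have "permute_list (\<sigma> \<circ> \<tau>) w = permute_list \<tau> (permute_list \<sigma> w)"
      using label_stab_permutes[OF \<tau>] w by (simp add: permute_list_compose)
    moreover have "sign \<sigma> * sign (\<sigma> \<circ> \<tau>) = sign \<tau>"
      using permutes_permutation[OF label_stab_permutes[OF \<sigma>]]
        permutes_permutation[OF label_stab_permutes[OF \<tau>]] by (simp add: sign_compose)
    then have "(of_int (sign \<sigma>) * of_int (sign (\<sigma> \<circ> \<tau>)) :: 'k) = of_int (sign \<tau>)"
      by (metis of_int_mult)
    ultimately show "of_int (sign \<sigma>) * (of_int (sign (\<sigma> \<circ> \<tau>)) * x (permute_list (\<sigma> \<circ> \<tau>) w)) =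
        of_int (sign \<tau>) * x (permute_list \<tau> (permute_list \<sigma> w))"
      by (metis mult.assoc)
  qed
  finally show ?thesis ..
qed

lemma label_antisym_transpose:
  assumes "a < length L" "b < length L" "a \<noteq> b" "L ! a = L ! b" "length w = length L"
  shows "label_antisym L x (permute_list (transpose a b) w) = - label_antisym L x w"
  using label_antisym_permute[OF label_stab_transpose, of a L b w x] assms by (simp add: sign_swap_id)

text \<open>
  Merge the column of \<open>a\<close> with the column of \<open>m\<close>, which has height one. The antisymmetrization over the
  merged column kills \<open>x\<close>, since \<open>x\<close> is invariant under \<open>transpose a m\<close>; expand it along cosets.
\<close>

lemma exchange_relation:
  fixes x :: "'k::field tensor"
  assumes sym: "\<And>\<sigma>. \<sigma> \<in> label_stab R \<Longrightarrow> place_perm \<sigma> x = x"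
    and len: "length R = length C" "length u = length C"
    and m: "m < length C" "\<And>k. k < length C \<Longrightarrow> C ! k = C ! m \<Longrightarrow> k = m"
    and a: "a < length C" "a \<noteq> m" "R ! a = R ! m"
  shows "label_antisym C x u =
    (\<Sum>b | b < length C \<and> C ! b = C ! a. label_antisym C x (permute_list (transpose m b) u))"
proof -
  define C' where "C' = C[m := C ! a]"
  define X where "X = {b. b < length C \<and> C ! b = C ! a}"
  have mX: "m \<notin> X"
    using m(2)[of a] a by (auto simp: X_def)
  have C'_nth: "C' ! k = (if k = m then C ! a else C ! k)" if "k < length C" for k
    using that by (simp add: C'_def nth_list_update)
  have lenC': "length C' = length C"
    by (simp add: C'_def)
  have C'X: "C' ! k = C ! a \<longleftrightarrow> k \<in> insert m X" if "k < length C" for k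
    using that by (auto simp: C'_nth X_def)
  have s: "transpose a m \<in> label_stab C'"
    by (rule label_stab_transpose) (use m a in \<open>auto simp: lenC' C'_nth\<close>)
  have s': "transpose a m \<in> label_stab R"
    by (rule label_stab_transpose) (use m a len in auto)
  have 0: "(\<Sum>g\<in>label_stab C'. of_int (sign g) * x (permute_list g u)) = 0"
  proof (rule sign_sum_zero[where h = "\<lambda>g. g \<circ> transpose a m"])
    fix g assume g: "g \<in> label_stab C'"
    show "g \<circ> transpose a m \<in> label_stab C'"
      by (rule label_stab_compose[OF g s])
    show "g \<circ> transpose a m \<circ> transpose a m = g"
      by (simp add: fun_eq_iff)
    show "sign (g \<circ> transpose a m) = - sign g"
      by (rule sign_transpose_compose(2)[OF label_stab_permutes[OF g] a(2)])
    have "permute_list (g \<circ> transpose a m) u = permute_list (transpose a m) (permute_list g u)"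
      using label_stab_permutes[OF s] len lenC' by (simp add: permute_list_compose)
    then show "x (permute_list (g \<circ> transpose a m) u) = x (permute_list g u)"
      using sym[OF s'] by (metis place_perm_def)
  qed (rule finite_label_stab)
  have fix_m: "\<sigma> m = m" if "\<sigma> \<in> label_stab C" for \<sigma>
    using that m permutes_in_image[OF label_stab_permutes[OF that], of m] by (auto simp: label_stab_iff)
  have tX: "transpose m b \<in> label_stab C'" if "b \<in> insert m X" for b
    by (rule label_stab_transpose) (use that m in \<open>auto simp: lenC' C'_nth X_def\<close>)
  have sub: "\<sigma> \<in> label_stab C'" if "\<sigma> \<in> label_stab C" for \<sigma>
  proof -
    have p: "\<sigma> permutes {..<length C}"
      using that by (rule label_stab_permutes)
    have "C' ! \<sigma> k = C' ! k" if "k < length C" for k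
      using that p fix_m[OF \<open>\<sigma> \<in> _\<close>] permutes_in_image[OF p, of k] \<open>\<sigma> \<in> _\<close> permutes_inj[OF p]
      by (auto simp: C'_nth label_stab_iff inj_def)
    then show ?thesis
      using p by (simp add: label_stab_iff lenC')
  qed
  \<comment> \<open>Cosets of \<open>label_stab C\<close> in \<open>label_stab C'\<close>: the
    smaller group fixes \<open>m\<close>, so the coset of \<open>g\<close> is determined by
    \<open>g m\<close>, and \<open>transpose m (g m)\<close> represents it.\<close>
  have bij: "bij_betw (\<lambda>(b, \<sigma>). transpose m b \<circ> \<sigma>) (insert m X \<times> label_stab C) (label_stab C')"
  proof (rule bij_betw_byWitness[where f' = "\<lambda>g. (g m, transpose m (g m) \<circ> g)"])
    show "\<forall>a\<in>insert m X \<times> label_stab C.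
       (\<lambda>g. (g m, transpose m (g m) \<circ> g)) (case a of (b, \<sigma>) \<Rightarrow> transpose m b \<circ> \<sigma>) = a"
      by (auto simp: fix_m fun_eq_iff)
    show "\<forall>a'\<in>label_stab C'. (case (a' m, transpose m (a' m) \<circ> a') of (b, \<sigma>) \<Rightarrow> transpose m b \<circ> \<sigma>) = a'"
      by (auto simp: fun_eq_iff)
    show "(\<lambda>(b, \<sigma>). transpose m b \<circ> \<sigma>) ` (insert m X \<times> label_stab C) \<subseteq> label_stab C'"
      using tX sub by (auto intro!: label_stab_compose)
    show "(\<lambda>g. (g m, transpose m (g m) \<circ> g)) ` label_stab C' \<subseteq> insert m X \<times> label_stab C"
    proof (intro image_subsetI SigmaI)
      fix g assume g: "g \<in> label_stab C'"
      have gp: "g permutes {..<length C}"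
        using label_stab_permutes[OF g] by (simp add: lenC')
      have gm: "g m < length C"
        using permutes_in_image[OF gp, of m] m by auto
      show gX: "g m \<in> insert m X"
        using C'X[OF gm] g m C'_nth[of m] by (simp add: label_stab_iff lenC')
      let ?h = "transpose m (g m) \<circ> g"
      have h: "?h \<in> label_stab C'"
        by (rule label_stab_compose[OF tX[OF gX] g])
      have hp: "?h permutes {..<length C}"
        using label_stab_permutes[OF h] by (simp add: lenC')
      have hm: "?h m = m" by simp
      have "C ! ?h k = C ! k" if k: "k < length C" for k
      proof (cases "k = m")
        case False
        then have "?h k \<noteq> m"
          using permutes_inj[OF hp] hm by (metis injD)
        moreover have "?h k < length C"
          using permutes_in_image[OF hp, of k] k by auto
        moreover have "C' ! ?h k = C' ! k"
          using h k lenC' unfolding label_stab_iff by metis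
        ultimately show ?thesis
          using k False by (simp only: C'_nth if_False)
      qed (simp add: hm)
      then show "?h \<in> label_stab C"
        unfolding label_stab_iff using hp by blast
    qed
  qed
  \<comment> \<open>The coset \<open>b = m\<close> is the trivial one, since
    \<open>transpose m m\<close> is the identity; it yields the left side of the relation. All other
    representatives are odd and yield the exchanged terms with a minus sign.\<close>
  have y: "(\<Sum>\<sigma>\<in>label_stab C. of_int (sign (transpose m b \<circ> \<sigma>)) * x (permute_list (transpose m b \<circ> \<sigma>) u)) =
      (if b = m then 1 else - 1) * label_antisym C x (permute_list (transpose m b) u)" for b
    unfolding label_antisym_apply sum_distrib_left
  proof (intro sum.cong refl)
    fix \<sigma> assume \<sigma>: "\<sigma> \<in> label_stab C"
    have p: "\<sigma> permutes {..<length C}"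
      by (rule label_stab_permutes[OF \<sigma>])
    have "permute_list (transpose m b \<circ> \<sigma>) u = permute_list \<sigma> (permute_list (transpose m b) u)"
      using p len by (simp add: permute_list_compose)
    then show "of_int (sign (transpose m b \<circ> \<sigma>)) * x (permute_list (transpose m b \<circ> \<sigma>) u) =
        (if b = m then 1 else - 1) *
        (of_int (sign \<sigma>) * x (permute_list \<sigma> (permute_list (transpose m b) u)))"
      using permutes_permutation[OF p]
      by (simp add: sign_compose permutation_swap_id sign_swap_id)
  qed
  have fX: "finite X" by (simp add: X_def)
  have "0 = (\<Sum>(b, \<sigma>)\<in>insert m X \<times> label_stab C.
      of_int (sign (transpose m b \<circ> \<sigma>)) * x (permute_list (transpose m b \<circ> \<sigma>) u))"
    unfolding 0[symmetric] by (subst sum.reindex_bij_betw[OF bij, symmetric]) (simp add: case_prod_beta)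
  also have "\<dots> = (\<Sum>b\<in>insert m X. (if b = m then 1 else - 1) * label_antisym C x (permute_list (transpose m b) u))"
    by (simp only: sum.cartesian_product[symmetric] y)
  also have "\<dots> = label_antisym C x u - (\<Sum>b\<in>X. label_antisym C x (permute_list (transpose m b) u))"
  proof -
    have "(\<Sum>b\<in>X. (if b = m then 1 else - 1) * label_antisym C x (permute_list (transpose m b) u)) =
        (\<Sum>b\<in>X. - label_antisym C x (permute_list (transpose m b) u))"
      by (rule sum.cong) (use mX in auto)
    then show ?thesis
      using mX fX by (simp add: sum_negf)
  qed
  finally show ?thesis
    by (simp add: X_def)
qed

section \<open>Divided powers of the raising operators\<close>

definition weight_words :: "nat \<Rightarrow> (nat \<Rightarrow> nat) \<Rightarrow> nat list set" where
  "weight_words r la = {u. length u = r \<and> (\<forall>i. count_list u i = la i)}"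

definition change_letters :: "nat set \<Rightarrow> nat \<Rightarrow> nat list \<Rightarrow> nat list" where
  "change_letters S c u = map (\<lambda>p. if p \<in> S then c else u ! p) [0..<length u]"

definition letter_positions :: "nat \<Rightarrow> nat list \<Rightarrow> nat set" where
  "letter_positions i u = {p. p < length u \<and> u ! p = i}"

text \<open>
  The divided power \<open>e\<^sub>i\<^sup>(\<^sup>t\<^sup>)\<close>. It turns \<open>t\<close> letters \<open>i + 1\<close> into \<open>i\<close>; on coefficient functions, the
  change of letters goes the other way.
\<close>

definition raising_op :: "nat \<Rightarrow> nat \<Rightarrow> nat \<Rightarrow> nat \<Rightarrow> 'k::field tensor \<Rightarrow> 'k tensor" where
  "raising_op n r i t x = (if x \<in> tensor_power n r then
     (\<lambda>u. \<Sum>S | S \<subseteq> letter_positions i u \<and> card S = t. x (change_letters S (Suc i) u)) else 0)"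

text \<open>The idempotent of the Schur algebra that belongs to the weight \<open>la\<close>. The
  value 0 off the tensor power follows the convention of \<open>lin_maps\<close>, as in
  \<open>raising_op\<close>.\<close>

definition weight_proj :: "nat \<Rightarrow> nat \<Rightarrow> (nat \<Rightarrow> nat) \<Rightarrow> 'k::field tensor \<Rightarrow> 'k tensor" where
  "weight_proj n r la x = (if x \<in> tensor_power n r then
     (\<lambda>u. if u \<in> weight_words r la then x u else 0) else 0)"

text \<open>Also called singular or maximal vectors. All divided powers are needed: the
  \<open>t\<close>-th power of the first raising operator is \<open>t!\<close> times the divided
  power, so it gives no information once the characteristic divides \<open>t!\<close>.\<close>

definition primitive_vectors ::
  "nat \<Rightarrow> nat \<Rightarrow> (nat \<Rightarrow> nat) \<Rightarrow> 'k::field tensor set \<Rightarrow> 'k tensor set" where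
  "primitive_vectors n r la M = {v \<in> M. (\<forall>u. u \<notin> weight_words r la \<longrightarrow> v u = 0) \<and>
     (\<forall>i\<in>{1..<n}. \<forall>t\<ge>1. raising_op n r i t v = 0)}"

lemma length_change_letters [simp]: "length (change_letters S c u) = length u"
  by (simp add: change_letters_def)

lemma nth_change_letters [simp]:
  "p < length u \<Longrightarrow> change_letters S c u ! p = (if p \<in> S then c else u ! p)"
  by (simp add: change_letters_def)

lemma finite_letter_positions [simp]: "finite (letter_positions i u)"
  by (simp add: letter_positions_def)

lemma card_letter_positions: "card (letter_positions i u) = count_list u i"
  by (simp add: letter_positions_def count_list_eq_length_filter length_filter_conv_card eq_commute)

lemma count_list_mset_cong: "mset u = mset w \<Longrightarrow> count_list u i = count_list w i"
  by (simp flip: count_mset)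

lemma weight_words_permute:
  assumes "\<sigma> permutes {..<r}"
  shows "permute_list \<sigma> u \<in> weight_words r la \<longleftrightarrow> u \<in> weight_words r la"
  using assms count_list_mset_cong[of "permute_list \<sigma> u" u] by (auto simp: weight_words_def)

lemma weight_words_multi_indices:
  assumes "la \<in> partitions n r"
  shows "weight_words r la \<subseteq> multi_indices n r"
proof
  fix u assume u: "u \<in> weight_words r la"
  have "i \<in> {1..n}" if "i \<in> set u" for i
  proof (rule ccontr)
    assume "i \<notin> {1..n}"
    then have "count_list u i = 0"
      using u assms by (auto simp: weight_words_def partitions_def)
    then show False
      using that by (simp add: count_list_0_iff)
  qed
  then show "u \<in> multi_indices n r"
    using u by (auto simp: multi_indices_def weight_words_def)
qed

lemma tensor_power_length: "x \<in> tensor_power n r \<Longrightarrow> x u \<noteq> 0 \<Longrightarrow> length u = r"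
  by (auto simp: tensor_power_def multi_indices_def)

lemma place_perm_compose:
  assumes "\<tau> permutes {..<r}" "x \<in> tensor_power n r"
  shows "place_perm \<sigma> (place_perm \<tau> x) = place_perm (\<sigma> \<circ> \<tau>) x"
proof
  fix u
  show "place_perm \<sigma> (place_perm \<tau> x) u = place_perm (\<sigma> \<circ> \<tau>) x u"
  proof (cases "length u = r")
    case True
    then show ?thesis
      using assms(1) by (simp add: place_perm_def permute_list_compose)
  next
    case False
    then show ?thesis
      using tensor_power_length[OF assms(2)] by (metis length_permute_list place_perm_def)
  qed
qed

lemma place_perm_inverse:
  assumes "\<sigma> permutes {..<r}" "x \<in> tensor_power n r"
  shows "place_perm \<sigma> (place_perm (inv \<sigma>) x) = x" "place_perm (inv \<sigma>) (place_perm \<sigma> x) = x"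
  using assms permutes_inv[OF assms(1)]
  by (simp_all add: place_perm_compose[of _ r _ n] permutes_inv_o) (simp_all add: place_perm_def)

lemma letter_positions_permute:
  assumes "\<sigma> permutes {..<length u}"
  shows "letter_positions i (permute_list \<sigma> u) = \<sigma> -` letter_positions i u"
proof (intro set_eqI)
  fix k
  have "\<sigma> k < length u \<longleftrightarrow> k < length u"
    using permutes_in_image[OF assms, of k] by simp
  then show "k \<in> letter_positions i (permute_list \<sigma> u) \<longleftrightarrow> k \<in> \<sigma> -` letter_positions i u"
    using assms by (auto simp: letter_positions_def permute_list_nth)
qed

lemma permute_change_letters:
  assumes "\<sigma> permutes {..<length u}"
  shows "permute_list \<sigma> (change_letters S c u) = change_letters (\<sigma> -` S) c (permute_list \<sigma> u)"
proof (rule nth_equalityI)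
  fix k assume "k < length (permute_list \<sigma> (change_letters S c u))"
  then show "permute_list \<sigma> (change_letters S c u) ! k =
      change_letters (\<sigma> -` S) c (permute_list \<sigma> u) ! k"
    using permutes_in_image[OF assms, of k] assms by (simp add: permute_list_nth)
qed simp

text \<open>Summing over all \<open>t\<close>-subsets makes the operator blind to the order of the
  positions: a place permutation \<open>\<sigma>\<close> merely replaces each \<open>S\<close> by
  its preimage. The bounds on \<open>i\<close> keep both letters \<open>i\<close> and
  \<open>Suc i\<close> in the alphabet.\<close>

lemma raising_op_schur:
  assumes i: "1 \<le> i" "i < n"
  shows "raising_op n r i t \<in> schur_algebra n r"
proof -
  have T: "raising_op n r i t x \<in> tensor_power n r" for x :: "'a tensor"
  proof (cases "x \<in> tensor_power n r")
    case x: True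
    \<comment> \<open>Only letters \<open>i\<close> are altered, and these are admissible anyway; so
      a letter of \<open>u\<close> outside the alphabet survives the change.\<close>
    have "x (change_letters S (Suc i) u) = 0"
      if "u \<notin> multi_indices n r" "S \<subseteq> letter_positions i u" for u S
    proof -
      have "change_letters S (Suc i) u \<notin> multi_indices n r"
      proof
        assume *: "change_letters S (Suc i) u \<in> multi_indices n r"
        then have len: "length u = r"
          by (simp add: multi_indices_def)
        have "u ! p \<in> {1..n}" if p: "p < r" for p
        proof (cases "p \<in> S")
          case True
          then show ?thesis
            using \<open>S \<subseteq> _\<close> i by (auto simp: letter_positions_def)
        next
          case False
          have "change_letters S (Suc i) u ! p \<in> set (change_letters S (Suc i) u)"
            using p len by (intro nth_mem) simp
          then show ?thesis
            using * False p len by (auto simp: multi_indices_def)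
        qed
        then show False
          using len \<open>u \<notin> _\<close> by (auto simp: multi_indices_def in_set_conv_nth)
      qed
      then show ?thesis
        using x by (simp add: tensor_power_def)
    qed
    then show ?thesis
      using x by (auto simp: raising_op_def tensor_power_def intro!: sum.neutral)
  qed (simp add: raising_op_def zero_tensor_power)
  have "raising_op n r i t \<in> lin_maps tscale (tscale :: 'a \<Rightarrow> _) (tensor_power n r) (tensor_power n r)"
    unfolding lin_maps_def
    by (intro CollectI conjI ballI allI impI funcsetI T)
       (auto simp: raising_op_def fun_eq_iff add_tensor_power tscale_tensor_power
        sum.distrib sum_distrib_left)
  moreover have "raising_op n r i t (place_perm \<sigma> x) = place_perm \<sigma> (raising_op n r i t x)"
    if \<sigma>: "\<sigma> permutes {..<r}" and x: "x \<in> tensor_power n r" for \<sigma> and x :: "'a tensor"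
  proof
    fix u
    have \<sigma>x: "place_perm \<sigma> x \<in> tensor_power n r"
      using \<sigma> x by (rule place_perm_tensor_power)
    show "raising_op n r i t (place_perm \<sigma> x) u = place_perm \<sigma> (raising_op n r i t x) u"
    proof (cases "length u = r")
      case len: True
      have \<sigma>u: "\<sigma> permutes {..<length u}"
        using \<sigma> len by simp
      have bij: "bij_betw (\<lambda>S. \<sigma> -` S) {S. S \<subseteq> letter_positions i u \<and> card S = t}
          {S. S \<subseteq> letter_positions i (permute_list \<sigma> u) \<and> card S = t}"
      proof (rule bij_betw_byWitness[where f' = "\<lambda>S. \<sigma> ` S"])
        have b: "bij \<sigma>"
          using \<sigma> by (rule permutes_bij)
        have card: "card (\<sigma> -` S) = card S" for S
          using b by (simp add: card_vimage_inj bij_is_inj bij_is_surj)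
        show "(\<lambda>S. \<sigma> -` S) ` {S. S \<subseteq> letter_positions i u \<and> card S = t} \<subseteq>
            {S. S \<subseteq> letter_positions i (permute_list \<sigma> u) \<and> card S = t}"
          by (auto simp: letter_positions_permute[OF \<sigma>u] card)
        show "(\<lambda>S. \<sigma> ` S) ` {S. S \<subseteq> letter_positions i (permute_list \<sigma> u) \<and> card S = t} \<subseteq>
            {S. S \<subseteq> letter_positions i u \<and> card S = t}"
          using bij_is_inj[OF b] by (auto simp: letter_positions_permute[OF \<sigma>u] card_image inj_on_def)
        show "\<forall>S\<in>{S. S \<subseteq> letter_positions i u \<and> card S = t}. \<sigma> ` (\<sigma> -` S) = S"
          using bij_is_surj[OF b] by (simp add: surj_image_vimage_eq)
        show "\<forall>S\<in>{S. S \<subseteq> letter_positions i (permute_list \<sigma> u) \<and> card S = t}. \<sigma> -` (\<sigma> ` S) = S"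
          using bij_is_inj[OF b] by (simp add: inj_vimage_image_eq)
      qed
      have "raising_op n r i t (place_perm \<sigma> x) u =
          (\<Sum>S | S \<subseteq> letter_positions i u \<and> card S = t.
            place_perm \<sigma> x (change_letters S (Suc i) u))"
        by (simp add: raising_op_def \<sigma>x)
      also have "\<dots> =
          (\<Sum>S | S \<subseteq> letter_positions i u \<and> card S = t.
            x (change_letters (\<sigma> -` S) (Suc i) (permute_list \<sigma> u)))"
        by (simp add: place_perm_def permute_change_letters[OF \<sigma>u])
      also have "\<dots> = place_perm \<sigma> (raising_op n r i t x) u"
        by (subst sum.reindex_bij_betw[OF bij]) (simp add: raising_op_def x place_perm_def)
      finally show ?thesis .
    next
      case False
      then have "raising_op n r i t (place_perm \<sigma> x) u = 0"
        using tensor_power_length[OF T] by blast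
      moreover have "raising_op n r i t x (permute_list \<sigma> u) = 0"
        using False tensor_power_length[OF T] by (metis length_permute_list)
      ultimately show ?thesis
        by (simp add: place_perm_def)
    qed
  qed
  ultimately show ?thesis
    by (simp add: schur_algebra_def)
qed

lemma weight_proj_schur: "weight_proj n r la \<in> schur_algebra n r"
proof -
  have "weight_proj n r la x \<in> tensor_power n r" for x :: "'a tensor"
    by (auto simp: weight_proj_def tensor_power_def)
  note T = this
  have "weight_proj n r la \<in> lin_maps tscale (tscale :: 'a \<Rightarrow> _) (tensor_power n r) (tensor_power n r)"
    unfolding lin_maps_def
    by (intro CollectI conjI ballI allI impI funcsetI T)
       (auto simp: weight_proj_def fun_eq_iff add_tensor_power tscale_tensor_power)
  moreover have "weight_proj n r la (place_perm \<sigma> x) = place_perm \<sigma> (weight_proj n r la x)"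
    if "\<sigma> permutes {..<r}" "x \<in> tensor_power n r" for \<sigma> and x :: "'a tensor"
    using that place_perm_tensor_power[OF that]
    by (simp add: weight_proj_def place_perm_def weight_words_permute)
  ultimately show ?thesis
    by (simp add: schur_algebra_def)
qed

lemma primitive_vectors_add:
  assumes M: "schur_submodule n r M"
    and "v \<in> primitive_vectors n r la M" "w \<in> primitive_vectors n r la M"
  shows "v + w \<in> primitive_vectors n r la M"
proof -
  have "v \<in> tensor_power n r" "w \<in> tensor_power n r"
    using assms by (auto simp: primitive_vectors_def schur_submodule_def)
  then have "raising_op n r i t (v + w) = raising_op n r i t v + raising_op n r i t w" if "i \<in> {1..<n}" for i t
    using that lin_mapsD(2)[OF schur_algebra_lin[OF raising_op_schur]] by auto
  then show ?thesis
    using assms by (auto simp: primitive_vectors_def schur_submodule_def)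
qed

lemma primitive_vectors_scale:
  assumes M: "schur_submodule n r M"
    and "v \<in> primitive_vectors n r la M"
  shows "tscale c v \<in> primitive_vectors n r la M"
proof -
  have "v \<in> tensor_power n r"
    using assms by (auto simp: primitive_vectors_def schur_submodule_def)
  then have "raising_op n r i t (tscale c v) = tscale c (raising_op n r i t v)" if "i \<in> {1..<n}" for i t
    using that lin_mapsD(3)[OF schur_algebra_lin[OF raising_op_schur]] by auto
  then show ?thesis
    using assms by (auto simp: primitive_vectors_def schur_submodule_def tscale_zero)
qed

lemma schur_submodule_tensor_power: "schur_submodule n r (tensor_power n r)"
  by (auto simp: schur_submodule_def zero_tensor_power add_tensor_power tscale_tensor_power
      intro: lin_mapsD(1)[OF schur_algebra_lin])

text \<open>
  The Garnir relations follow from the relations \<open>H\<close> for the raising operators, by induction on the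
  number of elements of \<open>U - A\<close> outside \<open>C\<close>.
\<close>

lemma garnir_sum:
  fixes f :: "nat set \<Rightarrow> 'k::ab_group_add"
  assumes U: "finite U" "A \<subseteq> U" "card (U - A) < b"
    and H: "\<And>Q t. Q \<subseteq> U \<Longrightarrow> t \<ge> 1 \<Longrightarrow> (\<Sum>S | S \<subseteq> U - Q \<and> card S = t. f (Q \<union> S)) = 0"
  shows "C \<subseteq> U - A \<Longrightarrow> (\<Sum>S | S \<subseteq> A \<and> card C + card S = b. f (C \<union> S)) = 0"
proof (induction "card (U - A - C)" arbitrary: C rule: less_induct)
  case less
  let ?B = "U - A - C"
  let ?T = "\<lambda>B. {S. S \<subseteq> A \<and> card (C \<union> B) + card S = b}"
  have fin: "finite A" "finite C" "finite ?B"
    using U less.prems by (auto intro: finite_subset)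
  \<comment> \<open>The bound \<open>card (U - A) < b\<close> serves to make
    \<open>b - card C\<close> positive, as \<open>H\<close> demands.\<close>
  have "card C \<le> card (U - A)"
    using U less.prems by (intro card_mono) auto
  then have t: "b - card C \<ge> 1" "card C \<le> b"
    using U by auto
  \<comment> \<open>Split a subset of \<open>U - C\<close> into its part \<open>B\<close> outside
    \<open>A\<close> and its part \<open>S\<close> inside \<open>A\<close>. The sum for
    \<open>B = {}\<close> is the wanted one; for any other \<open>B\<close> it is the same sum with
    \<open>C \<union> B\<close> in place of \<open>C\<close>, zero by induction.\<close>
  have bij: "bij_betw (\<lambda>(B, S). B \<union> S) (Sigma (Pow ?B) ?T) {S. S \<subseteq> U - C \<and> card S = b - card C}"
  proof (rule bij_betw_byWitness[where f' = "\<lambda>S. (S \<inter> ?B, S \<inter> A)"])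
    have card1: "card (C \<union> B) = card C + card B" if "B \<subseteq> ?B" for B
      using that fin by (intro card_Un_disjoint) (auto intro: finite_subset)
    have card2: "card (B \<union> S) = card B + card S" if "B \<subseteq> ?B" "S \<subseteq> A" for B S
      using that fin by (intro card_Un_disjoint) (auto intro: finite_subset)
    show "(\<lambda>(B, S). B \<union> S) ` Sigma (Pow ?B) ?T \<subseteq> {S. S \<subseteq> U - C \<and> card S = b - card C}"
      using U less.prems by (auto simp: card1 card2)
    have "card (C \<union> S \<inter> ?B) + card (S \<inter> A) = b" if "S \<subseteq> U - C" "card S = b - card C" for S
    proof -
      have "S \<inter> ?B \<union> S \<inter> A = S"
        using that by auto
      then have "card S = card (S \<inter> ?B) + card (S \<inter> A)"
        using card2[of "S \<inter> ?B" "S \<inter> A"] by simp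
      then show ?thesis
        using card1[of "S \<inter> ?B"] that t by simp
    qed
    then show "(\<lambda>S. (S \<inter> ?B, S \<inter> A)) ` {S. S \<subseteq> U - C \<and> card S = b - card C} \<subseteq> Sigma (Pow ?B) ?T"
      by auto
  qed (use U less.prems in auto)
  have "0 = (\<Sum>S | S \<subseteq> U - C \<and> card S = b - card C. f (C \<union> S))"
    using H[of C "b - card C"] t less.prems by auto
  also have "\<dots> = (\<Sum>(B, S)\<in>Sigma (Pow ?B) ?T. f (C \<union> (B \<union> S)))"
    by (subst sum.reindex_bij_betw[OF bij, symmetric]) (simp add: case_prod_beta)
  also have "\<dots> = (\<Sum>B\<in>Pow ?B. \<Sum>S\<in>?T B. f (C \<union> B \<union> S))"
    using fin by (subst sum.Sigma) (auto simp: Un_assoc)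
  also have "\<dots> = (\<Sum>B\<in>{{}}. \<Sum>S\<in>?T B. f (C \<union> B \<union> S))"
  proof (rule sum.mono_neutral_right)
    show "\<forall>B\<in>Pow ?B - {{}}. (\<Sum>S\<in>?T B. f (C \<union> B \<union> S)) = 0"
    proof
      fix B assume B: "B \<in> Pow ?B - {{}}"
      then have "U - A - (C \<union> B) \<subset> ?B"
        by auto
      then show "(\<Sum>S\<in>?T B. f (C \<union> B \<union> S)) = 0"
        using B fin less.prems by (intro less.hyps psubset_card_mono) auto
    qed
  qed (use fin in auto)
  finally show ?case
    by simp
qed

section \<open>Standard fillings and leading words\<close>

lemma sorted_boxes: "sorted_wrt (\<lambda>a b. fst a < fst b \<or> fst a = fst b \<and> snd a < snd b) (boxes n la)"
proof -
  have "sorted_wrt (\<lambda>a b. fst a < fst b \<or> fst a = fst b \<and> snd a < snd b)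
      (concat (map (\<lambda>i. map (Pair i) [1..<Suc (la i)]) xs))" if "sorted_wrt (<) xs" for xs
    using that
    by (induction xs) (auto simp: sorted_wrt_append sorted_wrt_map simp del: upt_Suc)
  then show ?thesis
    by (simp add: boxes_def del: upt_Suc)
qed

lemma boxes_nth_less:
  assumes "k < k'" "k' < length (boxes n la)"
  shows "fst (boxes n la ! k) < fst (boxes n la ! k') \<or>
    fst (boxes n la ! k) = fst (boxes n la ! k') \<and> snd (boxes n la ! k) < snd (boxes n la ! k')"
  using sorted_wrt_nth_less[OF sorted_boxes assms] .

lemma distinct_boxes: "distinct (boxes n la)"
  unfolding distinct_conv_nth
proof (intro allI impI)
  fix k k' assume "k < length (boxes n la)" "k' < length (boxes n la)" "k \<noteq> k'"
  then show "boxes n la ! k \<noteq> boxes n la ! k'"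
    using boxes_nth_less[of k k' n la] boxes_nth_less[of k' k n la] by (cases k k' rule: linorder_cases) auto
qed

lemma sorted_rows: "sorted (map fst (boxes n la))"
  using sorted_boxes[of n la]
  by (simp add: sorted_wrt_map, elim sorted_wrt_mono_rel[rotated]) auto

lemma boxes_position:
  assumes "1 \<le> i" "i \<le> n" "1 \<le> j" "j \<le> la i"
  obtains k where "k < length (boxes n la)" "boxes n la ! k = (i, j)"
proof -
  have "(i, j) \<in> set (boxes n la)"
    using assms by (simp add: set_boxes)
  then show ?thesis
    using that by (auto simp: in_set_conv_nth)
qed

lemma boxes_nth:
  assumes "k < length (boxes n la)" "boxes n la ! k = (i, j)"
  shows "1 \<le> i" "i \<le> n" "1 \<le> j" "j \<le> la i"
proof -
  have "(i, j) \<in> set (boxes n la)"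
    using assms by (metis nth_mem)
  then show "1 \<le> i" "i \<le> n" "1 \<le> j" "j \<le> la i"
    by (auto simp: set_boxes)
qed

lemma partitions_mono:
  assumes la: "la \<in> partitions n r" and "1 \<le> i" "i \<le> i'"
  shows "la i' \<le> la i"
  using assms(3)
proof (induction i' rule: dec_induct)
  case (step m)
  have "la (Suc m) \<le> la m"
  proof (cases "m < n")
    case True
    then show ?thesis
      using la step assms(2) by (auto simp: partitions_def)
  next
    case False
    then have "la (Suc m) = 0"
      using la by (auto simp: partitions_def)
    then show ?thesis by simp
  qed
  then show ?case using step by simp
qed simp

lemma count_rows:
  assumes la: "la \<in> partitions n r"
  shows "count_list (map fst (boxes n la)) i = la i"
proof -
  have "count_list (map fst (boxes n la)) i = length (filter (\<lambda>b. fst b = i) (boxes n la))"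
    by (simp add: count_list_eq_length_filter filter_map comp_def eq_commute)
  also have "\<dots> = card (set (filter (\<lambda>b. fst b = i) (boxes n la)))"
    by (rule distinct_card[symmetric]) (simp add: distinct_boxes)
  also have "set (filter (\<lambda>b. fst b = i) (boxes n la)) = (if i \<in> {1..n} then Pair i ` {1..la i} else {})"
    by (auto simp: set_boxes)
  also have "card \<dots> = la i"
    using la by (auto simp: card_image inj_on_def partitions_def)
  finally show ?thesis .
qed

lemma rows_weight_words:
  "la \<in> partitions n r \<Longrightarrow> map fst (boxes n la) \<in> weight_words r la"
  by (simp add: weight_words_def count_rows length_boxes)

lemma label_stab_map_iff:
  assumes "length bs = r"
  shows "\<sigma> \<in> label_stab (map f bs) \<longleftrightarrow> \<sigma> permutes {..<r} \<and> (\<forall>k<r. f (bs ! \<sigma> k) = f (bs ! k))"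
proof -
  have "map f bs ! \<sigma> k = f (bs ! \<sigma> k)" if "\<sigma> permutes {..<r}" "k < r" for k
    using permutes_in_image[OF that(1), of k] that assms by simp
  then show ?thesis
    using assms by (auto simp: label_stab_iff)
qed

lemma row_stabilizer_eq:
  "la \<in> partitions n r \<Longrightarrow> row_stabilizer n r la = label_stab (map fst (boxes n la))"
  and col_stabilizer_eq:
  "la \<in> partitions n r \<Longrightarrow> col_stabilizer n r la = label_stab (map snd (boxes n la))"
  by (auto simp: row_stabilizer_def col_stabilizer_def label_stab_map_iff[OF length_boxes])

lemma col_antisym_eq:
  "la \<in> partitions n r \<Longrightarrow> col_antisym n r la = label_antisym (map snd (boxes n la))"
  by (auto simp: col_antisym_def label_antisym_def col_stabilizer_eq)

text \<open>Column-preserving permutations carry a repetition inside a column of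
  \<open>permute_list \<sigma> w\<close> to one inside the same column of \<open>w\<close>, so a
  single nonzero term already triggers \<open>label_antisym_eq_0\<close>.\<close>

lemma label_antisym_eq_0_of_support:
  assumes x: "\<And>u. length u = length C \<Longrightarrow> x u \<noteq> 0 \<Longrightarrow>
      \<exists>a b. a < length C \<and> b < length C \<and> a \<noteq> b \<and> C ! a = C ! b \<and> u ! a = u ! b"
    and w: "length w = length C"
  shows "label_antisym C x w = 0"
proof (rule ccontr)
  assume nz: "label_antisym C x w \<noteq> 0"
  then obtain \<sigma> where \<sigma>: "\<sigma> \<in> label_stab C" "x (permute_list \<sigma> w) \<noteq> 0"
    unfolding label_antisym_apply by (metis (no_types, lifting) mult_zero_right sum.neutral)
  then obtain a b where ab: "a < length C" "b < length C" "a \<noteq> b" "C ! a = C ! b"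
      "permute_list \<sigma> w ! a = permute_list \<sigma> w ! b"
    using x[of "permute_list \<sigma> w"] w by auto
  note p = label_stab_permutes[OF \<sigma>(1)]
  have "\<sigma> a < length C" "\<sigma> b < length C"
    using permutes_in_image[OF p] ab by auto
  moreover have "\<sigma> a \<noteq> \<sigma> b"
    using ab permutes_inj[OF p] by (meson injD)
  moreover have "C ! \<sigma> a = C ! \<sigma> b"
    using \<sigma>(1) ab by (simp add: label_stab_iff)
  moreover have "w ! \<sigma> a = w ! \<sigma> b"
    using ab w p by (simp add: permute_list_nth)
  ultimately show False
    using label_antisym_eq_0[of "\<sigma> a" C "\<sigma> b" w x] nz w by simp
qed

lemma row_word_tensor:
  assumes "la \<in> partitions n r"
  shows "(\<lambda>i. if i = map fst (boxes n la) then 1 else 0) \<in> tensor_power n r"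
  using rows_weight_words[OF assms] weight_words_multi_indices[OF assms]
  by (auto simp: tensor_power_def)

lemma highest_weight_vector_apply:
  assumes "la \<in> partitions n r"
  shows "highest_weight_vector n r la u = (\<Sum>c\<in>label_stab (map snd (boxes n la)).
    of_int (sign c) * (if permute_list c u = map fst (boxes n la) then 1 else 0))"
  by (simp add: highest_weight_vector_def col_antisym_eq[OF assms] label_antisym_apply)

text \<open>Raising the row word turns the letter of some box \<open>(Suc i, j)\<close> into
  \<open>i\<close>. The box \<open>(i, j)\<close> above it exists because
  \<open>la (Suc i) \<le> la i\<close>, and it carries \<open>i\<close> too; antisymmetrization
  kills this repetition.\<close>

lemma highest_weight_vector_primitive:
  assumes la: "la \<in> partitions n r"
  shows "(highest_weight_vector n r la :: 'k::field tensor) \<in> primitive_vectors n r la (tensor_power n r)"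
proof -
  define R C where "R = map fst (boxes n la)" and "C = map snd (boxes n la)"
  define e :: "'k tensor" where "e = (\<lambda>i. if i = R then 1 else 0)"
  have len: "length R = r" "length C = r" "length (boxes n la) = r"
    using length_boxes[OF la] by (auto simp: R_def C_def)
  have e: "e \<in> tensor_power n r"
    using row_word_tensor[OF la] by (simp add: e_def R_def)
  have z: "highest_weight_vector n r la = col_antisym n r la e"
    by (simp add: highest_weight_vector_def e_def R_def)
  have zT: "(highest_weight_vector n r la :: 'k tensor) \<in> tensor_power n r"
    unfolding z using e by (rule col_antisym_tensor_power)
  have "(highest_weight_vector n r la :: 'k tensor) u = 0" if "u \<notin> weight_words r la" for u
  proof -
    have "permute_list c u \<noteq> R" if "c \<in> label_stab C" for c
      using \<open>u \<notin> _\<close> weight_words_permute[of c r u la] label_stab_permutes[OF that] len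
        rows_weight_words[OF la] by (auto simp: R_def)
    then show ?thesis
      unfolding highest_weight_vector_apply[OF la] by (auto simp: R_def C_def intro!: sum.neutral)
  qed
  moreover have "raising_op n r i t (highest_weight_vector n r la :: 'k tensor) = 0"
    if i: "i \<in> {1..<n}" and t: "t \<ge> 1" for i t
  proof
    fix w
    have S: "raising_op n r i t \<in> schur_algebra n r"
      using i by (intro raising_op_schur) auto
    \<comment> \<open>The operator commutes with the column antisymmetrizer, so it may act on the
      single word \<open>R\<close> first.\<close>
    have Ez: "raising_op n r i t (highest_weight_vector n r la) = label_antisym C (raising_op n r i t e)"
      unfolding z schur_algebra_col_antisym[OF S e] by (simp add: col_antisym_eq[OF la] C_def)
    have "raising_op n r i t (highest_weight_vector n r la :: 'k tensor) w = 0" if w: "length w = length C"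
      unfolding Ez
    proof (rule label_antisym_eq_0_of_support[OF _ w])
      fix u assume u: "length u = length C" "raising_op n r i t e u \<noteq> 0"
      then obtain S where S: "S \<subseteq> letter_positions i u" "card S = t" "e (change_letters S (Suc i) u) \<noteq> 0"
        using e by (auto simp: raising_op_def elim: sum.not_neutral_contains_not_neutral)
      from S(3) have R: "change_letters S (Suc i) u = R"
        by (auto simp: e_def split: if_splits)
      obtain p where p: "p \<in> S"
        using S(2) t by fastforce
      then have p': "p < r" "u ! p = i"
        using S(1) u len by (auto simp: letter_positions_def)
      have "R ! p = Suc i"
        using R p p' u len by (metis nth_change_letters)
      then obtain j where j: "boxes n la ! p = (Suc i, j)"
        using p' len by (cases "boxes n la ! p") (auto simp: R_def)
      have "j \<le> la (Suc i)" "1 \<le> j"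
        using boxes_nth[OF _ j] p' len by auto
      moreover have "la (Suc i) \<le> la i"
        using i la by (auto intro: partitions_mono)
      ultimately obtain q where q: "q < r" "boxes n la ! q = (i, j)"
        using boxes_position[of i n j la] i len by auto
      have "R ! q = i"
        using q len by (simp add: R_def)
      moreover have "change_letters S (Suc i) u ! q = (if q \<in> S then Suc i else u ! q)"
        using q u len by simp
      ultimately have "u ! q = i"
        using R by (auto split: if_splits)
      then show "\<exists>a b. a < length C \<and> b < length C \<and> a \<noteq> b \<and> C ! a = C ! b \<and> u ! a = u ! b"
        using p' q j len by (intro exI[of _ p] exI[of _ q]) (auto simp: C_def)
    qed
    moreover have "raising_op n r i t (highest_weight_vector n r la :: 'k tensor) w = 0" if "length w \<noteq> r"
      using that tensor_power_length[OF lin_mapsD(1)[OF schur_algebra_lin[OF S] zT]] by blast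
    ultimately show "raising_op n r i t (highest_weight_vector n r la :: 'k tensor) w = 0 w"
      using len by (simp, metis)
  qed
  ultimately show ?thesis
    using zT by (auto simp: primitive_vectors_def)
qed

section \<open>Lexicographic order and leading words of polytabloids\<close>

lemma list_less_nthI:
  fixes w u :: "nat list"
  assumes "length w = length u" "p < length u" "\<And>q. q < p \<Longrightarrow> w ! q = u ! q" "w ! p < u ! p"
  shows "w < u"
proof -
  have "take p w = take p u"
    using assms by (intro nth_equalityI) auto
  then show ?thesis
    using assms unfolding list_less_def lexord_take_index_conv by auto
qed

lemma list_less_first_difference:
  fixes w u :: "nat list"
  assumes "length w = length u" "w \<noteq> u"
    and "\<And>p. p < length u \<Longrightarrow> w ! p \<noteq> u ! p \<Longrightarrow> (\<And>q. q < p \<Longrightarrow> w ! q = u ! q) \<Longrightarrow> w ! p < u ! p"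
  shows "w < u"
proof -
  define p where "p = (LEAST p. p < length u \<and> w ! p \<noteq> u ! p)"
  have ex: "\<exists>p. p < length u \<and> w ! p \<noteq> u ! p"
    using assms(1,2) by (auto simp: list_eq_iff_nth_eq)
  have p: "p < length u" "w ! p \<noteq> u ! p"
    using LeastI_ex[OF ex] by (auto simp: p_def)
  have "w ! q = u ! q" if "q < p" for q
    using not_less_Least[of q "\<lambda>p. p < length u \<and> w ! p \<noteq> u ! p"] that p by (auto simp: p_def)
  then show ?thesis
    using assms p by (intro list_less_nthI[of w u p]) auto
qed

text \<open>The tableau whose \<open>k\<close>-th box holds the tensor position
  \<open>\<sigma> k\<close>. Only the columns are constrained here; increasing rows are provided by
  \<open>row_increasing_filling\<close>.\<close>

definition standard_filling :: "nat \<Rightarrow> (nat \<Rightarrow> nat) \<Rightarrow> (nat \<Rightarrow> nat) \<Rightarrow> bool" where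
  "standard_filling n la \<sigma> \<longleftrightarrow> (\<forall>k k' i j. k < length (boxes n la) \<longrightarrow> k' < length (boxes n la) \<longrightarrow>
     boxes n la ! k = (i, j) \<longrightarrow> boxes n la ! k' = (Suc i, j) \<longrightarrow> \<sigma> k < \<sigma> k')"

lemma row_increasing_filling:
  assumes la: "la \<in> partitions n r" and w: "w \<in> weight_words r la"
  obtains \<sigma> where "\<sigma> permutes {..<r}" "permute_list \<sigma> w = map fst (boxes n la)"
    "\<And>k k'. k < k' \<Longrightarrow> k' < r \<Longrightarrow> fst (boxes n la ! k) = fst (boxes n la ! k') \<Longrightarrow> \<sigma> k < \<sigma> k'"
proof -
  define R where "R = map fst (boxes n la)"
  have len: "length w = r" "length R = r" "length (boxes n la) = r"
    using w la length_boxes[OF la] by (auto simp: R_def weight_words_def)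
  \<comment> \<open>As \<open>p < r\<close>, this number encodes the lexicographic order of the
    pairs \<open>(w ! p, p)\<close>: positions are sorted by letter and, within one letter, that is
    within one row, by position.\<close>
  define key where "key p = w ! p * r + p" for p
  define P where "P = sort_key key [0..<r]"
  have P: "mset P = mset [0..<r]" "sorted (map key P)"
    by (simp_all add: P_def)
  have lP: "length P = r" "set P = {..<r}" "distinct P"
    by (simp_all add: P_def atLeast0LessThan)
  have Pr: "P ! k < r" if "k < r" for k
    using that lP by (metis lessThan_iff nth_mem)
  have key_le: "key (P ! k) \<le> key (P ! k')" if "k \<le> k'" "k' < r" for k k'
    using sorted_nth_mono[OF P(2), of k k'] that lP by simp
  have wP: "w ! (P ! k) \<le> w ! (P ! k')" if "k \<le> k'" "k' < r" for k k'
  proof (rule ccontr)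
    assume "\<not> ?thesis"
    then have "Suc (w ! (P ! k')) * r \<le> w ! (P ! k) * r"
      by (intro mult_right_mono) auto
    then have "key (P ! k') < key (P ! k)"
      using Pr[OF that(2)] by (simp add: key_def)
    then show False
      using key_le[OF that] by simp
  qed
  have "mset (map (\<lambda>p. w ! p) P) = mset w"
  proof -
    have "mset (map (\<lambda>p. w ! p) P) = mset (map (\<lambda>p. w ! p) [0..<r])"
      by (simp only: mset_map P(1))
    also have "map (\<lambda>p. w ! p) [0..<r] = w"
      using map_nth[of w] len by simp
    finally show ?thesis .
  qed
  also have "mset w = mset R"
    using w rows_weight_words[OF la]
    by (intro multiset_eqI) (simp add: count_mset weight_words_def flip: R_def)
  finally have "mset (map (\<lambda>p. w ! p) P) = mset R" .
  moreover have "sorted (map (\<lambda>p. w ! p) P)"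
    using wP lP by (auto simp: sorted_iff_nth_mono)
  ultimately have wR: "map (\<lambda>p. w ! p) P = R"
    using sorted_rows[of n la] properties_for_sort[of "map (\<lambda>p. w ! p) P" R] sorted_sort_id[of R]
    unfolding R_def by metis
  define \<sigma> where "\<sigma> k = (if k < r then P ! k else k)" for k
  have "bij_betw (\<lambda>k. P ! k) {..<r} {..<r}"
    by (rule bij_betw_nth) (simp_all add: lP)
  then have "bij_betw \<sigma> {..<r} {..<r}"
    by (rule bij_betw_cong[THEN iffD1, rotated]) (simp add: \<sigma>_def)
  then have \<sigma>: "\<sigma> permutes {..<r}"
    by (rule bij_imp_permutes) (simp add: \<sigma>_def)
  moreover have "permute_list \<sigma> w = R"
  proof (rule nth_equalityI)
    fix k assume "k < length (permute_list \<sigma> w)"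
    then have k: "k < r" using len by simp
    have "R ! k = w ! (P ! k)"
      using k lP by (simp flip: wR)
    then show "permute_list \<sigma> w ! k = R ! k"
      using k \<sigma> len by (simp add: permute_list_nth) (simp add: \<sigma>_def)
  qed (simp add: len)
  moreover have "\<sigma> k < \<sigma> k'" if "k < k'" "k' < r" "fst (boxes n la ! k) = fst (boxes n la ! k')" for k k'
  proof -
    have "w ! (P ! k) = R ! k" "w ! (P ! k') = R ! k'"
      using that lP by (simp_all flip: wR)
    moreover have "R ! k = R ! k'"
      using that len by (simp add: R_def)
    ultimately have "P ! k \<le> P ! k'"
      using key_le[of k k'] that by (simp add: key_def)
    moreover have "P ! k \<noteq> P ! k'"
      using that lP by (simp add: nth_eq_iff_index_eq)
    ultimately show ?thesis
      using that by (simp add: \<sigma>_def)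
  qed
  ultimately show ?thesis
    using that by (simp add: R_def)
qed

text \<open>James's leading term argument. Words in the support arise from \<open>w\<close> by
  moving letters within columns. At the first difference the boxes higher up in the column hold
  earlier positions and have kept their letters, so the new letter comes from a lower row and is
  larger.\<close>

lemma polytabloid_leading_word:
  assumes la: "la \<in> partitions n r" and \<sigma>: "\<sigma> permutes {..<r}" "standard_filling n la \<sigma>"
    and w: "permute_list \<sigma> w = map fst (boxes n la)"
  shows "place_perm \<sigma> (highest_weight_vector n r la :: 'k::field tensor) w = 1"
    and "place_perm \<sigma> (highest_weight_vector n r la :: 'k::field tensor) u \<noteq> 0 \<Longrightarrow> w \<le> u"
proof -
  define bs R C where "bs = boxes n la" and "R = map fst bs" and "C = map snd bs"
  have len: "length R = r" "length C = r" "length bs = r"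
    using length_boxes[OF la] by (auto simp: R_def C_def bs_def)
  have lw: "length w = r"
    using w len by (metis R_def bs_def length_permute_list)
  have w\<sigma>: "w ! \<sigma> k = R ! k" if "k < r" for k
    using that w \<sigma> lw by (simp add: R_def bs_def flip: w permute_list_nth)
  have less: "w < u" if c: "c \<in> label_stab C" "c \<noteq> id" "length u = r" "permute_list c (permute_list \<sigma> u) = R" for c u
  proof -
    define d where "d = inv c"
    have cp: "c permutes {..<r}"
      using label_stab_permutes[OF c(1)] len by simp
    have d: "d \<in> label_stab C"
      unfolding d_def by (rule label_stab_inv[OF c(1)])
    have dp: "d permutes {..<r}"
      using label_stab_permutes[OF d] len by simp
    have dr: "d k < r" if "k < r" for k
      using permutes_in_image[OF dp, of k] that by simp
    have Cd: "C ! d k = C ! k" if "k < r" for k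
      using d that len by (simp add: label_stab_iff)
    \<comment> \<open>The position held by box \<open>k\<close> carries in \<open>u\<close> the row
      number of box \<open>d k\<close>. Since \<open>d\<close> preserves columns, this equals the
      row of \<open>k\<close> only when \<open>d k = k\<close>.\<close>
    have u\<sigma>: "u ! \<sigma> k = R ! d k" if "k < r" for k
    proof -
      have "R ! d k = permute_list \<sigma> u ! c (d k)"
        using c(3) cp dr[OF that] by (simp flip: c(4) add: permute_list_nth)
      also have "\<dots> = u ! \<sigma> k"
        using that c(3) \<sigma> by (simp add: d_def permutes_inverses[OF cp] permute_list_nth)
      finally show ?thesis ..
    qed
    have dk: "d k = k" if "k < r" "R ! d k = R ! k" for k
    proof -
      have "bs ! d k = bs ! k"
        using that Cd[OF that(1)] dr[OF that(1)] len by (simp add: prod_eq_iff R_def C_def)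
      then show ?thesis
        using that dr[OF that(1)] len distinct_boxes[of n la] by (simp add: bs_def nth_eq_iff_index_eq)
    qed
    show "w < u"
    proof (rule list_less_first_difference)
      show "length w = length u"
        using lw c by simp
      show "w \<noteq> u"
      proof
        assume "w = u"
        then have "d k = k" if "k < r" for k
          using that u\<sigma>[of k] w\<sigma>[of k] dk[of k] by simp
        then have "d k = k" for k
          using dp by (cases "k < r") (auto simp: permutes_def)
        then have "c k = k" for k
          using permutes_inverses(1)[OF cp] by (metis d_def)
        then show False
          using c(2) by (auto simp: fun_eq_iff)
      qed
    next
      fix p assume p: "p < length u" "w ! p \<noteq> u ! p" and before: "\<And>q. q < p \<Longrightarrow> w ! q = u ! q"
      have pr: "p < r" using p c by simp
      define k where "k = inv \<sigma> p"
      have k: "k < r" "\<sigma> k = p"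
        using permutes_in_image[OF permutes_inv[OF \<sigma>(1)], of p] pr permutes_inverses(1)[OF \<sigma>(1)]
        by (auto simp: k_def)
      obtain i j where ij: "bs ! k = (i, j)"
        by (cases "bs ! k")
      note ij' = boxes_nth[of k n la i j, folded bs_def, OF _ ij]
      \<comment> \<open>Climb from box \<open>k\<close> up its column, one row at a time; the
        positions held there decrease strictly.\<close>
      have above: "\<exists>m<r. bs ! m = (i', j) \<and> \<sigma> m \<le> p \<and> (i' < i \<longrightarrow> \<sigma> m < p)" if "1 \<le> i'" "i' \<le> i" for i'
        using that(2,1)
      proof (induction i' rule: inc_induct)
        case base
        then show ?case
          using k ij by (intro exI[of _ k]) auto
      next
        case (step m)
        then obtain a where a: "a < r" "bs ! a = (Suc m, j)" "\<sigma> a \<le> p"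
          by auto
        have "la i \<le> la m"
          by (rule partitions_mono[OF la]) (use step in auto)
        then obtain b where b: "b < r" "bs ! b = (m, j)"
          using boxes_position[of m n j la] ij' k step len by (auto simp: bs_def)
        have "\<sigma> b < \<sigma> a"
          using \<sigma>(2) a b len by (auto simp: standard_filling_def bs_def)
        then show ?case
          using a b by (intro exI[of _ b]) auto
      qed
      have neq: "R ! d k \<noteq> i"
        using p k u\<sigma>[of k] w\<sigma>[of k] ij len by (auto simp: R_def)
      \<comment> \<open>If box \<open>d k\<close> were higher up, its position would come before
        \<open>p\<close>, where the words agree. Then \<open>d\<close> would fix \<open>d k\<close>,
        and by injectivity also \<open>k\<close>.\<close>
      have "\<not> R ! d k < i"
      proof
        assume lt: "R ! d k < i"
        have b: "bs ! d k = (R ! d k, j)"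
          using Cd[OF k(1)] dr[OF k(1)] ij k len by (simp add: prod_eq_iff R_def C_def)
        have "1 \<le> R ! d k"
          using boxes_nth[of "d k" n la, folded bs_def, OF _ b] dr[OF k(1)] len by simp
        then obtain m where m: "m < r" "bs ! m = (R ! d k, j)" "\<sigma> m < p"
          using above[of "R ! d k"] lt by auto
        have "m = d k"
          using m b dr[OF k(1)] len distinct_boxes[of n la]
          by (metis bs_def nth_eq_iff_index_eq)
        moreover have "R ! d m = R ! m"
          using before[OF m(3)] u\<sigma>[OF m(1)] w\<sigma>[OF m(1)] by simp
        then have "d m = m"
          using dk m by simp
        ultimately have "d k = k"
          using permutes_inj[OF dp] by (metis injD)
        then show False
          using lt ij k len by (simp add: R_def)
      qed
      then have "R ! d k > i"
        using neq by simp
      then show "w ! p < u ! p"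
        using k u\<sigma>[of k] w\<sigma>[of k] ij len by (simp add: R_def)
    qed
  qed
  have z: "place_perm \<sigma> (highest_weight_vector n r la :: 'k tensor) u =
      (\<Sum>c\<in>label_stab C. of_int (sign c) * (if permute_list c (permute_list \<sigma> u) = R then 1 else 0))" for u
    by (simp add: place_perm_def highest_weight_vector_apply[OF la] R_def C_def bs_def)
  have "place_perm \<sigma> (highest_weight_vector n r la :: 'k tensor) w =
      (\<Sum>c\<in>{id}. of_int (sign c) * (if permute_list c (permute_list \<sigma> w) = R then 1 else 0))"
    unfolding z
    by (rule sum.mono_neutral_right) (use less[OF _ _ lw] in \<open>auto simp: finite_label_stab id_label_stab\<close>)
  then show "place_perm \<sigma> (highest_weight_vector n r la :: 'k tensor) w = 1"
    using w by (simp add: R_def bs_def)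
  show "w \<le> u" if "place_perm \<sigma> (highest_weight_vector n r la :: 'k tensor) u \<noteq> 0"
  proof -
    have "\<exists>c\<in>label_stab C. permute_list c (permute_list \<sigma> u) = R"
    proof (rule ccontr)
      assume "\<not> ?thesis"
      then have "place_perm \<sigma> (highest_weight_vector n r la :: 'k tensor) u = 0"
        unfolding z by (intro sum.neutral) auto
      then show False
        using that by simp
    qed
    then obtain c where c: "c \<in> label_stab C" "permute_list c (permute_list \<sigma> u) = R"
      by blast
    have lu: "length u = r"
      using c len by (metis length_permute_list)
    show ?thesis
    proof (cases "c = id")
      case True
      then have *: "permute_list \<sigma> u = permute_list \<sigma> w"
        using c w by (simp add: R_def bs_def)
      have "u = permute_list (inv \<sigma>) (permute_list \<sigma> u)"
        using lu \<sigma> permutes_inv[OF \<sigma>(1)] by (simp add: permutes_inv_o flip: permute_list_compose)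
      also have "\<dots> = w"
        unfolding * using lw \<sigma> permutes_inv[OF \<sigma>(1)] by (simp add: permutes_inv_o flip: permute_list_compose)
      finally show ?thesis by simp
    next
      case False
      then show ?thesis
        using less[OF c(1) _ lu c(2)] by simp
    qed
  qed
qed


text \<open>
  At a descent in a column, the Garnir relation expresses \<open>v w\<close> by values of \<open>v\<close> at smaller words.
\<close>

lemma nonstandard_word_vanishes:
  fixes v :: "'k::field tensor"
  assumes la: "la \<in> partitions n r" and v: "v \<in> primitive_vectors n r la (tensor_power n r)"
    and \<sigma>: "\<sigma> permutes {..<r}" and w\<sigma>: "permute_list \<sigma> w = map fst (boxes n la)"
    and rows: "\<And>k k'. k < k' \<Longrightarrow> k' < r \<Longrightarrow> fst (boxes n la ! k) = fst (boxes n la ! k') \<Longrightarrow> \<sigma> k < \<sigma> k'"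
    and smaller: "\<And>u. u < w \<Longrightarrow> v u = 0"
    and nonstandard: "\<not> standard_filling n la \<sigma>"
  shows "v w = 0"
proof -
  define bs where "bs = boxes n la"
  have len: "length bs = r" "length w = r"
    using length_boxes[OF la] w\<sigma> by (auto simp: bs_def) (metis length_map length_permute_list)
  obtain k k' i j where k: "k < r" "k' < r" "bs ! k = (i, j)" "bs ! k' = (Suc i, j)" "\<not> \<sigma> k < \<sigma> k'"
    using nonstandard len by (auto simp: standard_filling_def bs_def)
  have "\<sigma> k \<noteq> \<sigma> k'"
    using k permutes_inj[OF \<sigma>] by (metis Pair_inject injD n_not_Suc_n)
  then have kk': "\<sigma> k' < \<sigma> k"
    using k by simp
  have ij: "1 \<le> i" "Suc i \<le> n" "1 \<le> j" "j \<le> la i" "j \<le> la (Suc i)"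
    using boxes_nth[of k n la i j] boxes_nth[of k' n la "Suc i" j] k len by (auto simp: bs_def)
  have w: "w ! \<sigma> m = fst (bs ! m)" if "m < r" for m
  proof -
    have "w ! \<sigma> m = map fst bs ! m"
      using that \<sigma> len by (simp add: bs_def flip: w\<sigma> permute_list_nth)
    then show ?thesis
      using that len by simp
  qed
  have \<sigma>r: "\<sigma> m < r \<longleftrightarrow> m < r" for m
    using permutes_in_image[OF \<sigma>, of m] by simp
  have inv: "\<sigma> (inv \<sigma> p) = p" "inv \<sigma> (\<sigma> p) = p" for p
    using permutes_inverses[OF \<sigma>] by auto
  have inv_r: "inv \<sigma> p < r \<longleftrightarrow> p < r" for p
    using \<sigma>r[of "inv \<sigma> p"] inv by simp
  define U where "U = letter_positions i w \<union> letter_positions (Suc i) w"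
  have lp: "letter_positions c w = \<sigma> ` {m. m < r \<and> fst (bs ! m) = c}" for c
  proof (intro set_eqI iffI)
    fix p assume "p \<in> letter_positions c w"
    then show "p \<in> \<sigma> ` {m. m < r \<and> fst (bs ! m) = c}"
      using w[of "inv \<sigma> p"] inv inv_r len
      by (intro image_eqI[of _ _ "inv \<sigma> p"]) (auto simp: letter_positions_def)
  next
    fix p assume "p \<in> \<sigma> ` {m. m < r \<and> fst (bs ! m) = c}"
    then show "p \<in> letter_positions c w"
      using w \<sigma>r len by (auto simp: letter_positions_def)
  qed
  \<comment> \<open>The Garnir belt of the descent at column \<open>j\<close>: \<open>A1\<close> is
    row \<open>i\<close> from box \<open>k\<close> onwards and \<open>A2\<close> is row
    \<open>Suc i\<close> up to box \<open>k'\<close>. \<open>B\<close> and \<open>C\<close> are the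
    remainders of these two rows.\<close>
  define A1 where "A1 = \<sigma> ` {m. m < r \<and> fst (bs ! m) = i \<and> k \<le> m}"
  define A2 where "A2 = \<sigma> ` {m. m < r \<and> fst (bs ! m) = Suc i \<and> m \<le> k'}"
  define B where "B = \<sigma> ` {m. m < r \<and> fst (bs ! m) = i \<and> m < k}"
  define C where "C = \<sigma> ` {m. m < r \<and> fst (bs ! m) = Suc i \<and> k' < m}"
  note inj = permutes_inj[OF \<sigma>]
  have U: "U = (A1 \<union> A2) \<union> (B \<union> C)"
    unfolding U_def lp A1_def A2_def B_def C_def image_Un[symmetric]
    by (rule arg_cong[where f = "image \<sigma>"]) auto
  have disj: "(A1 \<union> A2) \<inter> (B \<union> C) = {}" "A1 \<inter> A2 = {}"
    unfolding A1_def A2_def B_def C_def image_Un[symmetric] image_Int[OF inj, symmetric] by auto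
  have lpS: "letter_positions (Suc i) w = A2 \<union> C"
    unfolding lp A2_def C_def image_Un[symmetric]
    by (rule arg_cong[where f = "image \<sigma>"]) auto
  have fin: "finite A1" "finite A2" "finite B" "finite C" "finite U"
    by (auto simp: A1_def A2_def B_def C_def U_def)
  \<comment> \<open>Rows increase and \<open>\<sigma> k' < \<sigma> k\<close>, so the descent puts
    all of \<open>A2\<close> before all of \<open>A1\<close>.\<close>
  have A12: "p < q" if "p \<in> A2" "q \<in> A1" for p q
  proof -
    obtain a b where ab: "p = \<sigma> a" "a < r" "fst (bs ! a) = Suc i" "a \<le> k'"
      "q = \<sigma> b" "b < r" "fst (bs ! b) = i" "k \<le> b"
      using \<open>p \<in> A2\<close> \<open>q \<in> A1\<close> by (auto simp: A1_def A2_def)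
    have "\<sigma> a \<le> \<sigma> k'"
      using rows[of a k'] ab k by (cases "a = k'") (auto simp: bs_def)
    also note kk'
    also have "\<sigma> k \<le> \<sigma> b"
      using rows[of k b] ab k by (cases "b = k") (auto simp: bs_def)
    finally show ?thesis
      using ab by simp
  qed
  have UA: "U - (A1 \<union> A2) = B \<union> C"
    using U disj by auto
  have less: "snd (bs ! a) < snd (bs ! b)" if "a < b" "b < r" "fst (bs ! a) = fst (bs ! b)" for a b
    using boxes_nth_less[of a b n la] that len by (auto simp: bs_def)
  \<comment> \<open>\<open>B\<close> lies in columns left of \<open>j\<close> and \<open>C\<close>
    in columns right of \<open>j\<close>. Thus all its boxes have different columns, and none lies
    in column \<open>j\<close>; this gives the strict bound that \<open>garnir_sum\<close> needs
    with \<open>b = la (Suc i)\<close>.\<close>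
  have "card (B \<union> C) \<le> card ({1..la (Suc i)} - {j})"
  proof (rule card_inj_on_le)
    have BC: "\<exists>m<r. p = \<sigma> m \<and> (fst (bs ! m) = i \<and> snd (bs ! m) < j \<or>
        fst (bs ! m) = Suc i \<and> j < snd (bs ! m))" if "p \<in> B \<union> C" for p
    proof -
      from that consider m where "m < r" "p = \<sigma> m" "fst (bs ! m) = i" "m < k"
        | m where "m < r" "p = \<sigma> m" "fst (bs ! m) = Suc i" "k' < m"
        unfolding B_def C_def by blast
      then show ?thesis
      proof cases
        case 1
        then show ?thesis
          using less[of m k] k by (intro exI[of _ m]) auto
      next
        case 2
        then show ?thesis
          using less[of k' m] k by (intro exI[of _ m]) auto
      qed
    qed
    show "inj_on (\<lambda>p. snd (bs ! inv \<sigma> p)) (B \<union> C)"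
    proof (rule inj_onI)
      fix p q assume "p \<in> B \<union> C" "q \<in> B \<union> C" and eq: "snd (bs ! inv \<sigma> p) = snd (bs ! inv \<sigma> q)"
      then obtain a b where a: "a < r" "p = \<sigma> a" "fst (bs ! a) = i \<and> snd (bs ! a) < j \<or>
          fst (bs ! a) = Suc i \<and> j < snd (bs ! a)"
        and b: "b < r" "q = \<sigma> b" "fst (bs ! b) = i \<and> snd (bs ! b) < j \<or>
          fst (bs ! b) = Suc i \<and> j < snd (bs ! b)"
        using BC by metis
      then have "bs ! a = bs ! b"
        using eq by (auto simp: inv prod_eq_iff)
      then show "p = q"
        using a b len distinct_boxes[of n la] by (simp add: bs_def nth_eq_iff_index_eq)
    qed
    show "(\<lambda>p. snd (bs ! inv \<sigma> p)) ` (B \<union> C) \<subseteq> {1..la (Suc i)} - {j}"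
    proof (rule image_subsetI)
      fix p assume "p \<in> B \<union> C"
      then obtain m where m: "m < r" "p = \<sigma> m" "fst (bs ! m) = i \<and> snd (bs ! m) < j \<or>
          fst (bs ! m) = Suc i \<and> j < snd (bs ! m)"
        using BC by metis
      have "1 \<le> snd (bs ! m)" "snd (bs ! m) \<le> la (fst (bs ! m))"
        using boxes_nth[of m n la "fst (bs ! m)" "snd (bs ! m)"] m len by (auto simp: bs_def)
      then show "snd (bs ! inv \<sigma> p) \<in> {1..la (Suc i)} - {j}"
        using m ij by (auto simp: inv)
    qed
  qed simp
  also have "\<dots> < la (Suc i)"
    using ij by (simp add: card_Diff_singleton)
  finally have cardUA: "card (U - (A1 \<union> A2)) < la (Suc i)"
    unfolding UA .
  \<comment> \<open>First all of \<open>U\<close> is filled with \<open>i\<close>, then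
    \<open>T\<close> with \<open>Suc i\<close>. In this form the vanishing of
    \<open>raising_op n r i t v\<close> at the word of \<open>Q\<close> is exactly the hypothesis
    \<open>H\<close> of \<open>garnir_sum\<close>.\<close>
  define f where "f T = v (change_letters T (Suc i) (change_letters U i w))" for T
  have vT: "v \<in> tensor_power n r" and vP: "raising_op n r i t v = 0" if "t \<ge> 1" for t
    using v that ij by (auto simp: primitive_vectors_def)
  have ww: "w \<in> weight_words r la"
    using rows_weight_words[OF la] weight_words_permute[OF \<sigma>, of w la] w\<sigma> by simp
  have Ur: "U \<subseteq> {..<r}"
    using len by (auto simp: U_def letter_positions_def)
  have H: "(\<Sum>S | S \<subseteq> U - Q \<and> card S = t. f (Q \<union> S)) = 0" if Q: "Q \<subseteq> U" and t: "t \<ge> 1" for Q t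
  proof -
    let ?u = "change_letters Q (Suc i) (change_letters U i w)"
    have "letter_positions i ?u = U - Q"
      using Q Ur len by (auto simp: letter_positions_def U_def split: if_splits)
    moreover have "change_letters S (Suc i) ?u = change_letters (Q \<union> S) (Suc i) (change_letters U i w)" for S
      by (rule nth_equalityI) auto
    ultimately have "(\<Sum>S | S \<subseteq> U - Q \<and> card S = t. f (Q \<union> S)) = raising_op n r i t v ?u"
      using vT[OF t] by (simp add: raising_op_def f_def)
    then show ?thesis
      using vP[OF t] by simp
  qed
  have "(\<Sum>S | S \<subseteq> A1 \<union> A2 \<and> card C + card S = la (Suc i). f (C \<union> S)) = 0"
    by (rule garnir_sum[OF fin(5) _ cardUA H]) (use U disj in auto)
  also have "(\<Sum>S | S \<subseteq> A1 \<union> A2 \<and> card C + card S = la (Suc i). f (C \<union> S)) = (\<Sum>S\<in>{A2}. f (C \<union> S))"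
  proof (rule sum.mono_neutral_right)
    show "finite {S. S \<subseteq> A1 \<union> A2 \<and> card C + card S = la (Suc i)}"
      using fin by simp
    have cardA2: "card C + card A2 = la (Suc i)"
    proof -
      have "card (A2 \<union> C) = card A2 + card C"
        using fin disj by (intro card_Un_disjoint) auto
      then show ?thesis
        using card_letter_positions[of "Suc i" w] ww by (simp add: lpS weight_words_def)
    qed
    then show "{A2} \<subseteq> {S. S \<subseteq> A1 \<union> A2 \<and> card C + card S = la (Suc i)}"
      by auto
    \<comment> \<open>Any other \<open>S\<close> of the right size omits some \<open>a\<close> in
      \<open>A2\<close>. As \<open>A2\<close> precedes \<open>A1\<close>, the first change turns a
      letter \<open>Suc i\<close> into \<open>i\<close>, so the word is smaller than
      \<open>w\<close>.\<close>
    show "\<forall>S\<in>{S. S \<subseteq> A1 \<union> A2 \<and> card C + card S = la (Suc i)} - {A2}. f (C \<union> S) = 0"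
    proof
      fix S assume "S \<in> {S. S \<subseteq> A1 \<union> A2 \<and> card C + card S = la (Suc i)} - {A2}"
      then have S: "S \<subseteq> A1 \<union> A2" "card S = card A2" "S \<noteq> A2"
        using cardA2 by auto
      have finS: "finite S"
        using S fin by (meson finite_UnI finite_subset)
      have "\<not> A2 \<subseteq> S"
        using S finS card_subset_eq by metis
      then obtain a where a: "a \<in> A2" "a \<notin> S" by blast
      let ?u = "change_letters (C \<union> S) (Suc i) (change_letters U i w)"
      have val: "?u ! q = (if q \<in> C \<union> S then Suc i else if q \<in> U then i else w ! q)" if "q < r" for q
        using that len by simp
      have w_val: "w ! q = (if q \<in> A2 \<union> C then Suc i else i)" if "q \<in> U" for q
        using that lpS by (auto simp: U_def letter_positions_def)
      have "?u < w"
      proof (rule list_less_first_difference)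
        show "length ?u = length w" by simp
        have aU: "a \<in> U" "a < r" "a \<notin> C"
          using a U Ur disj by auto
        then have "?u ! a \<noteq> w ! a"
          using val[of a] w_val[of a] a by simp
        then show "?u \<noteq> w"
          by metis
        fix p assume p: "p < length w" "?u ! p \<noteq> w ! p" and before: "\<And>q. q < p \<Longrightarrow> ?u ! q = w ! q"
        have "\<not> a < p"
          using before[of a] \<open>?u ! a \<noteq> w ! a\<close> by auto
        moreover have pU: "p \<in> U"
        proof (rule ccontr)
          assume "p \<notin> U"
          then have "p \<notin> C \<union> S"
            using S U by auto
          then show False
            using \<open>p \<notin> U\<close> p val[of p] len by simp
        qed
        ultimately have "p \<notin> A1"
          using A12[OF a(1), of p] by auto
        moreover have "p \<notin> C"
          using p val[of p] w_val[OF pU] len by auto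
        ultimately have "p \<notin> S \<or> p \<in> A2"
          using S by auto
        then show "?u ! p < w ! p"
          using p val[of p] w_val[OF pU] pU \<open>p \<notin> C\<close> len by (auto split: if_splits)
      qed
      then show "f (C \<union> S) = 0"
        by (simp add: f_def smaller)
    qed
  qed
  also have "\<dots> = v w"
  proof -
    have "change_letters (C \<union> A2) (Suc i) (change_letters U i w) = w"
    proof (rule nth_equalityI)
      fix q assume "q < length (change_letters (C \<union> A2) (Suc i) (change_letters U i w))"
      then have q: "q < length w" by simp
      have "q \<in> C \<union> A2 \<longleftrightarrow> w ! q = Suc i" "q \<in> U \<longleftrightarrow> w ! q = i \<or> w ! q = Suc i"
        using q lpS by (auto simp: U_def letter_positions_def)
      then show "change_letters (C \<union> A2) (Suc i) (change_letters U i w) ! q = w ! q"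
        using q by simp
    qed simp
    then show ?thesis
      by (simp add: f_def)
  qed
  finally show ?thesis .
qed

section \<open>Homomorphisms from a Weyl module\<close>

lemma primitive_vectors_place_perm:
  assumes M: "M \<subseteq> tensor_power n r" and \<sigma>: "\<sigma> permutes {..<r}"
    and v: "v \<in> primitive_vectors n r la M"
  shows "place_perm \<sigma> v \<in> primitive_vectors n r la (place_perm \<sigma> ` M)"
proof -
  have vT: "v \<in> tensor_power n r"
    using v M by (auto simp: primitive_vectors_def)
  have "place_perm \<sigma> v u = 0" if "u \<notin> weight_words r la" for u
    using v that weight_words_permute[OF \<sigma>] by (auto simp: primitive_vectors_def place_perm_def)
  moreover have "raising_op n r i t (place_perm \<sigma> v) = 0" if "i \<in> {1..<n}" "t \<ge> 1" for i t
    using that v schur_algebra_place_perm[OF raising_op_schur \<sigma> vT, of i t]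
    by (simp add: primitive_vectors_def place_perm_zero)
  ultimately show ?thesis
    using v by (auto simp: primitive_vectors_def)
qed

lemma primitive_vectors_mono:
  "M \<subseteq> N \<Longrightarrow> primitive_vectors n r la M \<subseteq> primitive_vectors n r la N"
  by (auto simp: primitive_vectors_def)

text \<open>Elimination of leading words. The smallest word \<open>w\<close> in the support of
  \<open>v\<close> must come from a standard filling, for otherwise \<open>v w = 0\<close>. The
  corresponding polytabloid has coefficient 1 at \<open>w\<close> and none at smaller words, so
  subtracting \<open>v w\<close> times it pushes the support above \<open>w\<close>.\<close>

lemma primitive_in_perm_span:
  fixes v :: "'k::field tensor"
  assumes la: "la \<in> partitions n r"
  shows "v \<in> primitive_vectors n r la (tensor_power n r) \<Longrightarrow>
    \<exists>c. v = (\<Sum>\<sigma> | \<sigma> permutes {..<r}. tscale (c \<sigma>) (place_perm \<sigma> (highest_weight_vector n r la)))"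
proof (induction "card {u \<in> weight_words r la. \<exists>w. v w \<noteq> 0 \<and> w \<le> u}" arbitrary: v rule: less_induct)
  case less
  let ?z = "highest_weight_vector n r la :: 'k tensor"
  let ?D = "\<lambda>v :: 'k tensor. {u \<in> weight_words r la. \<exists>w. v w \<noteq> 0 \<and> w \<le> u}"
  have finW: "finite (weight_words r la)"
    by (rule finite_subset[OF weight_words_multi_indices[OF la] finite_multi_indices])
  have supp: "{w. v w \<noteq> 0} \<subseteq> weight_words r la"
    using less.prems by (auto simp: primitive_vectors_def)
  show ?case
  proof (cases "v = 0")
    case True
    then show ?thesis
      by (intro exI[of _ "\<lambda>_. 0"]) (auto simp: fun_eq_iff sum_tensor_apply)
  next
    case False
    then have ne: "{w. v w \<noteq> 0} \<noteq> {}"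
      by (auto simp: fun_eq_iff)
    define w where "w = Min {w. v w \<noteq> 0}"
    have fin: "finite {w. v w \<noteq> 0}"
      using supp finW by (rule finite_subset)
    have w: "v w \<noteq> 0" and w_min: "\<And>u. v u \<noteq> 0 \<Longrightarrow> w \<le> u"
      using Min_in[OF fin ne] Min_le[OF fin] by (auto simp: w_def)
    have wW: "w \<in> weight_words r la"
      using w supp by auto
    obtain \<sigma> where \<sigma>: "\<sigma> permutes {..<r}" "permute_list \<sigma> w = map fst (boxes n la)"
      "\<And>k k'. k < k' \<Longrightarrow> k' < r \<Longrightarrow> fst (boxes n la ! k) = fst (boxes n la ! k') \<Longrightarrow> \<sigma> k < \<sigma> k'"
      using row_increasing_filling[OF la wW] by metis
    have std: "standard_filling n la \<sigma>"
      using nonstandard_word_vanishes[OF la less.prems \<sigma>(1,2,3)] w w_min by (metis leD)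
    note lead = polytabloid_leading_word[OF la \<sigma>(1) std \<sigma>(2), where ?'k = 'k]
    have e: "place_perm \<sigma> ?z \<in> primitive_vectors n r la (tensor_power n r)"
      using primitive_vectors_place_perm[OF _ \<sigma>(1) highest_weight_vector_primitive[OF la]]
        primitive_vectors_mono[of "place_perm \<sigma> ` tensor_power n r" "tensor_power n r"]
        place_perm_tensor_power[OF \<sigma>(1)] by blast
    define v' where "v' = v + tscale (- v w) (place_perm \<sigma> ?z)"
    have v'P: "v' \<in> primitive_vectors n r la (tensor_power n r)"
      unfolding v'_def using less.prems e
      by (intro primitive_vectors_add primitive_vectors_scale schur_submodule_tensor_power)
    have v'w: "v' w = 0"
      by (simp add: v'_def lead)
    have v'_min: "w < u" if "v' u \<noteq> 0" for u
    proof -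
      have "v u \<noteq> 0 \<or> place_perm \<sigma> ?z u \<noteq> 0"
        using that by (auto simp: v'_def)
      then have "w \<le> u"
        using w_min lead(2) by blast
      moreover have "u \<noteq> w"
        using that v'w by auto
      ultimately show ?thesis by simp
    qed
    \<comment> \<open>The measure counts all words of weight \<open>la\<close> above the support,
      not the support itself, which may grow by the subtraction. The word \<open>w\<close> drops out
      of it.\<close>
    have "?D v' \<subset> ?D v"
    proof
      show "?D v' \<subseteq> ?D v"
        using w v'_min by fastforce
      have "w \<in> ?D v" "w \<notin> ?D v'"
        using w wW v'_min by (auto simp: not_le)
      then show "?D v' \<noteq> ?D v"
        by blast
    qed
    then have "card (?D v') < card (?D v)"
      using finW by (intro psubset_card_mono) auto
    then obtain c where c: "v' = (\<Sum>\<sigma> | \<sigma> permutes {..<r}. tscale (c \<sigma>) (place_perm \<sigma> ?z))"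
      using less.hyps v'P by blast
    have "v = (\<Sum>\<tau> | \<tau> permutes {..<r}. tscale ((c(\<sigma> := c \<sigma> + v w)) \<tau>) (place_perm \<tau> ?z))"
    proof
      fix u
      have "(\<Sum>\<tau> | \<tau> permutes {..<r}. (c(\<sigma> := c \<sigma> + v w)) \<tau> * place_perm \<tau> ?z u) =
          (\<Sum>\<tau> | \<tau> permutes {..<r}. c \<tau> * place_perm \<tau> ?z u + (if \<tau> = \<sigma> then v w * place_perm \<sigma> ?z u else 0))"
        by (rule sum.cong) (auto simp: algebra_simps)
      also have "\<dots> = v' u + v w * place_perm \<sigma> ?z u"
        using \<sigma>(1) by (simp add: c sum.distrib sum_tensor_apply finite_permutations)
      also have "\<dots> = v u"
        by (simp add: v'_def)
      finally show "v u = (\<Sum>\<tau> | \<tau> permutes {..<r}. tscale ((c(\<sigma> := c \<sigma> + v w)) \<tau>) (place_perm \<tau> ?z)) u"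
        by (simp add: sum_tensor_apply)
    qed
    then show ?thesis by blast
  qed
qed

lemma id_schur_algebra: "(\<lambda>x. if x \<in> tensor_power n r then x else 0) \<in> schur_algebra n r"
  by (auto simp: schur_algebra_def lin_maps_def add_tensor_power tscale_tensor_power place_perm_tensor_power)

lemma highest_weight_vector_in_weyl_module:
  assumes "la \<in> partitions n r"
  shows "(highest_weight_vector n r la :: 'k::field tensor) \<in> weyl_module n r la"
  unfolding weyl_module_cyclic[OF assms]
proof (rule image_eqI[OF _ id_schur_algebra])
  show "(highest_weight_vector n r la :: 'k tensor) =
      (if highest_weight_vector n r la \<in> (tensor_power n r :: 'k tensor set) then highest_weight_vector n r la else 0)"
    using highest_weight_vector_primitive[OF assms, where ?'k = 'k] by (simp add: primitive_vectors_def)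
qed

lemma schur_hom_primitive_bij:
  fixes M :: "'k::field tensor set"
  assumes la: "la \<in> partitions n r" and M: "schur_submodule n r M"
  shows "bij_betw (\<lambda>f. f (highest_weight_vector n r la))
    (schur_hom n r (weyl_module n r la) M) (primitive_vectors n r la M)"
proof -
  let ?z = "highest_weight_vector n r la :: 'k tensor"
  let ?W = "weyl_module n r la :: 'k tensor set"
  have zP: "?z \<in> primitive_vectors n r la (tensor_power n r)"
    by (rule highest_weight_vector_primitive[OF la])
  then have zT: "?z \<in> tensor_power n r"
    by (simp add: primitive_vectors_def)
  have zW: "?z \<in> ?W"
    by (rule highest_weight_vector_in_weyl_module[OF la])
  have W: "schur_submodule n r ?W"
    by (rule schur_submodule_weyl_module)
  have WT: "?W \<subseteq> tensor_power n r" and MT: "M \<subseteq> tensor_power n r"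
    using W M by (auto simp: schur_submodule_def)
  have cyc: "\<exists>\<phi>\<in>schur_algebra n r. x = \<phi> ?z" if "x \<in> ?W" for x
    using that unfolding weyl_module_cyclic[OF la] by auto
  have "inj_on (\<lambda>f. f ?z) (schur_hom n r ?W M)"
  proof (rule inj_onI)
    fix f g assume f: "f \<in> schur_hom n r ?W M" and g: "g \<in> schur_hom n r ?W M" and eq: "f ?z = g ?z"
    show "f = g"
    proof
      fix x
      show "f x = g x"
      proof (cases "x \<in> ?W")
        case True
        then obtain \<phi> where \<phi>: "\<phi> \<in> schur_algebra n r" "x = \<phi> ?z"
          using cyc by blast
        then show ?thesis
          using f g zW eq by (simp add: schur_hom_def)
      next
        case False
        then show ?thesis
          using f g by (simp add: schur_hom_def lin_maps_def)
      qed
    qed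
  qed
  moreover have "(\<lambda>f. f ?z) ` schur_hom n r ?W M = primitive_vectors n r la M"
  proof (intro equalityI subsetI)
    fix v assume "v \<in> (\<lambda>f. f ?z) ` schur_hom n r ?W M"
    then obtain f where f: "f \<in> schur_hom n r ?W M" and v: "v = f ?z" by blast
    have fM: "f x \<in> M" if "x \<in> ?W" for x
      using f that by (auto simp: schur_hom_def lin_maps_def)
    have f0: "f 0 = 0"
      using f W lin_mapsD(2)[of f tscale tscale ?W M 0 0] by (auto simp: schur_hom_def schur_submodule_def)
    have comm: "f (\<phi> ?z) = \<phi> v" if "\<phi> \<in> schur_algebra n r" for \<phi>
      using f that zW v by (simp add: schur_hom_def)
    have vM: "v \<in> M"
      using fM zW v by simp
    \<comment> \<open>Having weight \<open>la\<close> and being killed by raising operators are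
      equations for elements of the Schur algebra, so \<open>f\<close> carries them from
      \<open>?z\<close> to \<open>v\<close>.\<close>
    have "weight_proj n r la ?z = ?z"
      using zP by (auto simp: weight_proj_def primitive_vectors_def fun_eq_iff)
    then have "weight_proj n r la v = v"
      using comm[OF weight_proj_schur, of la] v by simp
    then have "v u = 0" if "u \<notin> weight_words r la" for u
      using that vM MT by (auto simp: weight_proj_def fun_eq_iff split: if_splits)
    moreover have "raising_op n r i t v = 0" if "i \<in> {1..<n}" "t \<ge> 1" for i t
      using comm[OF raising_op_schur, of i t] that zP f0 by (auto simp: primitive_vectors_def)
    ultimately show "v \<in> primitive_vectors n r la M"
      using vM by (simp add: primitive_vectors_def)
  next
    fix v assume v: "v \<in> primitive_vectors n r la M"
    then have vM: "v \<in> M" by (simp add: primitive_vectors_def)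
    obtain c where c: "v = (\<Sum>\<sigma> | \<sigma> permutes {..<r}. tscale (c \<sigma>) (place_perm \<sigma> ?z))"
      using primitive_in_perm_span[OF la] v primitive_vectors_mono[OF MT] by blast
    define h where "h x = (\<Sum>\<sigma> | \<sigma> permutes {..<r}. tscale (c \<sigma>) (place_perm \<sigma> x))" for x :: "'k tensor"
    have h_comm: "h (\<phi> x) = \<phi> (h x)" if "\<phi> \<in> schur_algebra n r" "x \<in> tensor_power n r" for \<phi> x
      unfolding h_def using that
      by (subst schur_algebra_sum[OF that(1)])
        (auto intro!: sum.cong tscale_tensor_power place_perm_tensor_power
          simp: lin_mapsD(3)[OF schur_algebra_lin[OF that(1)]] place_perm_tensor_power schur_algebra_place_perm)
    have h_add: "h (x + y) = h x + h y" and h_scale: "h (tscale a x) = tscale a (h x)" for x y a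
      by (simp_all add: h_def place_perm_add place_perm_tscale tscale_add sum.distrib tscale_sum tscale_commute[of a])
    \<comment> \<open>On an arbitrary tensor \<open>h\<close> need not land in \<open>M\<close>.
      Cyclicity of the Weyl module helps: for \<open>x = \<phi> ?z\<close> the value is
      \<open>\<phi> v\<close>, and \<open>v\<close> lies in \<open>M\<close>.\<close>
    have hM: "h x \<in> M" if x: "x \<in> ?W" for x
    proof -
      obtain \<phi> where \<phi>: "\<phi> \<in> schur_algebra n r" "x = \<phi> ?z"
        using cyc[OF x] by blast
      then have "h x = \<phi> v"
        using h_comm[OF \<phi>(1) zT] c by (simp add: h_def)
      then show ?thesis
        using M \<phi> vM by (simp add: schur_submodule_def)
    qed
    define f where "f x = (if x \<in> ?W then h x else 0)" for x
    have Wc: "\<And>x y. x \<in> ?W \<Longrightarrow> y \<in> ?W \<Longrightarrow> x + y \<in> ?W" "\<And>a x. x \<in> ?W \<Longrightarrow> tscale a x \<in> ?W"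
      "\<And>\<phi> x. \<phi> \<in> schur_algebra n r \<Longrightarrow> x \<in> ?W \<Longrightarrow> \<phi> x \<in> ?W"
      using W by (auto simp: schur_submodule_def)
    have "f \<in> schur_hom n r ?W M"
      using hM Wc h_comm WT by (auto simp: schur_hom_def lin_maps_def f_def h_add h_scale)
    moreover have "f ?z = v"
      using zW c by (simp add: f_def h_def)
    ultimately show "v \<in> (\<lambda>f. f ?z) ` schur_hom n r ?W M"
      by blast
  qed
  ultimately show ?thesis
    by (simp add: bij_betw_def)
qed

text \<open>Both spaces are compared with a common set \<open>P\<close>, here the primitive vectors
  in the Weyl module of \<open>mu\<close>; so no formula for the inverse of the truncation is
  needed.\<close>

lemma vs_isomorphicI:
  assumes bij: "bij_betw a V P" "bij_betw b W P"
    and V: "\<And>x y. x \<in> V \<Longrightarrow> y \<in> V \<Longrightarrow> x + y \<in> V \<and> a (x + y) = a x + a y"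
      "\<And>c x. x \<in> V \<Longrightarrow> s c x \<in> V \<and> a (s c x) = u c (a x)"
    and W: "\<And>x y. x \<in> W \<Longrightarrow> y \<in> W \<Longrightarrow> x + y \<in> W \<and> b (x + y) = b x + b y"
      "\<And>c x. x \<in> W \<Longrightarrow> t c x \<in> W \<and> b (t c x) = u c (b x)"
  shows "vs_isomorphic s t V W"
proof -
  define g where "g = the_inv_into W b"
  define \<Phi> where "\<Phi> x = (if x \<in> V then g (a x) else 0)" for x
  have inj: "inj_on b W" and im: "b ` W = P"
    using bij(2) by (auto simp: bij_betw_def)
  have aP: "a x \<in> P" if "x \<in> V" for x
    using bij(1) that by (rule bij_betwE[THEN bspec])
  have g: "g y \<in> W" "b (g y) = y" if "y \<in> P" for y
    using that im inj by (auto simp: g_def the_inv_into_into f_the_inv_into_f)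
  have gb: "g (b x) = x" if "x \<in> W" for x
    using that inj by (simp add: g_def the_inv_into_f_f)
  have "g (a (x + y)) = g (a x) + g (a y)" if "x \<in> V" "y \<in> V" for x y
  proof -
    have "b (g (a x) + g (a y)) = a (x + y)"
      using that V(1)[OF that] W(1) g aP by simp
    then show ?thesis
      using gb W(1) g aP that by metis
  qed
  moreover have "g (a (s c x)) = t c (g (a x))" if "x \<in> V" for c x
  proof -
    have "b (t c (g (a x))) = a (s c x)"
      using that V(2)[OF that] W(2) g aP by simp
    then show ?thesis
      using gb W(2) g aP that by metis
  qed
  ultimately have "\<Phi> \<in> lin_maps s t V W"
    using V g aP by (auto simp: lin_maps_def \<Phi>_def)
  moreover have "bij_betw g P W"
    unfolding g_def by (rule bij_betw_the_inv_into[OF bij(2)])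
  then have "bij_betw (g \<circ> a) V W"
    using bij_betw_trans[OF bij(1)] by blast
  then have "bij_betw \<Phi> V W"
    by (rule bij_betw_cong[THEN iffD1, rotated]) (simp add: \<Phi>_def)
  ultimately show ?thesis
    by (auto simp: vs_isomorphic_def)
qed

section \<open>Weyl modules of labelled positions\<close>

definition label_weyl :: "nat \<Rightarrow> 'a list \<Rightarrow> 'b list \<Rightarrow> 'k::field tensor set" where
  "label_weyl n R C =
     label_antisym C ` {x \<in> tensor_power n (length R). \<forall>\<sigma>\<in>label_stab R. place_perm \<sigma> x = x}"

lemma place_perm_sum: "place_perm \<sigma> (sum f A) = (\<Sum>a\<in>A. place_perm \<sigma> (f a))"
  by (auto simp: fun_eq_iff place_perm_def sum_tensor_apply)

lemma label_antisym_tensor_power: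
  assumes "x \<in> tensor_power n (length C)"
  shows "label_antisym C x \<in> tensor_power n (length C)"
  unfolding label_antisym_def using assms
  by (intro sum_tensor_power tscale_tensor_power place_perm_tensor_power) (auto simp: label_stab_def)

lemma label_stab_conjugate:
  assumes \<rho>: "\<rho> permutes {..<length L}" and \<sigma>: "\<sigma> \<in> label_stab L"
  shows "inv \<rho> \<circ> \<sigma> \<circ> \<rho> \<in> label_stab (permute_list \<rho> L)"
proof -
  have \<sigma>p: "\<sigma> permutes {..<length L}" "permute_list \<sigma> L = L"
    using \<sigma> by (auto simp: label_stab_def)
  have p: "inv \<rho> \<circ> \<sigma> \<circ> \<rho> permutes {..<length L}"
    using \<rho> \<sigma>p permutes_inv[OF \<rho>] by (intro permutes_compose) auto
  have "\<rho> \<circ> (inv \<rho> \<circ> \<sigma> \<circ> \<rho>) = \<sigma> \<circ> \<rho>"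
    by (simp add: fun_eq_iff permutes_inverses[OF \<rho>])
  then have "permute_list (inv \<rho> \<circ> \<sigma> \<circ> \<rho>) (permute_list \<rho> L) = permute_list \<rho> (permute_list \<sigma> L)"
    using p \<rho> by (metis permute_list_compose)
  then show ?thesis
    using p \<sigma>p by (simp add: label_stab_def)
qed

lemma permute_list_inv:
  assumes "\<rho> permutes {..<length L}"
  shows "permute_list (inv \<rho>) (permute_list \<rho> L) = L" "permute_list \<rho> (permute_list (inv \<rho>) L) = L"
  using assms permutes_inv[OF assms] by (simp_all add: permutes_inv_o flip: permute_list_compose)

lemma label_stab_conjugate':
  assumes \<rho>: "\<rho> permutes {..<length L}" and \<sigma>: "\<sigma> \<in> label_stab (permute_list \<rho> L)"
  shows "\<rho> \<circ> \<sigma> \<circ> inv \<rho> \<in> label_stab L"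
  using label_stab_conjugate[of "inv \<rho>" "permute_list \<rho> L" \<sigma>] assms permutes_inv[OF \<rho>]
  by (simp add: permute_list_inv permutes_inv_inv)

text \<open>Reordering the positions by \<open>\<rho>\<close> conjugates the row and the column
  stabilizer, and conjugation preserves signs.\<close>

lemma label_weyl_conjugate_subset:
  assumes \<rho>: "\<rho> permutes {..<length C}" and len: "length R = length C"
  shows "place_perm (inv \<rho>) ` label_weyl n R C \<subseteq>
    (label_weyl n (permute_list \<rho> R) (permute_list \<rho> C) :: 'k::field tensor set)"
proof (rule image_subsetI)
  fix y :: "'k tensor" assume "y \<in> label_weyl n R C"
  then obtain x where x: "x \<in> tensor_power n (length C)" "\<And>\<sigma>. \<sigma> \<in> label_stab R \<Longrightarrow> place_perm \<sigma> x = x"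
    and y: "y = label_antisym C x"
    using len by (auto simp: label_weyl_def)
  note \<rho>i = permutes_inv[OF \<rho>]
  have x': "place_perm (inv \<rho>) x \<in> tensor_power n (length C)"
    by (rule place_perm_tensor_power[OF \<rho>i x(1)])
  have "place_perm \<sigma> (place_perm (inv \<rho>) x) = place_perm (inv \<rho>) x" if \<sigma>: "\<sigma> \<in> label_stab (permute_list \<rho> R)" for \<sigma>
  proof -
    have *: "\<rho> \<circ> \<sigma> \<circ> inv \<rho> \<in> label_stab R"
      using label_stab_conjugate'[of \<rho> R \<sigma>] \<rho> \<sigma> len by simp
    have "place_perm \<sigma> (place_perm (inv \<rho>) x) = place_perm (\<sigma> \<circ> inv \<rho>) x"
      by (rule place_perm_compose[OF \<rho>i x(1)])
    also have "\<sigma> \<circ> inv \<rho> = inv \<rho> \<circ> (\<rho> \<circ> \<sigma> \<circ> inv \<rho>)"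
      by (simp add: fun_eq_iff permutes_inverses[OF \<rho>])
    also have "place_perm \<dots> x = place_perm (inv \<rho>) (place_perm (\<rho> \<circ> \<sigma> \<circ> inv \<rho>) x)"
      using label_stab_permutes[OF *] len x(1) by (intro place_perm_compose[symmetric]) auto
    also have "\<dots> = place_perm (inv \<rho>) x"
      by (simp add: x(2)[OF *])
    finally show ?thesis .
  qed
  moreover have "place_perm (inv \<rho>) y = label_antisym (permute_list \<rho> C) (place_perm (inv \<rho>) x)"
  proof -
    have bij: "bij_betw (\<lambda>\<sigma>. inv \<rho> \<circ> \<sigma> \<circ> \<rho>) (label_stab C) (label_stab (permute_list \<rho> C))"
      by (rule bij_betw_byWitness[where f' = "\<lambda>\<sigma>. \<rho> \<circ> \<sigma> \<circ> inv \<rho>"])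
        (use label_stab_conjugate[OF \<rho>] label_stab_conjugate'[OF \<rho>] in
          \<open>auto simp: fun_eq_iff permutes_inverses[OF \<rho>]\<close>)
    have "label_antisym (permute_list \<rho> C) (place_perm (inv \<rho>) x) = (\<Sum>\<sigma>\<in>label_stab C.
        tscale (of_int (sign (inv \<rho> \<circ> \<sigma> \<circ> \<rho>))) (place_perm (inv \<rho> \<circ> \<sigma> \<circ> \<rho>) (place_perm (inv \<rho>) x)))"
      unfolding label_antisym_def by (rule sum.reindex_bij_betw[OF bij, symmetric])
    also have "\<dots> = (\<Sum>\<sigma>\<in>label_stab C. place_perm (inv \<rho>) (tscale (of_int (sign \<sigma>)) (place_perm \<sigma> x)))"
    proof (rule sum.cong[OF refl])
      fix \<sigma> assume \<sigma>: "\<sigma> \<in> label_stab C"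
      note \<sigma>p = label_stab_permutes[OF \<sigma>]
      have "sign (inv \<rho> \<circ> \<sigma> \<circ> \<rho>) = sign \<sigma>"
        using permutes_permutation[OF \<rho>] permutes_permutation[OF \<rho>i] permutes_permutation[OF \<sigma>p]
        by (simp add: sign_compose permutation_compose sign_inverse)
      moreover have "place_perm (inv \<rho> \<circ> \<sigma> \<circ> \<rho>) (place_perm (inv \<rho>) x) = place_perm (inv \<rho> \<circ> \<sigma> \<circ> \<rho> \<circ> inv \<rho>) x"
        by (rule place_perm_compose[OF \<rho>i x(1)])
      moreover have "inv \<rho> \<circ> \<sigma> \<circ> \<rho> \<circ> inv \<rho> = inv \<rho> \<circ> \<sigma>"
        by (simp add: fun_eq_iff permutes_inverses[OF \<rho>])
      moreover have "place_perm (inv \<rho> \<circ> \<sigma>) x = place_perm (inv \<rho>) (place_perm \<sigma> x)"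
        by (rule place_perm_compose[OF \<sigma>p x(1), symmetric])
      ultimately show "tscale (of_int (sign (inv \<rho> \<circ> \<sigma> \<circ> \<rho>))) (place_perm (inv \<rho> \<circ> \<sigma> \<circ> \<rho>) (place_perm (inv \<rho>) x)) =
          place_perm (inv \<rho>) (tscale (of_int (sign \<sigma>)) (place_perm \<sigma> x))"
        by (simp add: place_perm_tscale)
    qed
    finally show ?thesis
      by (simp add: y label_antisym_def place_perm_sum)
  qed
  ultimately show "place_perm (inv \<rho>) y \<in> label_weyl n (permute_list \<rho> R) (permute_list \<rho> C)"
    using x' len unfolding label_weyl_def by auto
qed

lemma label_weyl_tensor_power:
  assumes "length R = length C"
  shows "label_weyl n R C \<subseteq> tensor_power n (length C)"
  using assms by (auto simp: label_weyl_def intro: label_antisym_tensor_power)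

text \<open>Another reading order of the diagram gives the image of the Weyl module under a place
  permutation, which commutes with the Schur algebra. This will move the new boxes of the extended
  diagram behind the old ones.\<close>

lemma label_weyl_conjugate:
  assumes \<rho>: "\<rho> permutes {..<length C}" and len: "length R = length C"
  shows "(label_weyl n (permute_list \<rho> R) (permute_list \<rho> C) :: 'k::field tensor set) =
    place_perm (inv \<rho>) ` label_weyl n R C"
proof
  show "(label_weyl n (permute_list \<rho> R) (permute_list \<rho> C) :: 'k::field tensor set) \<subseteq>
    place_perm (inv \<rho>) ` label_weyl n R C"
  proof
    fix y :: "'k tensor" assume y: "y \<in> label_weyl n (permute_list \<rho> R) (permute_list \<rho> C)"
    have "place_perm \<rho> y \<in> label_weyl n R C"
      using label_weyl_conjugate_subset[of "inv \<rho>" "permute_list \<rho> C" "permute_list \<rho> R" n] y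
        permutes_inv[OF \<rho>] \<rho> len by (auto simp: permute_list_inv permutes_inv_inv)
    moreover have "place_perm (inv \<rho>) (place_perm \<rho> y) = y"
      using place_perm_inverse(2)[OF \<rho>, of y n] y label_weyl_tensor_power[of "permute_list \<rho> R" "permute_list \<rho> C" n] len
      by auto
    ultimately show "y \<in> place_perm (inv \<rho>) ` label_weyl n R C"
      by (metis image_eqI)
  qed
qed (rule label_weyl_conjugate_subset[OF assms])

section \<open>Truncation along the new columns of height one\<close>

definition truncate_ones :: "nat \<Rightarrow> 'k::field tensor \<Rightarrow> 'k tensor" where
  "truncate_ones q x = (\<lambda>u. x (u @ replicate q 1))"

lemma truncate_ones_add: "truncate_ones q (x + y) = truncate_ones q x + truncate_ones q y"
  and truncate_ones_tscale: "truncate_ones q (tscale c x) = tscale c (truncate_ones q x)"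
  by (simp_all add: truncate_ones_def fun_eq_iff)

lemma truncate_ones_tensor_power:
  assumes "x \<in> tensor_power n (r + q)"
  shows "truncate_ones q x \<in> tensor_power n r"
proof -
  have "u @ replicate q 1 \<notin> multi_indices n (r + q)" if "u \<notin> multi_indices n r" for u
    using that by (auto simp: multi_indices_def)
  then show ?thesis
    using assms by (auto simp: tensor_power_def truncate_ones_def)
qed

lemma permute_list_append_left:
  assumes "\<sigma> permutes {..<length u}"
  shows "permute_list \<sigma> (u @ v) = permute_list \<sigma> u @ v"
proof (rule nth_equalityI)
  fix k assume "k < length (permute_list \<sigma> (u @ v))"
  moreover have "\<sigma> permutes {..<length (u @ v)}"
    using assms by (rule permutes_subset) auto
  moreover have "\<sigma> k < length u \<longleftrightarrow> k < length u"
    using permutes_in_image[OF assms, of k] by simp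
  moreover have "\<sigma> k = k" if "\<not> k < length u"
    using permutes_not_in[OF assms] that by simp
  ultimately show "permute_list \<sigma> (u @ v) ! k = (permute_list \<sigma> u @ v) ! k"
    using assms by (auto simp: permute_list_nth nth_append)
qed simp

lemma label_stab_append_subset: "label_stab C \<subseteq> label_stab (C @ D)"
proof
  fix \<sigma> assume "\<sigma> \<in> label_stab C"
  then show "\<sigma> \<in> label_stab (C @ D)"
    by (auto simp: label_stab_def permute_list_append_left intro: permutes_subset)
qed

lemma label_stab_append:
  assumes "distinct D" "set C \<inter> set D = {}"
  shows "label_stab (C @ D) = label_stab C"
proof
  show "label_stab (C @ D) \<subseteq> label_stab C"
  proof
    fix \<sigma> assume \<sigma>: "\<sigma> \<in> label_stab (C @ D)"
    note p = label_stab_permutes[OF \<sigma>]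
    have fixed: "\<sigma> k = k" if k: "\<not> k < length C" for k
    proof (cases "k < length (C @ D)")
      case True
      have \<sigma>k: "\<sigma> k < length (C @ D)"
        using permutes_in_image[OF p, of k] True by simp
      have eq: "(C @ D) ! \<sigma> k = D ! (k - length C)"
        using \<sigma> True k by (simp add: label_stab_iff nth_append)
      have mem: "D ! (k - length C) \<in> set D"
        using True k by (intro nth_mem) auto
      have "\<not> \<sigma> k < length C"
      proof
        assume "\<sigma> k < length C"
        then have "(C @ D) ! \<sigma> k \<in> set C"
          by (simp add: nth_append)
        then show False
          using eq mem assms(2) by auto
      qed
      then have "D ! (\<sigma> k - length C) = D ! (k - length C)"
        using eq by (simp add: nth_append)
      then have "\<sigma> k - length C = k - length C"
        using \<sigma>k True k \<open>\<not> \<sigma> k < length C\<close> assms(1) by (subst (asm) nth_eq_iff_index_eq) auto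
      then show ?thesis
        using k \<open>\<not> \<sigma> k < length C\<close> by simp
    next
      case False
      then show ?thesis
        using permutes_not_in[OF p] by simp
    qed
    have p': "\<sigma> permutes {..<length C}"
      by (rule permutes_superset[OF p]) (use fixed in auto)
    have "C ! \<sigma> k = C ! k" if "k < length C" for k
    proof -
      have "\<sigma> k < length C"
        using permutes_in_image[OF p', of k] that by simp
      moreover have "(C @ D) ! \<sigma> k = (C @ D) ! k"
        using \<sigma> that by (simp add: label_stab_iff)
      ultimately show ?thesis
        using that by (simp add: nth_append)
    qed
    then show "\<sigma> \<in> label_stab C"
      using p' by (simp add: label_stab_iff)
  qed
qed (rule label_stab_append_subset)

text \<open>Each new box is alone in its column, so the column stabilizer fixes the last
  \<open>q\<close> positions and never touches the appended ones.\<close>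

lemma truncate_label_antisym:
  assumes D: "distinct D" "set C \<inter> set D = {}" "length D = q"
    and x: "x \<in> tensor_power n (length C + q)"
  shows "truncate_ones q (label_antisym (C @ D) x) = label_antisym C (truncate_ones q x)"
proof
  fix u
  have xD: "x \<in> tensor_power n (length (C @ D))"
    using x D by simp
  show "truncate_ones q (label_antisym (C @ D) x) u = label_antisym C (truncate_ones q x) u"
  proof (cases "length u = length C")
    case True
    have "permute_list \<sigma> (u @ replicate q 1) = permute_list \<sigma> u @ replicate q 1" if "\<sigma> \<in> label_stab C" for \<sigma>
      using label_stab_permutes[OF that] True by (intro permute_list_append_left) simp
    then show ?thesis
      by (simp add: truncate_ones_def label_antisym_apply label_stab_append[OF D(1,2)])
  next
    case False
    have "label_antisym C (truncate_ones q x) \<in> tensor_power n (length C)"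
      by (rule label_antisym_tensor_power[OF truncate_ones_tensor_power[OF x]])
    moreover have "truncate_ones q (label_antisym (C @ D) x) \<in> tensor_power n (length C)"
      using label_antisym_tensor_power[OF xD] D by (intro truncate_ones_tensor_power) simp
    ultimately show ?thesis
      using False tensor_power_length by metis
  qed
qed

text \<open>The multiset of pairs (row, letter) records the content of each row; words with equal
  row contents differ by a row permutation.\<close>

lemma label_symmetric_cong:
  assumes sym: "\<And>\<sigma>. \<sigma> \<in> label_stab R \<Longrightarrow> place_perm \<sigma> x = x"
    and len: "length u = length R" "length u' = length R" and eq: "mset (zip R u) = mset (zip R u')"
  shows "x u = x u'"
proof -
  obtain \<tau> where \<tau>: "\<tau> permutes {..<length (zip R u')}" "permute_list \<tau> (zip R u') = zip R u"
    using mset_eq_permutation[OF eq] by blast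
  have \<tau>R: "\<tau> permutes {..<length R}"
    using \<tau>(1) len by simp
  have "zip (permute_list \<tau> R) (permute_list \<tau> u') = zip R u"
    using \<tau> len by (subst permute_list_zip[symmetric]) auto
  then have "permute_list \<tau> R = R" "permute_list \<tau> u' = u"
    using len by (metis length_permute_list map_fst_zip, metis length_permute_list map_snd_zip)
  then have "\<tau> \<in> label_stab R" "permute_list \<tau> u' = u"
    using \<tau>R by (auto simp: label_stab_def)
  then show ?thesis
    using sym by (metis place_perm_def)
qed

text \<open>
  Divided powers: this lifts \<open>1\<^sup>(\<^sup>k\<^sup>) y\<close> to \<open>1\<^sup>(\<^sup>k\<^sup>+\<^sup>q\<^sup>) y\<close> in the row with label \<open>a\<close>. Multiplication by \<open>1\<^sup>(\<^sup>q\<^sup>)\<close> would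
  introduce a binomial coefficient, so \<open>x'\<close> is defined through row contents.
\<close>

lemma symmetric_lift:
  fixes x :: "'k::field tensor"
  assumes n: "1 \<le> n" and x: "x \<in> tensor_power n (length R)"
    and sym: "\<And>\<sigma>. \<sigma> \<in> label_stab R \<Longrightarrow> place_perm \<sigma> x = x"
  obtains x' where "x' \<in> tensor_power n (length R + q)"
    "\<And>\<sigma>. \<sigma> \<in> label_stab (R @ replicate q a) \<Longrightarrow> place_perm \<sigma> x' = x'" "truncate_ones q x' = x"
proof -
  define R' where "R' = R @ replicate q a"
  define P where "P w u \<longleftrightarrow> length w = length R' \<and> length u = length R \<and>
    mset (zip R' w) = mset (zip R' (u @ replicate q (1::nat)))" for w u
  \<comment> \<open>\<open>P w u\<close> says that \<open>w\<close> has the row contents of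
    \<open>u\<close> together with \<open>q\<close> more ones in row \<open>a\<close>. All such
    \<open>u\<close> have the same contents, so the choice is immaterial; words with fewer than
    \<open>q\<close> ones in row \<open>a\<close> admit no \<open>u\<close> and get 0.\<close>
  define x' where "x' w = (if \<exists>u. P w u then x (SOME u. P w u) else 0)" for w
  have zip: "mset (zip R' (u @ replicate q 1)) = mset (zip R u) + mset (zip (replicate q a) (replicate q 1))"
    if "length u = length R" for u
    using that by (simp add: R'_def)
  have x': "x' w = x u" if "P w u" for w u
  proof -
    have S: "P w (SOME u. P w u)"
      using that by (rule someI)
    have "x (SOME u. P w u) = x u"
      by (rule label_symmetric_cong[OF sym])
        (use S that zip[of u] zip[of "SOME u. P w u"] in \<open>auto simp: P_def\<close>)
    then show ?thesis
      using that by (auto simp: x'_def)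
  qed
  have "x' w = 0" if w: "w \<notin> multi_indices n (length R + q)" for w
  proof (cases "\<exists>u. P w u")
    case True
    then obtain u where u: "P w u" by blast
    then have "set (zip R' w) = set (zip R' (u @ replicate q 1))"
      using mset_eq_setD by (auto simp: P_def)
    then have "snd ` set (zip R' w) = snd ` set (zip R' (u @ replicate q 1))"
      by simp
    then have "set w = set (u @ replicate q 1)"
      using u by (simp add: P_def R'_def del: zip_append set_append flip: set_map)
    then have "u \<notin> multi_indices n (length R)"
      using w u n by (auto simp: multi_indices_def P_def R'_def)
    then show ?thesis
      using x'[OF u] x by (simp add: tensor_power_def)
  qed (simp add: x'_def)
  then have 1: "x' \<in> tensor_power n (length R + q)"
    by (auto simp: tensor_power_def)
  have 2: "place_perm \<sigma> x' = x'" if \<sigma>: "\<sigma> \<in> label_stab R'" for \<sigma>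
  proof
    fix w
    have "P (permute_list \<sigma> w) = P w"
    proof (intro ext, cases "length w = length R'")
      case True
      fix u
      have "\<sigma> permutes {..<length w}" "permute_list \<sigma> R' = R'"
        using \<sigma> True by (auto simp: label_stab_def)
      then have "zip R' (permute_list \<sigma> w) = permute_list \<sigma> (zip R' w)"
        using True by (simp add: permute_list_zip)
      then show "P (permute_list \<sigma> w) u = P w u"
        using True \<sigma> by (simp add: P_def label_stab_permutes)
    qed (simp add: P_def)
    then show "place_perm \<sigma> x' w = x' w"
      by (auto simp: place_perm_def x'_def)
  qed
  have "truncate_ones q x' = x"
  proof
    fix u
    show "truncate_ones q x' u = x u"
    proof (cases "length u = length R")
      case True
      then have "P (u @ replicate q 1) u"
        by (simp add: P_def R'_def)
      then show ?thesis
        by (simp add: truncate_ones_def x')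
    next
      case False
      then show ?thesis
        using x truncate_ones_tensor_power[OF 1] tensor_power_length by metis
    qed
  qed
  then show ?thesis
    using that 1 2 by (simp add: R'_def)
qed

text \<open>Truncation commutes with antisymmetrization over columns, which reduces the claim to
  row-symmetric tensors: these truncate to row-symmetric tensors, and \<open>symmetric_lift\<close>
  supplies preimages.\<close>

lemma truncate_label_weyl:
  assumes n: "1 \<le> n" and len: "length R = length C"
    and D: "distinct D" "set C \<inter> set D = {}" "length D = q"
  shows "truncate_ones q ` (label_weyl n (R @ replicate q a) (C @ D) :: 'k::field tensor set) = label_weyl n R C"
proof (intro equalityI subsetI)
  fix y :: "'k tensor" assume "y \<in> truncate_ones q ` label_weyl n (R @ replicate q a) (C @ D)"
  then obtain x where x: "x \<in> tensor_power n (length C + q)"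
      "\<And>\<sigma>. \<sigma> \<in> label_stab (R @ replicate q a) \<Longrightarrow> place_perm \<sigma> x = x"
    and y: "y = truncate_ones q (label_antisym (C @ D) x)"
    using len D by (auto simp: label_weyl_def)
  have "place_perm \<sigma> (truncate_ones q x) = truncate_ones q x" if \<sigma>: "\<sigma> \<in> label_stab R" for \<sigma>
  proof
    fix u
    show "place_perm \<sigma> (truncate_ones q x) u = truncate_ones q x u"
    proof (cases "length u = length C")
      case True
      then have "permute_list \<sigma> (u @ replicate q 1) = permute_list \<sigma> u @ replicate q 1"
        using label_stab_permutes[OF \<sigma>] len by (intro permute_list_append_left) simp
      moreover have "place_perm \<sigma> x (u @ replicate q 1) = x (u @ replicate q 1)"
        using x(2) label_stab_append_subset \<sigma> by (metis subsetD)
      ultimately show ?thesis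
        by (simp add: place_perm_def truncate_ones_def)
    next
      case False
      then show ?thesis
        using tensor_power_length[OF truncate_ones_tensor_power[OF x(1)]]
        by (metis length_permute_list place_perm_def)
    qed
  qed
  then show "y \<in> label_weyl n R C"
    using truncate_ones_tensor_power[OF x(1)] truncate_label_antisym[OF D x(1)] y len
    by (auto simp: label_weyl_def)
next
  fix y :: "'k tensor" assume "y \<in> label_weyl n R C"
  then obtain x where x: "x \<in> tensor_power n (length R)" "\<And>\<sigma>. \<sigma> \<in> label_stab R \<Longrightarrow> place_perm \<sigma> x = x"
    and y: "y = label_antisym C x"
    by (auto simp: label_weyl_def)
  obtain x' where x': "x' \<in> tensor_power n (length R + q)"
    "\<And>\<sigma>. \<sigma> \<in> label_stab (R @ replicate q a) \<Longrightarrow> place_perm \<sigma> x' = x'" "truncate_ones q x' = x"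
    using symmetric_lift[OF n x] by metis
  have "y = truncate_ones q (label_antisym (C @ D) x')"
    using truncate_label_antisym[OF D, of x' n] x' len y by simp
  moreover have "label_antisym (C @ D) x' \<in> label_weyl n (R @ replicate q a) (C @ D)"
    using x' by (auto simp: label_weyl_def)
  ultimately show "y \<in> truncate_ones q ` label_weyl n (R @ replicate q a) (C @ D)"
    by blast
qed

text \<open>The new boxes share a row, so \<open>\<tau>\<close> fixes the row-symmetric
  \<open>x\<close>; they are alone in their columns, so \<open>\<tau>\<close> commutes with the
  column stabilizer. Hence a coefficient depends on the letters in the new boxes only up to
  order.\<close>

lemma label_weyl_new_symmetric:
  assumes len: "length R = length C" and D: "distinct D" "set C \<inter> set D = {}" "length D = q"
    and y: "y \<in> label_weyl n (R @ replicate q a) (C @ D)"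
    and \<tau>: "\<tau> permutes {length C..<length C + q}"
  shows "place_perm \<tau> y = y"
proof -
  obtain x where x: "x \<in> tensor_power n (length C + q)"
      "\<And>\<sigma>. \<sigma> \<in> label_stab (R @ replicate q a) \<Longrightarrow> place_perm \<sigma> x = x"
    and y: "y = label_antisym (C @ D) x"
    using y len D by (auto simp: label_weyl_def)
  have \<tau>p: "\<tau> permutes {..<length C + q}"
    using \<tau> by (rule permutes_subset) auto
  have "(R @ replicate q a) ! \<tau> k = (R @ replicate q a) ! k" if "k < length C + q" for k
  proof (cases "k < length C")
    case True
    then show ?thesis
      using permutes_not_in[OF \<tau>, of k] by simp
  next
    case False
    then have "\<tau> k \<in> {length C..<length C + q}"
      using permutes_in_image[OF \<tau>, of k] that by simp
    moreover from this have "\<tau> k - length C < q" "k - length C < q"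
      using False that by auto
    ultimately show ?thesis
      using False len by (simp add: nth_append)
  qed
  then have \<tau>s: "\<tau> \<in> label_stab (R @ replicate q a)"
    using \<tau>p len by (simp add: label_stab_iff)
  have "place_perm \<tau> (place_perm \<sigma> x) = place_perm \<sigma> x" if \<sigma>: "\<sigma> \<in> label_stab C" for \<sigma>
  proof -
    have \<sigma>p: "\<sigma> permutes {..<length C}"
      by (rule label_stab_permutes[OF \<sigma>])
    then have \<sigma>p': "\<sigma> permutes {..<length C + q}"
      by (rule permutes_subset) auto
    have comm: "\<tau> \<circ> \<sigma> = \<sigma> \<circ> \<tau>"
    proof
      fix k
      show "(\<tau> \<circ> \<sigma>) k = (\<sigma> \<circ> \<tau>) k"
      proof (cases "k < length C")
        case True
        then have "\<sigma> k < length C"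
          using permutes_in_image[OF \<sigma>p, of k] by simp
        then show ?thesis
          using True permutes_not_in[OF \<tau>, of k] permutes_not_in[OF \<tau>, of "\<sigma> k"] by simp
      next
        case False
        then have "\<not> \<tau> k < length C"
          using permutes_in_image[OF \<tau>, of k] permutes_not_in[OF \<tau>, of k]
          by (cases "k < length C + q") auto
        then show ?thesis
          using False permutes_not_in[OF \<sigma>p, of k] permutes_not_in[OF \<sigma>p, of "\<tau> k"] by simp
      qed
    qed
    show ?thesis
      using place_perm_compose[OF \<sigma>p' x(1), of \<tau>] place_perm_compose[OF \<tau>p x(1), of \<sigma>] comm x(2)[OF \<tau>s]
      by simp
  qed
  then show ?thesis
    unfolding y label_antisym_def label_stab_append[OF D(1,2)] place_perm_sum place_perm_tscale
    by (intro sum.cong) auto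
qed

section \<open>Removing columns of height one\<close>

text \<open>With \<open>q = p ^ d\<close> one has
  \<open>j * (q choose j) = q * (q - 1 choose (j - 1))\<close>. If \<open>p\<close> did not divide
  \<open>q choose j\<close>, then \<open>q\<close> would divide \<open>j\<close>, which is too
  small.\<close>

lemma of_nat_choose_prime_power_eq_0:
  assumes "CHAR('k::field) = p" "p > 0" "0 < j" "j < p ^ d"
  shows "of_nat (p ^ d choose j) = (0 :: 'k)"
proof -
  have p: "prime p"
    using prime_CHAR_semidom[where 'a = 'k] assms by simp
  have "p dvd (p ^ d choose j)"
  proof (rule ccontr)
    assume "\<not> p dvd (p ^ d choose j)"
    then have "coprime (p ^ d) (p ^ d choose j)"
      using p by (simp add: prime_imp_coprime)
    moreover have "p ^ d dvd j * (p ^ d choose j)"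
      using times_binomial_minus1_eq[OF assms(3), of "p ^ d"] by simp
    ultimately have "p ^ d dvd j"
      by (simp add: coprime_dvd_mult_left_iff)
    then show False
      using assms by (auto dest: dvd_imp_le)
  qed
  then show ?thesis
    using assms by (simp add: of_nat_eq_0_iff_char_dvd)
qed

lemma permutes_moving_subset:
  assumes "finite N" "S \<subseteq> N" "S' \<subseteq> N" "card S = card S'"
  obtains \<tau> where "\<tau> permutes N" "\<And>k. k \<in> N \<Longrightarrow> \<tau> k \<in> S \<longleftrightarrow> k \<in> S'"
proof -
  have fin: "finite S" "finite S'"
    using assms by (auto intro: finite_subset)
  obtain f where f: "bij_betw f S' S"
    using finite_same_card_bij[OF fin(2,1)] assms by auto
  have "card (N - S') = card (N - S)"
    using assms fin by (simp add: card_Diff_subset)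
  then obtain g where g: "bij_betw g (N - S') (N - S)"
    using finite_same_card_bij[of "N - S'" "N - S"] assms by auto
  define \<tau> where "\<tau> k = (if k \<in> S' then f k else if k \<in> N then g k else k)" for k
  have 1: "bij_betw \<tau> S' S"
    using f by (rule bij_betw_cong[THEN iffD1, rotated]) (simp add: \<tau>_def)
  have 2: "bij_betw \<tau> (N - S') (N - S)"
    using g by (rule bij_betw_cong[THEN iffD1, rotated]) (simp add: \<tau>_def)
  have "bij_betw \<tau> (S' \<union> (N - S')) (S \<union> (N - S))"
    by (rule bij_betw_combine[OF 1 2]) auto
  moreover have "S' \<union> (N - S') = N" "S \<union> (N - S) = N"
    using assms by auto
  ultimately have "\<tau> permutes N"
    using assms by (intro bij_imp_permutes) (auto simp: \<tau>_def)
  moreover have "\<tau> k \<in> S \<longleftrightarrow> k \<in> S'" if "k \<in> N" for k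
    using bij_betwE[OF 1] bij_betwE[OF 2] that by blast
  ultimately show ?thesis
    using that by blast
qed

text \<open>The new positions carry the letter 1, so they matter only for \<open>i = 1\<close>.
  There a set of changed positions splits into an old part \<open>S1\<close> and a new part
  \<open>S2\<close>. By symmetry the choices of \<open>S2\<close> of one size contribute equally, so
  they sum to a multiple of a binomial coefficient, zero in the field unless \<open>S2\<close> is
  empty.\<close>

lemma truncate_raising_op:
  fixes w :: "'k::field tensor"
  assumes w: "w \<in> tensor_power n (r + q)"
    and sym: "\<And>\<tau>. \<tau> permutes {r..<r + q} \<Longrightarrow> place_perm \<tau> w = w"
    and i: "1 \<le> i" "i < n"
    and it: "i \<noteq> 1 \<or> (\<forall>j. 0 < j \<and> j \<le> t \<longrightarrow> of_nat (q choose j) = (0 :: 'k))"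
  shows "truncate_ones q (raising_op n (r + q) i t w) = raising_op n r i t (truncate_ones q w)"
proof
  fix u
  have wT: "truncate_ones q w \<in> tensor_power n r"
    by (rule truncate_ones_tensor_power[OF w])
  show "truncate_ones q (raising_op n (r + q) i t w) u = raising_op n r i t (truncate_ones q w) u"
  proof (cases "length u = r")
    case False
    have "raising_op n r i t (truncate_ones q w) \<in> tensor_power n r"
      "truncate_ones q (raising_op n (r + q) i t w) \<in> tensor_power n r"
      using lin_mapsD(1)[OF schur_algebra_lin[OF raising_op_schur[OF i]]] w wT
      by (auto intro: truncate_ones_tensor_power)
    then show ?thesis
      using False tensor_power_length by metis
  next
    case len: True
    let ?u = "u @ replicate q 1"
    let ?f = "\<lambda>S. w (change_letters S (Suc i) ?u)"
    let ?P = "letter_positions i u"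
    let ?A = "{S. S \<subseteq> ?P \<and> card S = t}"
    have Pr: "?P \<subseteq> {..<r}"
      using len by (auto simp: letter_positions_def)
    have app: "change_letters S (Suc i) ?u = change_letters S (Suc i) u @ replicate q 1"
      if "S \<subseteq> ?P" for S
      using that Pr len by (intro nth_equalityI) (auto simp: nth_append)
    have R: "raising_op n r i t (truncate_ones q w) u = (\<Sum>S\<in>?A. ?f S)"
      using wT by (auto simp: raising_op_def truncate_ones_def app simp del: One_nat_def intro!: sum.cong)
    have L: "truncate_ones q (raising_op n (r + q) i t w) u =
        (\<Sum>S | S \<subseteq> letter_positions i ?u \<and> card S = t. ?f S)"
      using w by (simp add: truncate_ones_def raising_op_def)
    show ?thesis
    proof (cases "i = 1")
      case False
      have "?u ! k = 1" if "length u \<le> k" "k < length u + q" for k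
        using that by (simp add: nth_append)
      then have "k \<in> letter_positions i ?u \<longleftrightarrow> k \<in> ?P" for k
        using False by (cases "k < length u") (auto simp: letter_positions_def nth_append)
      then have "letter_positions i ?u = ?P"
        by blast
      then show ?thesis
        unfolding L R by simp
    next
      case i1: True
      let ?N = "{r..<r + q}"
      let ?B = "\<lambda>S1. {S2. S2 \<subseteq> ?N \<and> card S2 = t - card S1}"
      have lp: "letter_positions i ?u = ?P \<union> ?N"
        using len i1 by (auto simp: letter_positions_def nth_append)
      have disj: "?P \<inter> ?N = {}"
        using Pr by auto
      have finP: "finite S1" if "S1 \<subseteq> ?P" for S1
        using that finite_subset finite_letter_positions by blast
      have finN: "finite S2" if "S2 \<subseteq> ?N" for S2
        using that finite_subset by blast
      have card: "card (S1 \<union> S2) = card S1 + card S2" if "S1 \<subseteq> ?P" "S2 \<subseteq> ?N" for S1 S2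
        using that finP finN disj by (intro card_Un_disjoint) auto
      have bij: "bij_betw (\<lambda>(S1, S2). S1 \<union> S2) (Sigma {S1. S1 \<subseteq> ?P \<and> card S1 \<le> t} ?B)
          {S. S \<subseteq> ?P \<union> ?N \<and> card S = t}"
      proof (rule bij_betw_byWitness[where f' = "\<lambda>S. (S \<inter> ?P, S \<inter> ?N)"])
        show "(\<lambda>(S1, S2). S1 \<union> S2) ` Sigma {S1. S1 \<subseteq> ?P \<and> card S1 \<le> t} ?B
            \<subseteq> {S. S \<subseteq> ?P \<union> ?N \<and> card S = t}"
          by (auto simp: card)
        have "card S = card (S \<inter> ?P) + card (S \<inter> ?N)" if "S \<subseteq> ?P \<union> ?N" for S
        proof -
          have "S = (S \<inter> ?P) \<union> (S \<inter> ?N)"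
            using that by auto
          then show ?thesis
            using card[of "S \<inter> ?P" "S \<inter> ?N"] by simp
        qed
        then show "(\<lambda>S. (S \<inter> ?P, S \<inter> ?N)) ` {S. S \<subseteq> ?P \<union> ?N \<and> card S = t} \<subseteq>
            Sigma {S1. S1 \<subseteq> ?P \<and> card S1 \<le> t} ?B"
          by auto
      qed (use disj in auto)
      have inner: "(\<Sum>S2\<in>?B S1. ?f (S1 \<union> S2)) = (if card S1 = t then ?f S1 else 0)"
        if S1: "S1 \<subseteq> ?P" "card S1 \<le> t" for S1
      proof (cases "card S1 = t")
        case True
        then have "?B S1 = {{}}"
          using finN by auto
        then show ?thesis
          using True by simp
      next
        case False
        \<comment> \<open>A permutation of the new positions taking \<open>S3\<close> to
          \<open>S2\<close> fixes \<open>w\<close> and leaves the old letters in place.\<close>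
        have const: "?f (S1 \<union> S2) = ?f (S1 \<union> S3)" if S: "S2 \<in> ?B S1" "S3 \<in> ?B S1" for S2 S3
        proof -
          obtain \<tau> where \<tau>: "\<tau> permutes ?N" "\<And>k. k \<in> ?N \<Longrightarrow> \<tau> k \<in> S2 \<longleftrightarrow> k \<in> S3"
            using permutes_moving_subset[of ?N S2 S3] S by auto
          have \<tau>p: "\<tau> permutes {..<length ?u}"
            using \<tau>(1) by (rule permutes_subset) (use len in auto)
          have "permute_list \<tau> (change_letters (S1 \<union> S2) (Suc i) ?u) = change_letters (S1 \<union> S3) (Suc i) ?u"
          proof (rule nth_equalityI)
            fix k assume "k < length (permute_list \<tau> (change_letters (S1 \<union> S2) (Suc i) ?u))"
            then have k: "k < r + q"
              using len by simp
            have 1: "permute_list \<tau> (change_letters (S1 \<union> S2) (Suc i) ?u) ! k =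
                change_letters (S1 \<union> S2) (Suc i) ?u ! \<tau> k"
              using \<tau>p k len by (intro permute_list_nth) auto
            have \<tau>k: "\<tau> k < length ?u"
              using permutes_in_image[OF \<tau>p, of k] k len by simp
            show "permute_list \<tau> (change_letters (S1 \<union> S2) (Suc i) ?u) ! k =
                change_letters (S1 \<union> S3) (Suc i) ?u ! k"
            proof (cases "k < r")
              case True
              then have "\<tau> k = k"
                using permutes_not_in[OF \<tau>(1), of k] by simp
              moreover have "k \<notin> S2" "k \<notin> S3"
                using True S by auto
              ultimately show ?thesis
                unfolding 1 using k len by simp
            next
              case False
              then have kN: "k \<in> ?N"
                using k by simp
              have \<tau>kN: "\<tau> k \<in> ?N"
                using permutes_in_image[OF \<tau>(1), of k] kN by blast
              have "k \<notin> S1" "\<tau> k \<notin> S1"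
                using kN \<tau>kN S1 disj by blast+
              moreover have "?u ! k = 1" "?u ! \<tau> k = 1"
                using kN \<tau>kN len by (auto simp: nth_append)
              ultimately show ?thesis
                unfolding 1 using k len \<tau>k \<tau>(2)[OF kN] by simp
            qed
          qed simp
          then show ?thesis
            using sym[OF \<tau>(1)] by (metis place_perm_def)
        qed
        define c where "c = ?f (S1 \<union> (SOME S. S \<in> ?B S1))"
        have c: "?f (S1 \<union> S2) = c" if "S2 \<in> ?B S1" for S2
          unfolding c_def by (rule const[OF that someI[of "\<lambda>S. S \<in> ?B S1", OF that]])
        have "(\<Sum>S2\<in>?B S1. ?f (S1 \<union> S2)) = (\<Sum>S2\<in>?B S1. c)"
          by (rule sum.cong) (use c in auto)
        also have "\<dots> = of_nat (q choose (t - card S1)) * c"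
          using n_subsets[of ?N "t - card S1"] by simp
        also have "of_nat (q choose (t - card S1)) = (0 :: 'k)"
          using it i1 False S1 by (metis diff_le_self le_neq_implies_less zero_less_diff)
        finally show ?thesis
          using False by simp
      qed
      have "(\<Sum>S | S \<subseteq> ?P \<union> ?N \<and> card S = t. ?f S) =
          (\<Sum>(S1, S2)\<in>Sigma {S1. S1 \<subseteq> ?P \<and> card S1 \<le> t} ?B. ?f (S1 \<union> S2))"
        by (subst sum.reindex_bij_betw[OF bij, symmetric]) (simp add: case_prod_beta)
      also have "\<dots> = (\<Sum>S1 | S1 \<subseteq> ?P \<and> card S1 \<le> t. \<Sum>S2\<in>?B S1. ?f (S1 \<union> S2))"
        by (rule sum.Sigma[symmetric]) auto
      also have "\<dots> = (\<Sum>S1 | S1 \<subseteq> ?P \<and> card S1 \<le> t. if card S1 = t then ?f S1 else 0)"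
        by (rule sum.cong[OF refl]) (use inner in auto)
      also have "\<dots> = (\<Sum>S\<in>?A. ?f S)"
        by (rule sum.mono_neutral_cong_right) auto
      finally show ?thesis
        unfolding L R lp .
    qed
  qed
qed

section \<open>Testing the vanishing of antisymmetrized tensors on few words\<close>

lemma letter_positions_transpose:
  assumes "a < length u" "b < length u"
  shows "letter_positions c (permute_list (transpose a b) u) = transpose a b ` letter_positions c u"
proof -
  have p: "transpose a b permutes {..<length u}"
    using assms by (intro permutes_swap_id) auto
  show ?thesis
    unfolding letter_positions_permute[OF p]
  proof (intro set_eqI iffI)
    fix k assume "k \<in> transpose a b -` letter_positions c u"
    then show "k \<in> transpose a b ` letter_positions c u"
      by (intro image_eqI[of k _ "transpose a b k"]) auto
  qed auto
qed

lemma nth_permute_list_transpose: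
  assumes "a < length u" "b < length u" "k < length u"
  shows "permute_list (transpose a b) u ! k = (if k = a then u ! b else if k = b then u ! a else u ! k)"
  using permute_list_nth[OF permutes_swap_id[of a "{..<length u}" b], of k] assms
  by (auto simp: transpose_def)

text \<open>Pigeonhole: with more letters \<open>c\<close> than columns, some column contains
  \<open>c\<close> twice.\<close>

lemma label_antisym_eq_0_of_card:
  assumes len: "length u = length C" and card: "card (set C) < card (letter_positions c u)"
  shows "label_antisym C x u = 0"
proof -
  have "card ((\<lambda>k. C ! k) ` letter_positions c u) \<le> card (set C)"
    using len by (intro card_mono) (auto simp: letter_positions_def)
  then have "\<not> inj_on (\<lambda>k. C ! k) (letter_positions c u)"
    using card card_image by fastforce
  then obtain a b where "a \<in> letter_positions c u" "b \<in> letter_positions c u" "a \<noteq> b" "C ! a = C ! b"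
    by (auto simp: inj_on_def)
  then show ?thesis
    using len by (intro label_antisym_eq_0[of a C b]) (auto simp: letter_positions_def)
qed

text \<open>
  Here \<open>T\<close> and \<open>Sg\<close> are the first-row boxes of the tall columns and of the columns of height one.
  Exchanges move letters \<open>c\<close> from columns of height one into tall columns without \<open>c\<close>; afterwards
  the letters \<open>c\<close> are sorted into \<open>C0\<close>.
\<close>

lemma vanishing_test:
  fixes x :: "'k::field tensor"
  assumes sym: "\<And>\<sigma>. \<sigma> \<in> label_stab R \<Longrightarrow> place_perm \<sigma> x = x"
    and len: "length R = length C"
    and T: "T \<subseteq> {k. k < length C \<and> R ! k = a}" "inj_on (\<lambda>k. C ! k) T"
    and Sg: "Sg \<subseteq> {k. k < length C \<and> R ! k = a}"
      "\<And>m k. m \<in> Sg \<Longrightarrow> k < length C \<Longrightarrow> C ! k = C ! m \<Longrightarrow> k = m"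
    and TS: "T \<inter> Sg = {}"
    and cover: "\<And>k. k < length C \<Longrightarrow> k \<in> Sg \<or> (\<exists>t\<in>T. C ! k = C ! t)"
    and C0: "T \<subseteq> C0" "C0 \<subseteq> T \<union> Sg"
    and van: "\<And>u. length u = length C \<Longrightarrow> letter_positions c u = C0 \<Longrightarrow> label_antisym C x u = 0"
  shows "length u = length C \<Longrightarrow> card (letter_positions c u) = card C0 \<Longrightarrow> label_antisym C x u = 0"
proof -
  \<comment> \<open>Lexicographic measure: \<open>E u\<close> collects the tall columns without
    \<open>c\<close>, and the second count is that of the boxes of \<open>C0\<close> without
    \<open>c\<close>. The factor \<open>N\<close> exceeds every value of the second count, which may
    therefore grow when the first drops.\<close>
  define E where "E u = {t \<in> T. \<forall>k<length C. C ! k = C ! t \<longrightarrow> u ! k \<noteq> c}" for u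
  define N where "N = Suc (length C)"
  have T_lt: "t < length C" "R ! t = a" if "t \<in> T" for t
    using T(1) that by auto
  have S_lt: "t < length C" "R ! t = a" if "t \<in> Sg" for t
    using Sg(1) that by auto
  have finT: "finite T"
    by (rule finite_subset[OF T(1)]) simp
  have C0_lt: "C0 \<subseteq> {..<length C}"
    using C0 T_lt S_lt by auto
  have finC0: "finite C0"
    using C0_lt finite_subset by blast
  have cardC0: "card (C0 - A) < N" for A :: "nat set"
  proof -
    have "card (C0 - A) \<le> card {..<length C}"
      using C0_lt by (intro card_mono) auto
    then show ?thesis by (simp add: N_def)
  qed
  have measure: "card (E u') * N + card (C0 - A) < card (E u) * N + card (C0 - B)"
    if "card (E u') < card (E u)" for u u' A B
  proof -
    have "card (E u') * N + card (C0 - A) < Suc (card (E u')) * N"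
      using cardC0[of A] by simp
    also have "\<dots> \<le> card (E u) * N"
      using that by (intro mult_right_mono) auto
    finally show ?thesis by simp
  qed
  have measure': "card (E u') * N + card (C0 - A) < card (E u) * N + card (C0 - B)"
    if "card (E u') \<le> card (E u)" "C0 - A \<subset> C0 - B" for u u' A B
    using that finC0 by (intro add_le_less_mono mult_right_mono psubset_card_mono) auto
  have finE: "finite (E u)" for u
    using finT by (simp add: E_def)
  show "length u = length C \<Longrightarrow> card (letter_positions c u) = card C0 \<Longrightarrow> label_antisym C x u = 0"
  proof (induction "card (E u) * N + card (C0 - letter_positions c u)" arbitrary: u rule: less_induct)
    case less
    let ?P = "letter_positions c u"
    let ?y = "label_antisym C x"
    have lu: "length u = length C" by fact
    have P_lt: "k < length C" "u ! k = c" if "k \<in> ?P" for k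
      using that lu by (auto simp: letter_positions_def)
    have card': "card (letter_positions c (permute_list (transpose k b) u)) = card C0"
      if "k < length C" "b < length C" for k b
      using that lu less.prems(2) by (simp add: letter_positions_transpose card_image)
    show ?case
    proof (cases "inj_on (\<lambda>k. C ! k) ?P")
      case False
      then obtain k b where "k \<in> ?P" "b \<in> ?P" "k \<noteq> b" "C ! k = C ! b"
        by (auto simp: inj_on_def)
      then show ?thesis
        using lu by (intro label_antisym_eq_0[of k C b]) (auto simp: letter_positions_def)
    next
      case inj: True
      show ?thesis
      proof (cases "E u = {}")
        case False
        then obtain t where t: "t \<in> E u" by blast
        then have tT: "t \<in> T" by (simp add: E_def)
        \<comment> \<open>Otherwise the letters \<open>c\<close> would lie in different tall
          columns, none of them that of \<open>t\<close>. That leaves room for fewer than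
          \<open>card T\<close> of them, but there are \<open>card C0\<close>.\<close>
        have "\<exists>m. m \<in> ?P \<inter> Sg"
        proof (rule ccontr)
          assume none: "\<nexists>m. m \<in> ?P \<inter> Sg"
          have "\<exists>s\<in>T - E u. C ! k = C ! s" if k: "k \<in> ?P" for k
          proof -
            obtain s where s: "s \<in> T" "C ! k = C ! s"
              using cover[of k] P_lt[OF k] none k by blast
            then have "s \<notin> E u"
              using P_lt[OF k] by (auto simp: E_def)
            then show ?thesis
              using s by blast
          qed
          then have "(\<lambda>k. C ! k) ` ?P \<subseteq> (\<lambda>k. C ! k) ` (T - E u)"
            by blast
          then have "card ((\<lambda>k. C ! k) ` ?P) \<le> card (T - E u)"
            using finT by (meson card_image_le card_mono finite_Diff finite_imageI le_trans)
          also have "\<dots> < card T"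
            using t tT finT by (intro psubset_card_mono) auto
          also have "\<dots> \<le> card C0"
            using finC0 C0 by (intro card_mono)
          finally show False
            using less.prems(2) by (simp add: card_image[OF inj])
        qed
        then obtain m where m: "m \<in> ?P" "m \<in> Sg" by blast
        have mt: "C ! m \<noteq> C ! s" if "s \<in> T" for s
          using Sg(2)[OF m(2), of s] T_lt[OF that] that m TS by auto
        \<comment> \<open>Each exchange term has the letter \<open>c\<close> of \<open>m\<close> in
          the column of \<open>t\<close>, and no other tall column is touched; so \<open>t\<close>
          leaves \<open>E\<close> and nothing enters.\<close>
        have 0: "?y (permute_list (transpose m b) u) = 0" if b: "b < length C" "C ! b = C ! t" for b
        proof (rule less.hyps)
          let ?u' = "permute_list (transpose m b) u"
          have nth: "?u' ! k = (if k = m then u ! b else if k = b then u ! m else u ! k)" if "k < length C" for k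
            using nth_permute_list_transpose[of m u b k] P_lt[OF m(1)] b that lu by simp
          have "E ?u' \<subseteq> E u - {t}"
          proof
            fix s assume s: "s \<in> E ?u'"
            then have sT: "s \<in> T" by (simp add: E_def)
            have "s \<noteq> t"
            proof
              assume "s = t"
              then have "?u' ! b \<noteq> c"
                using s b by (auto simp: E_def)
              then show False
                using nth[OF b(1)] P_lt[OF m(1)] by (auto split: if_splits)
            qed
            then have "C ! s \<noteq> C ! t"
              using T(2) sT tT by (auto dest: inj_onD)
            then have "?u' ! k = u ! k" if "k < length C" "C ! k = C ! s" for k
              using nth[OF that(1)] that b mt[OF sT] by auto
            then show "s \<in> E u - {t}"
              using s \<open>s \<noteq> t\<close> by (auto simp: E_def)
          qed
          then have "E ?u' \<subset> E u"
            using t by auto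
          then show "card (E ?u') * N + card (C0 - letter_positions c ?u') < card (E u) * N + card (C0 - ?P)"
            using finE by (intro measure psubset_card_mono)
        qed (use lu card' b P_lt[OF m(1)] in auto)
        have "t \<noteq> m"
          using tT m TS by auto
        moreover have "R ! t = R ! m"
          using T_lt[OF tT] S_lt[OF m(2)] by simp
        ultimately have "?y u = (\<Sum>b | b < length C \<and> C ! b = C ! t. ?y (permute_list (transpose m b) u))"
          using T_lt[OF tT] by (intro exchange_relation[OF sym len lu P_lt(1)[OF m(1)] Sg(2)[OF m(2)]])
        also have "\<dots> = 0"
          by (rule sum.neutral) (use 0 in blast)
        finally show ?thesis .
      next
        case E: True
        have hit: "\<exists>k\<in>?P. C ! k = C ! t" if "t \<in> T" for t
          using E that lu by (auto simp: E_def letter_positions_def)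
        show ?thesis
        proof (cases "T \<subseteq> ?P")
          case False
          then obtain t where t: "t \<in> T" "t \<notin> ?P" by blast
          obtain k where k: "k \<in> ?P" "C ! k = C ! t"
            using hit[OF t(1)] by blast
          have kt: "k \<noteq> t" "k < length C" "t < length C"
            using k t P_lt T_lt by auto
          have kC0: "k \<notin> C0"
          proof
            assume "k \<in> C0"
            then consider "k \<in> T" | "k \<in> Sg"
              using C0 by blast
            then show False
            proof cases
              case 1
              then show ?thesis
                using T(2) k(2) t(1) kt by (auto dest: inj_onD)
            next
              case 2
              then show ?thesis
                using Sg(2)[of k t] k(2) kt by simp
            qed
          qed
          \<comment> \<open>A swap inside the column moves \<open>c\<close> to the box
            \<open>t\<close> in \<open>C0\<close>, at the cost of a sign.\<close>
          let ?u' = "permute_list (transpose k t) u"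
          have P': "letter_positions c ?u' = insert t (?P - {k})"
            using letter_positions_transpose[of k u t c] kt lu k t by (auto simp: transpose_def split: if_splits)
          have "E ?u' = {}"
          proof -
            have "s \<notin> E ?u'" if s: "s \<in> T" for s
            proof -
              obtain b where b: "b \<in> ?P" "C ! b = C ! s"
                using hit[OF s] by blast
              show ?thesis
              proof (cases "b = k")
                case True
                then have "C ! t = C ! s" "t \<in> letter_positions c ?u'"
                  using b k P' by auto
                then show ?thesis
                  using kt lu by (auto simp: E_def letter_positions_def)
              next
                case False
                then have "b \<in> letter_positions c ?u'"
                  using b P' by auto
                then show ?thesis
                  using b lu by (auto simp: E_def letter_positions_def)
              qed
            qed
            then show ?thesis
              by (auto simp: E_def)
          qed
          moreover have "C0 - letter_positions c ?u' \<subset> C0 - ?P"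
            unfolding P' using kC0 t C0 by blast
          ultimately have "?y ?u' = 0"
            using less.hyps[of ?u'] measure'[of ?u' u] lu card' kt E by simp
          then show ?thesis
            using label_antisym_transpose[of k C t u x] kt k lu by simp
        next
          case TP: True
          show ?thesis
          proof (cases "?P = C0")
            case True
            then show ?thesis
              using van lu by simp
          next
            case False
            then obtain t where t: "t \<in> C0" "t \<notin> ?P"
              using less.prems(2) finC0 by (metis card_subset_eq finite_letter_positions subsetI)
            have tS: "t \<in> Sg"
              using t C0 TP by auto
            have "\<not> ?P \<subseteq> C0"
              using False less.prems(2) finC0 card_subset_eq by metis
            then obtain k where k: "k \<in> ?P" "k \<notin> C0"
              by blast
            have kS: "k \<in> Sg"
            proof (rule ccontr)
              assume "k \<notin> Sg"
              then obtain s where s: "s \<in> T" "C ! k = C ! s"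
                using cover P_lt[OF k(1)] by blast
              then have "k = s"
                using inj k(1) TP by (auto dest: inj_onD)
              then show False
                using s C0 k by auto
            qed
            have kt: "k \<noteq> t" "k < length C" "t < length C"
              using k t P_lt S_lt[OF tS] by auto
            let ?u' = "permute_list (transpose k t) u"
            have P': "letter_positions c ?u' = insert t (?P - {k})"
              using letter_positions_transpose[of k u t c] kt lu k t by (auto simp: transpose_def split: if_splits)
            have "T \<subseteq> letter_positions c ?u'"
              unfolding P' using TP kS TS by blast
            then have "E ?u' = {}"
              using lu T_lt by (auto simp: E_def letter_positions_def)
            moreover have "C0 - letter_positions c ?u' \<subset> C0 - ?P"
              unfolding P' using k t by blast
            ultimately have "?y ?u' = 0"
              using less.hyps[of ?u'] measure'[of ?u' u] lu card' kt E by simp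
            \<comment> \<open>Between two columns of height one the exchange relation has a single
              term: the swap does not change the value.\<close>
            moreover have "{b. b < length C \<and> C ! b = C ! t} = {t}"
              using Sg(2)[OF tS] kt by auto
            moreover have "?y u = (\<Sum>b | b < length C \<and> C ! b = C ! t. ?y (permute_list (transpose k b) u))"
              using kt S_lt[OF tS] S_lt[OF kS]
              by (intro exchange_relation[OF sym len lu kt(2) Sg(2)[OF kS]]) auto
            ultimately show ?thesis
              by simp
          qed
        qed
      qed
    qed
  qed
qed

section \<open>The extended partitions\<close>

lemma truncate_ones_zero: "truncate_ones q 0 = 0"
  by (simp add: truncate_ones_def fun_eq_iff)

lemma weyl_module_eq_label_weyl:
  assumes "la \<in> partitions n r"
  shows "weyl_module n r la = label_weyl n (map fst (boxes n la)) (map snd (boxes n la))"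
  using assms by (simp add: weyl_module_def label_weyl_def col_antisym_eq row_stabilizer_eq length_boxes)

lemma schur_submodule_place_perm:
  fixes M :: "'k::field tensor set"
  assumes M: "schur_submodule n r M" and \<sigma>: "\<sigma> permutes {..<r}"
  shows "schur_submodule n r (place_perm \<sigma> ` M)"
proof -
  have MT: "M \<subseteq> tensor_power n r" and M0: "0 \<in> M"
    and M1: "\<And>x y. x \<in> M \<Longrightarrow> y \<in> M \<Longrightarrow> x + y \<in> M" "\<And>c x. x \<in> M \<Longrightarrow> tscale c x \<in> M"
      "\<And>\<phi> x. \<phi> \<in> schur_algebra n r \<Longrightarrow> x \<in> M \<Longrightarrow> \<phi> x \<in> M"
    using M by (auto simp: schur_submodule_def)
  show ?thesis
    unfolding schur_submodule_def
  proof (intro conjI ballI allI)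
    show "place_perm \<sigma> ` M \<subseteq> tensor_power n r"
      using MT \<sigma> by (auto intro: place_perm_tensor_power)
    show "0 \<in> place_perm \<sigma> ` M"
      using M0 by (rule image_eqI[rotated]) (simp add: place_perm_zero)
  next
    fix x y assume "x \<in> place_perm \<sigma> ` M" "y \<in> place_perm \<sigma> ` M"
    then show "x + y \<in> place_perm \<sigma> ` M"
      using M1(1) by (auto simp flip: place_perm_add)
  next
    fix c x assume "x \<in> place_perm \<sigma> ` M"
    then show "tscale c x \<in> place_perm \<sigma> ` M"
      using M1(2) by (auto simp flip: place_perm_tscale)
  next
    fix \<phi> :: "'k tensor \<Rightarrow> 'k tensor" and x
    assume "\<phi> \<in> schur_algebra n r" "x \<in> place_perm \<sigma> ` M"
    then show "\<phi> x \<in> place_perm \<sigma> ` M"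
      using M1(3) MT \<sigma> by (auto simp: schur_algebra_place_perm subset_iff)
  qed
qed

lemma primitive_vectors_place_perm_bij:
  assumes M: "M \<subseteq> tensor_power n r" and \<sigma>: "\<sigma> permutes {..<r}"
  shows "bij_betw (place_perm \<sigma>) (primitive_vectors n r la M) (primitive_vectors n r la (place_perm \<sigma> ` M))"
proof (rule bij_betw_byWitness[where f' = "place_perm (inv \<sigma>)"])
  have T: "place_perm \<sigma> ` M \<subseteq> tensor_power n r"
    using M \<sigma> by (auto intro: place_perm_tensor_power)
  have inv: "place_perm (inv \<sigma>) (place_perm \<sigma> x) = x" if "x \<in> M" for x
    using that M place_perm_inverse(2)[OF \<sigma>] by blast
  then have MM: "place_perm (inv \<sigma>) ` place_perm \<sigma> ` M = M"
    by (force simp: image_image)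
  show "\<forall>x\<in>primitive_vectors n r la M. place_perm (inv \<sigma>) (place_perm \<sigma> x) = x"
    using inv by (simp add: primitive_vectors_def)
  show "\<forall>x\<in>primitive_vectors n r la (place_perm \<sigma> ` M). place_perm \<sigma> (place_perm (inv \<sigma>) x) = x"
    using place_perm_inverse(1)[OF \<sigma>] T by (auto simp: primitive_vectors_def)
  show "place_perm \<sigma> ` primitive_vectors n r la M \<subseteq> primitive_vectors n r la (place_perm \<sigma> ` M)"
    using primitive_vectors_place_perm[OF M \<sigma>] by blast
  show "place_perm (inv \<sigma>) ` primitive_vectors n r la (place_perm \<sigma> ` M) \<subseteq> primitive_vectors n r la M"
    using primitive_vectors_place_perm[OF T permutes_inv[OF \<sigma>]] MM by auto
qed

lemma extended_partition:
  assumes la: "la \<in> partitions n r" and n: "n > 0"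
  shows "la(1 := la 1 + q) \<in> partitions n (r + q)"
proof -
  have "(\<Sum>i = 1..n. (la(1 := la 1 + q)) i) = (\<Sum>i = 1..n. la i + (if i = 1 then q else 0))"
    by (rule sum.cong) auto
  also have "\<dots> = (\<Sum>i = 1..n. la i) + q"
    using n by (simp add: sum.distrib)
  finally show ?thesis
    using la n by (auto simp: partitions_def trans_le_add1)
qed

lemma mset_boxes_extended:
  assumes n: "n > 0"
  shows "mset (boxes n (mu(1 := mu 1 + q))) =
    mset (boxes n mu @ map (Pair 1) [Suc (mu 1)..<Suc (mu 1 + q)])"
proof (rule set_eq_iff_mset_eq_distinct[THEN iffD1])
  show "distinct (boxes n mu @ map (Pair 1) [Suc (mu 1)..<Suc (mu 1 + q)])"
    by (auto simp: distinct_boxes set_boxes distinct_map inj_on_def simp del: upt_Suc)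
  show "set (boxes n (mu(1 := mu 1 + q))) = set (boxes n mu @ map (Pair 1) [Suc (mu 1)..<Suc (mu 1 + q)])"
    using n by (auto simp: set_boxes image_iff simp del: upt_Suc split: if_splits)
qed (rule distinct_boxes)

text \<open>Weight bookkeeping: the operator adds \<open>t\<close> to the part \<open>i\<close> and
  takes \<open>t\<close> away from the part \<open>Suc i\<close>. Stated on words, undoing the
  change at \<open>S\<close> must give a word of weight \<open>la\<close>.\<close>

lemma raising_op_support:
  assumes v: "\<And>u. u \<notin> weight_words r la \<Longrightarrow> v u = 0" and nz: "raising_op n r i t v u \<noteq> 0"
  shows "t \<le> la (Suc i)" "card (letter_positions i u) = la i + t"
    "c \<noteq> i \<Longrightarrow> c \<noteq> Suc i \<Longrightarrow> card (letter_positions c u) = la c"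
proof -
  obtain S where S: "S \<subseteq> letter_positions i u" "card S = t" "v (change_letters S (Suc i) u) \<noteq> 0"
    using nz by (auto simp: raising_op_def split: if_splits elim: sum.not_neutral_contains_not_neutral)
  let ?w = "change_letters S (Suc i) u"
  have w: "card (letter_positions c ?w) = la c" for c
    using S(3) v by (auto simp: card_letter_positions weight_words_def)
  have fin: "finite S"
    using S(1) finite_subset finite_letter_positions by blast
  have "S \<subseteq> letter_positions (Suc i) ?w"
    using S(1) by (auto simp: letter_positions_def)
  then show "t \<le> la (Suc i)"
    using w[of "Suc i"] S(2) card_mono[OF finite_letter_positions] by metis
  have "letter_positions i ?w = letter_positions i u - S"
    by (auto simp: letter_positions_def split: if_splits)
  then have "la i = card (letter_positions i u) - t"
    using w[of i] S fin by (simp add: card_Diff_subset)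
  moreover have "t \<le> card (letter_positions i u)"
    using S card_mono[OF finite_letter_positions] by metis
  ultimately show "card (letter_positions i u) = la i + t"
    by simp
  assume "c \<noteq> i" "c \<noteq> Suc i"
  then have "letter_positions c ?w = letter_positions c u"
    using S(1) by (auto simp: letter_positions_def split: if_splits)
  then show "card (letter_positions c u) = la c"
    using w[of c] by simp
qed

text \<open>Either too few letters 2 are available for raising, or the result would have more
  letters 1 than there are columns. These are the two alternatives in the hypothesis on
  \<open>p ^ d\<close>.\<close>

lemma raising_op_1_vanishes:
  assumes v: "\<And>u. u \<notin> weight_words r la \<Longrightarrow> v u = 0"
    and W: "raising_op n r 1 t v \<in> label_weyl n R C" and len: "length R = length C" "length C = r"
    and t: "la 2 < t \<or> card (set C) < la 1 + t"
  shows "raising_op n r 1 t v = 0"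
proof (rule ccontr)
  assume "raising_op n r 1 t v \<noteq> 0"
  then obtain u where u: "raising_op n r 1 t v u \<noteq> 0"
    by (auto simp: fun_eq_iff)
  have "length u = r"
    using u W label_weyl_tensor_power[OF len(1), of n] len tensor_power_length by blast
  moreover have "t \<le> la (Suc 1)" "card (letter_positions 1 u) = la 1 + t"
    by (rule raising_op_support[OF v u]; assumption)+
  then have "card (set C) < card (letter_positions 1 u)"
    using t by (auto simp: numeral_2_eq_2)
  ultimately have "label_antisym C x u = 0" for x :: "'a tensor"
    using len by (intro label_antisym_eq_0_of_card) auto
  then show False
    using u W by (auto simp: label_weyl_def)
qed

text \<open>An application of \<open>vanishing_test\<close> to the letter 1 in the first row. The
  parameter \<open>k\<close> is free because the lemma serves both for primitive vectors, with
  \<open>k = la 1\<close>, and for their images under raising operators, with up to \<open>t\<close>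
  more ones.\<close>

lemma truncate_ones_injective:
  fixes y :: "'k::field tensor"
  assumes mu: "mu \<in> partitions n r" and n: "n > 0"
    and L: "L = boxes n mu @ map (Pair 1) [Suc (mu 1)..<Suc (mu 1 + q)]"
    and y: "y \<in> label_weyl n (map fst L) (map snd L)"
    and supp: "\<And>u. y u \<noteq> 0 \<Longrightarrow> card (letter_positions 1 u) = k + q" and k: "mu 2 \<le> k"
    and trunc: "truncate_ones q y = 0"
  shows "y = 0"
proof -
  define R C where "R = map fst L" and "C = map snd L"
  have lenb: "length (boxes n mu) = r"
    by (rule length_boxes[OF mu])
  have len: "length L = r + q" "length R = r + q" "length C = r + q"
    by (simp_all add: L lenb R_def C_def del: upt_Suc)
  have dist: "distinct L"
    by (auto simp: L distinct_boxes set_boxes distinct_map inj_on_def simp del: upt_Suc)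
  have setL: "set L = set (boxes n (mu(1 := mu 1 + q)))"
    using mset_boxes_extended[OF n, of mu q] unfolding L by (rule mset_eq_setD[symmetric])
  have mem: "(i, j) \<in> set L \<longleftrightarrow> 1 \<le> i \<and> i \<le> n \<and> 1 \<le> j \<and> j \<le> (if i = 1 then mu 1 + q else mu i)" for i j
    by (auto simp: setL set_boxes)
  have L_eq: "p = p'" if "p < r + q" "p' < r + q" "L ! p = L ! p'" for p p'
    using that dist len by (simp add: nth_eq_iff_index_eq)
  have R_nth: "R ! p = fst (L ! p)" and C_nth: "C ! p = snd (L ! p)" if "p < r + q" for p
    using that len by (auto simp: R_def C_def)
  have L_mem: "(R ! p, C ! p) \<in> set L" if "p < r + q" for p
    using that len nth_mem[of p L] by (simp add: R_nth C_nth)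
  have pos: "\<exists>p<r + q. R ! p = i \<and> C ! p = j" if "(i, j) \<in> set L" for i j
    using that len R_nth C_nth by (metis fst_conv in_set_conv_nth snd_conv)
  have RC_eq: "p = p'" if "p < r + q" "p' < r + q" "R ! p = R ! p'" "C ! p = C ! p'" for p p'
    using that L_eq by (simp add: R_nth C_nth prod_eq_iff)
  have mu_le: "mu i \<le> mu 2" if "2 \<le> i" for i
    using that by (intro partitions_mono[OF mu]) auto
  have row1: "R ! p = 1" if "p < r + q" "mu 2 < C ! p" for p
    using L_mem[OF that(1)] that(2) mu_le[of "R ! p"] by (auto simp: mem split: if_splits)
  have new: "R ! p = 1" "C ! p = Suc (mu 1) + (p - r)" if "r \<le> p" "p < r + q" for p
    using that lenb by (simp_all add: R_nth C_nth, simp_all add: L nth_append del: upt_Suc)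
  obtain x where x: "\<And>\<sigma>. \<sigma> \<in> label_stab R \<Longrightarrow> place_perm \<sigma> x = x" "x \<in> tensor_power n (r + q)"
    and yx: "y = label_antisym C x"
    using y len by (auto simp: label_weyl_def R_def C_def)
  have yT: "y \<in> tensor_power n (r + q)"
    using label_antisym_tensor_power[of x n C] x(2) yx len by simp
  have "y u = 0" for u
  proof (rule ccontr)
    assume nz: "y u \<noteq> 0"
    have lu: "length u = length C"
      using tensor_power_length[OF yT nz] len by simp
    have card_u: "card (letter_positions 1 u) = k + q"
      by (rule supp[OF nz])
    show False
    proof (cases "k \<le> mu 1")
      \<comment> \<open>More than \<open>mu 1 + q\<close> letters 1 do not fit into
        \<open>mu 1 + q\<close> columns.\<close>
      case False
      have "set C \<subseteq> {1..mu 1 + q}"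
      proof
        fix j assume "j \<in> set C"
        then obtain i where "(i, j) \<in> set L"
          by (auto simp: C_def)
        moreover have "mu i \<le> mu 1" if "1 \<le> i"
          using that by (intro partitions_mono[OF mu]) auto
        ultimately show "j \<in> {1..mu 1 + q}"
          by (fastforce simp: mem split: if_splits)
      qed
      then have "card (set C) \<le> mu 1 + q"
        using card_mono[of "{1..mu 1 + q}" "set C"] by simp
      then show False
        using label_antisym_eq_0_of_card[OF lu, of 1 x] card_u False nz yx by simp
    next
      case True
      define T where "T = {p. p < r + q \<and> R ! p = 1 \<and> C ! p \<le> mu 2}"
      define Sg where "Sg = {p. p < r + q \<and> R ! p = 1 \<and> mu 2 < C ! p}"
      \<comment> \<open>The first \<open>k\<close> old boxes of the row and all \<open>q\<close> new
        ones. They include the tops of all tall columns because \<open>mu 2 \<le> k\<close>, and a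
        word with its ones exactly here ends in \<open>q\<close> ones, so truncation determines the
        coefficient.\<close>
      define C0 where "C0 = {p. p < r + q \<and> R ! p = 1 \<and> (C ! p \<le> k \<or> mu 1 < C ! p)}"
      have "bij_betw (\<lambda>p. C ! p) C0 ({1..k} \<union> {Suc (mu 1)..mu 1 + q})"
        unfolding bij_betw_def
      proof
        show "inj_on (\<lambda>p. C ! p) C0"
          by (rule inj_onI) (auto simp: C0_def intro: RC_eq)
        show "(\<lambda>p. C ! p) ` C0 = {1..k} \<union> {Suc (mu 1)..mu 1 + q}"
        proof (intro equalityI subsetI)
          fix j assume "j \<in> (\<lambda>p. C ! p) ` C0"
          then obtain p where p: "p \<in> C0" "j = C ! p" by blast
          then show "j \<in> {1..k} \<union> {Suc (mu 1)..mu 1 + q}"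
            using L_mem[of p] by (auto simp: C0_def mem)
        next
          fix j assume j: "j \<in> {1..k} \<union> {Suc (mu 1)..mu 1 + q}"
          then have "(1, j) \<in> set L"
            using n True by (auto simp: mem)
          then obtain p where "p < r + q" "R ! p = 1" "C ! p = j"
            using pos by blast
          then show "j \<in> (\<lambda>p. C ! p) ` C0"
            using j by (intro image_eqI[of _ _ p]) (auto simp: C0_def)
        qed
      qed
      then have "card C0 = card ({1..k} \<union> {Suc (mu 1)..mu 1 + q})"
        by (rule bij_betw_same_card)
      also have "\<dots> = k + q"
        using True by (subst card_Un_disjoint) auto
      finally have card_C0: "card C0 = k + q" .
      have "label_antisym C x u = 0"
      proof (rule vanishing_test[where T = T and Sg = Sg and ?C0.0 = C0 and a = 1 and c = 1, OF x(1)])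
        show "length R = length C" by (simp add: len)
        show "T \<subseteq> {k. k < length C \<and> R ! k = 1}" "Sg \<subseteq> {k. k < length C \<and> R ! k = 1}"
          by (auto simp: T_def Sg_def len)
        show "inj_on (\<lambda>k. C ! k) T"
          by (rule inj_onI) (auto simp: T_def intro: RC_eq)
        show "T \<inter> Sg = {}"
          by (auto simp: T_def Sg_def)
        show "T \<subseteq> C0" "C0 \<subseteq> T \<union> Sg"
          using k by (auto simp: T_def Sg_def C0_def)
        show "p = m" if "m \<in> Sg" "p < length C" "C ! p = C ! m" for m p
        proof (rule RC_eq)
          show "p < r + q" "m < r + q" "C ! p = C ! m"
            using that by (simp_all add: Sg_def len)
          then show "R ! p = R ! m"
            using row1[of p] that(1) by (simp add: Sg_def)
        qed
        show "p \<in> Sg \<or> (\<exists>t\<in>T. C ! p = C ! t)" if p: "p < length C" for p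
        proof (cases "mu 2 < C ! p")
          case True
          then show ?thesis
            using p row1[of p] by (simp add: Sg_def len)
        next
          case False
          have "mu 2 \<le> mu 1"
            by (intro partitions_mono[OF mu]) auto
          then have "(1, C ! p) \<in> set L"
            using False n L_mem[of p] p by (auto simp: mem len)
          then obtain t where "t < r + q" "R ! t = 1" "C ! t = C ! p"
            using pos by blast
          then show ?thesis
            using False by (intro disjI2 bexI[of _ t]) (auto simp: T_def)
        qed
        show "label_antisym C x w = 0" if w: "length w = length C" "letter_positions 1 w = C0" for w
        proof -
          have "w = take r w @ replicate q 1"
          proof (rule nth_equalityI)
            fix p assume "p < length w"
            then have p: "p < r + q"
              using w len by simp
            show "w ! p = (take r w @ replicate q 1) ! p"
            proof (cases "p < r")
              case True
              then show ?thesis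
                using w len by (simp add: nth_append)
            next
              case False
              then have "R ! p = 1" "mu 1 < C ! p"
                using p new[of p] by linarith+
              then have "p \<in> C0"
                using p by (simp add: C0_def)
              then have "w ! p = 1"
                using w(2) by (auto simp: letter_positions_def)
              then show ?thesis
                using False p w(1) len by (simp add: nth_append)
            qed
          qed (simp add: w len)
          then have "y w = truncate_ones q y (take r w)"
            by (simp add: truncate_ones_def)
          then show ?thesis
            using trunc yx by simp
        qed
        show "length u = length C" by (rule lu)
        show "card (letter_positions 1 u) = card C0"
          using card_u card_C0 by simp
      qed
      then show False
        using nz yx by simp
    qed
  qed
  then show ?thesis
    by (simp add: fun_eq_iff)
qed

lemma truncate_primitive_bij:
  fixes n q :: nat
  defines "Y \<equiv> \<lambda>L. label_weyl n (map fst L) (map snd L) :: 'k::field tensor set"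
  assumes la: "la \<in> partitions n r" and mu: "mu \<in> partitions n r" and n: "n > 0"
    and L: "L = boxes n mu @ map (Pair 1) [Suc (mu 1)..<Suc (mu 1 + q)]"
    and sub: "schur_submodule n (r + q) (Y L)"
    and mu2: "mu 2 \<le> la 1" and q: "la 2 < q \<or> mu 1 < la 1 + q"
    and choose: "\<And>j. 0 < j \<Longrightarrow> j < q \<Longrightarrow> of_nat (q choose j) = (0 :: 'k)"
  shows "bij_betw (truncate_ones q) (primitive_vectors n (r + q) (la(1 := la 1 + q)) (Y L))
    (primitive_vectors n r la (Y (boxes n mu)))"
proof -
  let ?la = "la(1 := la 1 + q)" and ?Y = "Y L" and ?Z = "Y (boxes n mu)"
  define R C D where "R = map fst (boxes n mu)" and "C = map snd (boxes n mu)" and "D = [Suc (mu 1)..<Suc (mu 1 + q)]"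
  have Zeq: "?Z = weyl_module n r mu"
    by (simp add: Y_def weyl_module_eq_label_weyl[OF mu])
  have Zsub: "schur_submodule n r ?Z"
    unfolding Zeq by (rule schur_submodule_weyl_module)
  have len: "length (boxes n mu) = r" "length R = length C" "length C = r" "length D = q"
    by (simp_all add: R_def C_def D_def length_boxes[OF mu] del: upt_Suc)
  have setC: "set C \<subseteq> {1..mu 1}"
  proof
    fix j assume "j \<in> set C"
    then obtain i where "(i, j) \<in> set (boxes n mu)"
      by (auto simp: C_def)
    moreover have "mu i \<le> mu 1" if "1 \<le> i"
      using that by (intro partitions_mono[OF mu]) auto
    ultimately show "j \<in> {1..mu 1}"
      by (fastforce simp: set_boxes)
  qed
  have D: "distinct D" "set C \<inter> set D = {}"
    using setC by (auto simp: D_def simp del: upt_Suc)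
  have fstL: "map fst L = R @ replicate q 1"
    by (simp add: L R_def comp_def map_replicate_const del: upt_Suc)
  have sndL: "map snd L = C @ D"
    by (simp add: L C_def D_def comp_def del: upt_Suc)
  have ZRC: "?Z = label_weyl n R C"
    by (simp add: Y_def R_def C_def)
  have YRC: "?Y = label_weyl n (R @ replicate q 1) (C @ D)"
    unfolding Y_def fstL sndL ..
  have YT: "?Y \<subseteq> tensor_power n (r + q)" and ZT: "?Z \<subseteq> tensor_power n r"
    using sub Zsub by (auto simp: schur_submodule_def)
  have tr: "truncate_ones q ` ?Y = ?Z"
    unfolding YRC ZRC by (rule truncate_label_weyl) (use n len D in auto)
  have comm: "truncate_ones q (raising_op n (r + q) i t w) = raising_op n r i t (truncate_ones q w)"
    if "w \<in> ?Y" "1 \<le> i" "i < n" "i \<noteq> 1 \<or> t < q" for w i t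
  proof (rule truncate_raising_op)
    show "place_perm \<tau> w = w" if "\<tau> permutes {r..<r + q}" for \<tau>
      using label_weyl_new_symmetric[OF len(2) D len(4), of w n 1 \<tau>] that \<open>w \<in> ?Y\<close> len YRC by simp
  qed (use that YT choose in auto)
  have weights: "u @ replicate q 1 \<in> weight_words (r + q) ?la \<longleftrightarrow> u \<in> weight_words r la" for u
  proof -
    have "count_list (u @ replicate q 1) i = count_list u i + (if i = 1 then q else 0)" for i
      by (induction q) auto
    then show ?thesis
      by (auto simp: weight_words_def split: if_splits)
  qed
  have inj: "y = 0" if y: "y \<in> ?Y" "\<And>u. y u \<noteq> 0 \<Longrightarrow> card (letter_positions 1 u) = k + q" "la 1 \<le> k"
    "truncate_ones q y = 0" for y k
    by (rule truncate_ones_injective[OF mu n L, of y k]) (use y mu2 in \<open>auto simp: Y_def\<close>)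
  have Ysub: "raising_op n (r + q) i t y \<in> ?Y" if "y \<in> ?Y" "1 \<le> i" "i < n" for y i t
    using sub that raising_op_schur[of i n "r + q" t] by (auto simp: schur_submodule_def)
  have Zsub': "raising_op n r i t y \<in> ?Z" if "y \<in> ?Z" "1 \<le> i" "i < n" for y i t
    using Zsub that raising_op_schur[of i n r t] by (auto simp: schur_submodule_def)
  have "set (C @ D) \<subseteq> {1..mu 1 + q}"
    using setC by (auto simp: D_def simp del: upt_Suc)
  then have cardC: "card (set C) \<le> mu 1" "card (set (C @ D)) \<le> mu 1 + q"
    using card_mono[OF _ setC] card_mono[of "{1..mu 1 + q}" "set (C @ D)"] by simp_all
  \<comment> \<open>For \<open>t \<ge> q\<close> the coefficient \<open>q choose q = 1\<close>
    obstructs the commutation used in \<open>comm\<close>; instead both operators are shown to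
    vanish, here and in \<open>van'\<close>.\<close>
  have van: "raising_op n (r + q) 1 t y = 0" if y: "y \<in> ?Y" "\<And>u. u \<notin> weight_words (r + q) ?la \<Longrightarrow> y u = 0"
    and t: "q \<le> t" "1 < n" for y t
  proof (rule raising_op_1_vanishes[where la = ?la])
    show "y u = 0" if "u \<notin> weight_words (r + q) ?la" for u
      using that by (rule y(2))
    show "raising_op n (r + q) 1 t y \<in> label_weyl n (R @ replicate q 1) (C @ D)"
      using Ysub[OF y(1), of 1 t] t YRC by simp
    show "?la 2 < t \<or> card (set (C @ D)) < ?la 1 + t"
      using q t cardC by auto
  qed (auto simp: len)
  have van': "raising_op n r 1 t y = 0" if y: "y \<in> ?Z" "\<And>u. u \<notin> weight_words r la \<Longrightarrow> y u = 0"
    and t: "q \<le> t" "1 < n" for y t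
  proof (rule raising_op_1_vanishes[where la = la])
    show "y u = 0" if "u \<notin> weight_words (r) la" for u
      using that by (rule y(2))
    show "raising_op n (r) 1 t y \<in> label_weyl n (R) (C)"
      using Zsub'[OF y(1), of 1 t] t ZRC by simp
    show "la 2 < t \<or> card (set C) < la 1 + t"
      using q t cardC by auto
  qed (auto simp: len)
  have card1: "card (letter_positions 1 u) = la 1 + q" if "u \<in> weight_words (r + q) ?la" for u
    using that by (simp add: card_letter_positions weight_words_def)
  show ?thesis
    unfolding bij_betw_def
  proof (intro conjI equalityI)
    show "inj_on (truncate_ones q) (primitive_vectors n (r + q) ?la ?Y)"
    proof (rule inj_onI)
      fix y z assume y: "y \<in> primitive_vectors n (r + q) ?la ?Y" and z: "z \<in> primitive_vectors n (r + q) ?la ?Y"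
        and eq: "truncate_ones q y = truncate_ones q z"
      let ?d = "y + tscale (- 1) z"
      have d: "?d \<in> primitive_vectors n (r + q) ?la ?Y"
        using y z by (intro primitive_vectors_add primitive_vectors_scale sub)
      have "?d = 0"
      proof (rule inj)
        show "truncate_ones q ?d = 0"
          using eq by (simp add: truncate_ones_add truncate_ones_tscale) (simp add: fun_eq_iff)
        show "card (letter_positions 1 u) = la 1 + q" if "?d u \<noteq> 0" for u
          using d that card1 unfolding primitive_vectors_def by blast
      qed (use d in \<open>auto simp: primitive_vectors_def\<close>)
      then show "y = z"
        by (simp add: fun_eq_iff)
    qed
    show "truncate_ones q ` primitive_vectors n (r + q) ?la ?Y \<subseteq> primitive_vectors n r la ?Z"
    proof (rule image_subsetI)
      fix y assume "y \<in> primitive_vectors n (r + q) ?la ?Y"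
      then have y: "y \<in> ?Y" "\<And>u. u \<notin> weight_words (r + q) ?la \<Longrightarrow> y u = 0"
        "\<And>i t. 1 \<le> i \<Longrightarrow> i < n \<Longrightarrow> 1 \<le> t \<Longrightarrow> raising_op n (r + q) i t y = 0"
        by (auto simp: primitive_vectors_def)
      have Z: "truncate_ones q y \<in> ?Z"
        using y(1) tr by blast
      have w: "truncate_ones q y u = 0" if "u \<notin> weight_words r la" for u
        using y(2) weights that by (simp add: truncate_ones_def)
      have "raising_op n r i t (truncate_ones q y) = 0" if it: "1 \<le> i" "i < n" "1 \<le> t" for i t
      proof (cases "i \<noteq> 1 \<or> t < q")
        case True
        then show ?thesis
          using comm[OF y(1) it(1,2) True] y(3)[OF it] by (metis truncate_ones_zero)
      next
        case False
        then show ?thesis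
          using van'[OF Z w] it by simp
      qed
      then show "truncate_ones q y \<in> primitive_vectors n r la ?Z"
        using Z w by (auto simp: primitive_vectors_def)
    qed
    show "primitive_vectors n r la ?Z \<subseteq> truncate_ones q ` primitive_vectors n (r + q) ?la ?Y"
    proof
      fix v assume "v \<in> primitive_vectors n r la ?Z"
      then have v: "v \<in> ?Z" "\<And>u. u \<notin> weight_words r la \<Longrightarrow> v u = 0"
        "\<And>i t. 1 \<le> i \<Longrightarrow> i < n \<Longrightarrow> 1 \<le> t \<Longrightarrow> raising_op n r i t v = 0"
        by (auto simp: primitive_vectors_def)
      have "v \<in> truncate_ones q ` ?Y"
        unfolding tr by (rule v(1))
      then obtain y0 where "v = truncate_ones q y0" and y0Y: "y0 \<in> ?Y"
        by (rule imageE)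
      then have y0: "y0 \<in> ?Y" "truncate_ones q y0 = v"
        by simp_all
      \<comment> \<open>An arbitrary preimage may have components of other weights. Cutting them off
        does not affect the truncation, because by \<open>weights\<close> appending \<open>q\<close>
        ones matches weight \<open>la\<close> with the extended weight.\<close>
      define y where "y = weight_proj n (r + q) ?la y0"
      have yY: "y \<in> ?Y"
        using sub y0 weight_proj_schur[of n "r + q" ?la] by (auto simp: y_def schur_submodule_def)
      have y_apply: "y u = (if u \<in> weight_words (r + q) ?la then y0 u else 0)" for u
        using y0 YT by (auto simp: y_def weight_proj_def)
      have tv: "truncate_ones q y = v"
      proof
        fix u
        show "truncate_ones q y u = v u"
          using v(2)[of u] fun_cong[OF y0(2), of u] weights[of u]
          by (auto simp: truncate_ones_def y_apply simp del: fun_upd_apply)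
      qed
      have "raising_op n (r + q) i t y = 0" if it: "1 \<le> i" "i < n" "1 \<le> t" for i t
      proof (cases "i \<noteq> 1 \<or> t < q")
        case True
        show ?thesis
        proof (rule inj)
          show "raising_op n (r + q) i t y \<in> ?Y"
            using Ysub[OF yY] it by simp
          show "truncate_ones q (raising_op n (r + q) i t y) = 0"
            using comm[OF yY it(1,2) True] tv v(3)[OF it] by simp
          \<comment> \<open>For \<open>i = 1\<close> the raised vector has \<open>t\<close>
            additional ones, so \<open>inj\<close> is applied with \<open>k = la 1 + t\<close>; for
            larger \<open>i\<close> the number of ones is unchanged.\<close>
          show "card (letter_positions 1 u) = (la 1 + (if i = 1 then t else 0)) + q"
            if nz: "raising_op n (r + q) i t y u \<noteq> 0" for u
            using raising_op_support(2)[OF _ nz, of ?la] raising_op_support(3)[OF _ nz, of ?la 1] it y_apply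
            by auto
        qed simp
      next
        case False
        then show ?thesis
          using van[OF yY] y_apply it by simp
      qed
      then have "y \<in> primitive_vectors n (r + q) ?la ?Y"
        using yY y_apply by (auto simp: primitive_vectors_def)
      then show "v \<in> truncate_ones q ` primitive_vectors n (r + q) ?la ?Y"
        using tv by blast
    qed
  qed
qed

theorem theorem6p1:
  fixes n r d p :: nat and la mu :: "nat \<Rightarrow> nat"
  assumes "infinite (UNIV :: 'k::field set)"
    and "CHAR('k) = p" and "p > 0"
    and "n > 0" and "r > 0" and "d > 0"
    and "la \<in> partitions n r" and "mu \<in> partitions n r"
    and "int (p ^ d) > min (int (la 2)) (int (mu 1) - int (la 1))"
    and "mu 2 \<le> la 1"
  shows "vs_isomorphic (hom_scale :: 'k \<Rightarrow> _) hom_scale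
    (schur_hom n r (weyl_module n r la) (weyl_module n r mu))
    (schur_hom n (r + p ^ d)
      (weyl_module n (r + p ^ d) (la(1 := la 1 + p ^ d)))
      (weyl_module n (r + p ^ d) (mu(1 := mu 1 + p ^ d))))"
proof -
  define q where "q = p ^ d"
  let ?la = "la(1 := la 1 + q)" and ?mu = "mu(1 := mu 1 + q)"
  \<comment> \<open>In the reading order of the extended diagram the new boxes come at the end of
    the first row, before all lower rows. Truncation wants them last, so the boxes are relisted and
    \<open>\<rho>\<close> compares the two orders.\<close>
  define L where "L = boxes n mu @ map (Pair 1) [Suc (mu 1)..<Suc (mu 1 + q)]"
  define Y :: "'k tensor set" where "Y = label_weyl n (map fst L) (map snd L)"
  let ?M = "weyl_module n r mu :: 'k tensor set" and ?M' = "weyl_module n (r + q) ?mu :: 'k tensor set"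
  let ?z = "highest_weight_vector n r la :: 'k tensor"
    and ?z' = "highest_weight_vector n (r + q) ?la :: 'k tensor"
  have la': "?la \<in> partitions n (r + q)" and mu': "?mu \<in> partitions n (r + q)"
    by (rule extended_partition[OF assms(7,4)], rule extended_partition[OF assms(8,4)])
  have lenb: "length (boxes n ?mu) = r + q"
    by (rule length_boxes[OF mu'])
  have "mset L = mset (boxes n ?mu)"
    unfolding L_def using mset_boxes_extended[of n mu q] assms by simp
  then obtain \<rho> where \<rho>: "\<rho> permutes {..<r + q}" "permute_list \<rho> (boxes n ?mu) = L"
    using mset_eq_permutation[of L "boxes n ?mu"] lenb by metis
  have Y_eq: "Y = place_perm (inv \<rho>) ` ?M'"
  proof -
    have "map f L = permute_list \<rho> (map f (boxes n ?mu))" for f :: "nat \<times> nat \<Rightarrow> nat"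
      using permute_list_map[of \<rho> "boxes n ?mu" f] \<rho> lenb by metis
    then show ?thesis
      unfolding Y_def weyl_module_eq_label_weyl[OF mu']
      using label_weyl_conjugate[of \<rho> "map snd (boxes n ?mu)" "map fst (boxes n ?mu)" n] \<rho>(1) lenb
      by (metis length_map)
  qed
  have M': "schur_submodule n (r + q) ?M'" and M: "schur_submodule n r ?M"
    by (rule schur_submodule_weyl_module)+
  note \<rho>i = permutes_inv[OF \<rho>(1)]
  have sub: "schur_submodule n (r + q) Y"
    unfolding Y_eq by (rule schur_submodule_place_perm[OF M' \<rho>i])
  have "bij_betw (truncate_ones q) (primitive_vectors n (r + q) ?la Y) (primitive_vectors n r la ?M)"
    unfolding Y_def weyl_module_eq_label_weyl[OF assms(8)]
  proof (rule truncate_primitive_bij[OF assms(7,8,4) L_def _ assms(10)])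
    \<comment> \<open>The difference in the hypothesis is an integer, so \<open>mu 1 < la 1\<close>
      falls under the second alternative.\<close>
    show "la 2 < q \<or> mu 1 < la 1 + q"
      using assms(9)[folded q_def] by (auto simp: min_def split: if_splits)
    show "of_nat (q choose j) = (0 :: 'k)" if "0 < j" "j < q" for j
      using of_nat_choose_prime_power_eq_0[OF assms(2,3) that(1)] that(2) by (simp add: q_def)
  qed (use sub Y_def in simp)
  moreover have "bij_betw (place_perm (inv \<rho>)) (primitive_vectors n (r + q) ?la ?M') (primitive_vectors n (r + q) ?la Y)"
    unfolding Y_eq using M' \<rho>i
    by (intro primitive_vectors_place_perm_bij) (auto simp: schur_submodule_def)
  moreover have "bij_betw (\<lambda>f. f ?z') (schur_hom n (r + q) (weyl_module n (r + q) ?la) ?M')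
      (primitive_vectors n (r + q) ?la ?M')"
    by (rule schur_hom_primitive_bij[OF la' M'])
  \<comment> \<open>Evaluate at the highest weight vector, move the new boxes to the end, truncate.
    Each step is linear, and the composite ends in the set that evaluation at \<open>?z\<close>
    reaches from the other space of homomorphisms.\<close>
  ultimately have bij': "bij_betw (truncate_ones q \<circ> (place_perm (inv \<rho>) \<circ> (\<lambda>f. f ?z')))
      (schur_hom n (r + q) (weyl_module n (r + q) ?la) ?M') (primitive_vectors n r la ?M)"
    by (meson bij_betw_trans)
  have "vs_isomorphic (hom_scale :: 'k \<Rightarrow> _) hom_scale (schur_hom n r (weyl_module n r la) ?M)
      (schur_hom n (r + q) (weyl_module n (r + q) ?la) ?M')"
  proof (rule vs_isomorphicI[OF schur_hom_primitive_bij[OF assms(7) M] bij'])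
    fix f g :: "'k tensor \<Rightarrow> 'k tensor" and c :: 'k
    let ?H = "schur_hom n r (weyl_module n r la) ?M"
      and ?H' = "schur_hom n (r + q) (weyl_module n (r + q) ?la) ?M'"
    show "f + g \<in> ?H \<and> (f + g) ?z = f ?z + g ?z" if "f \<in> ?H" "g \<in> ?H"
      using that schur_hom_subspace(2)[OF schur_submodule_weyl_module M] by simp
    show "hom_scale c f \<in> ?H \<and> hom_scale c f ?z = tscale c (f ?z)" if "f \<in> ?H"
      using that schur_hom_subspace(3)[OF schur_submodule_weyl_module M] by simp
    show "f + g \<in> ?H' \<and> (truncate_ones q \<circ> (place_perm (inv \<rho>) \<circ> (\<lambda>f. f ?z'))) (f + g) =
        (truncate_ones q \<circ> (place_perm (inv \<rho>) \<circ> (\<lambda>f. f ?z'))) f +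
        (truncate_ones q \<circ> (place_perm (inv \<rho>) \<circ> (\<lambda>f. f ?z'))) g" if "f \<in> ?H'" "g \<in> ?H'"
      using that schur_hom_subspace(2)[OF schur_submodule_weyl_module M']
      by (simp add: place_perm_add truncate_ones_add)
    show "hom_scale c f \<in> ?H' \<and> (truncate_ones q \<circ> (place_perm (inv \<rho>) \<circ> (\<lambda>f. f ?z'))) (hom_scale c f) =
        tscale c ((truncate_ones q \<circ> (place_perm (inv \<rho>) \<circ> (\<lambda>f. f ?z'))) f)" if "f \<in> ?H'"
      using that schur_hom_subspace(3)[OF schur_submodule_weyl_module M']
      by (simp add: place_perm_tscale truncate_ones_tscale)
  qed
  then show ?thesis
    by (simp only: q_def)
qed

end
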